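(* Let $r\in(1,2)$. Let $\mu$ be a probability measure on $\mathbb{R}^d$ which satisfies the Latała–Oleszkiewicz inequality with parameter $r$ and with constant $C_{LO}$. Then there exists a constant $C>0$, depending only on $C_{LO}$ and $r$, such that for any positive integer $n$, any smooth $f\colon\mathbb{R}^{dn}\to\mathbb{R}$, and all $t>0$, $$\mu^{\otimes n}\left(\left|f-\int_{\mathbb{R}^{dn}}f\,d\mu^{\otimes n}\right|\ge t\right)\le 2\exp\left(-\frac12\min\left\{\frac{t^2}{C\sup_{x\in\mathbb{R}^{dn}}|\nabla f(x)|^2},\ \frac{t^r}{C^{r-1}\sup_{x\in(\mathbb{R}^d)^n}\|\nabla f(x)\|_{r',2}^r}\right\}\right).$$
   Context: $|\cdot|$ is the Euclidean norm. A probability measure $\mu$ on $\mathbb{R}^d$ satisfies the Latała–Oleszkiewicz inequality with parameter $r\in[1,2]$ and constant $C_{LO}<\infty$ if for every smooth $f\colon\mathbb{R}^d\to\mathbb{R}$, $$\sup_{\theta\in(1,2)}\frac{\int_{\mathbb{R}^d} f^2\,d\mu-\left(\int_{\mathbb{R}^d}|f|^\theta d\mu\right)^{2/\theta}}{(2-\theta)^{2(1-1/r)}}\le C_{LO}\int_{\mathbb{R}^d}|\nabla f|^2d\mu.$$ $r'$ is the dual exponent: $\frac1r+\frac1{r'}=1$. For $x=(x_1,\dots,x_n)\in(\mathbb{R}^d)^n$ and $p\in(1,\infty)$, $\|x\|_{p,2}=\left(\sum_{i=1}^n|x_i|^p\right)^{1/p}$, where $|x_i|$ is the Euclidean norm of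 $x_i\in\mathbb{R}^d$; $\mathbb{R}^{dn}$ is identified with $(\mathbb{R}^d)^n$. Conventions: a fraction with infinite denominator equals $0$, and one with zero denominator equals $+\infty$. *)

theory Defs
  imports "HOL-Probability.Probability"
begin

text \<open>
  The constant in the main theorem must not depend on the dimensions, so dimensions cannot be
  types here. The space \<open>\<real>\<^sup>N\<close> is the set of functions on indices \<open>0, \<dots>, N - 1\<close>, extended by
  \<^term>\<open>undefined\<close>. Its topology is the one inherited from the product topology of the function
  type (which for finitely many coordinates is the Euclidean one), and it is the space of
  \<open>borel_Rn N\<close>. Functions on \<open>\<real>\<^sup>N\<close> are HOL functions on all of \<^typ>\<open>nat \<Rightarrow> real\<close>; nothing below
  depends on their values outside \<open>Rn N\<close>.
\<close>

definition Rn :: "nat \<Rightarrow> (nat \<Rightarrow> real) set" where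
  "Rn N = (\<Pi>\<^sub>E i\<in>{..<N}. UNIV)"

definition borel_Rn :: "nat \<Rightarrow> (nat \<Rightarrow> real) measure" where
  "borel_Rn N = (\<Pi>\<^sub>M i\<in>{..<N}. borel)"

definition partial_deriv :: "nat \<Rightarrow> ((nat \<Rightarrow> real) \<Rightarrow> real) \<Rightarrow> (nat \<Rightarrow> real) \<Rightarrow> real" where
  "partial_deriv i f x = deriv (\<lambda>s. f (x(i := s))) (x i)"

definition grad :: "nat \<Rightarrow> ((nat \<Rightarrow> real) \<Rightarrow> real) \<Rightarrow> (nat \<Rightarrow> real) \<Rightarrow> (nat \<Rightarrow> real)" where
  "grad N f x = (\<lambda>i\<in>{..<N}. partial_deriv i f x)"

abbreviation euclid_norm :: "nat \<Rightarrow> (nat \<Rightarrow> real) \<Rightarrow> real" where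
  "euclid_norm N x \<equiv> L2_set x {..<N}"

text \<open>\<open>C_k N k f\<close>: all iterated partial derivatives of \<open>f\<close> of order at most \<open>k\<close> exist and are
  continuous on \<open>\<real>\<^sup>N\<close>.\<close>

primrec C_k :: "nat \<Rightarrow> nat \<Rightarrow> ((nat \<Rightarrow> real) \<Rightarrow> real) \<Rightarrow> bool" where
  "C_k N 0 f \<longleftrightarrow> continuous_on (Rn N) f"
| "C_k N (Suc k) f \<longleftrightarrow> continuous_on (Rn N) f \<and>
     (\<forall>i<N. (\<forall>x\<in>Rn N. (\<lambda>s. f (x(i := s))) differentiable at (x i)) \<and>
            C_k N k (partial_deriv i f))"

definition smooth :: "nat \<Rightarrow> ((nat \<Rightarrow> real) \<Rightarrow> real) \<Rightarrow> bool" where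
  "smooth N f \<longleftrightarrow> (\<forall>k. C_k N k f)"

definition prob_measure_on_Rn :: "nat \<Rightarrow> (nat \<Rightarrow> real) measure \<Rightarrow> bool" where
  "prob_measure_on_Rn N \<mu> \<longleftrightarrow> prob_space \<mu> \<and> sets \<mu> = sets (borel_Rn N)"

text \<open>
  The Latala-Oleszkiewicz inequality. It is required for those smooth \<open>f\<close> with
  \<open>\<integral> f\<^sup>2 d\<mu> < \<infinity>\<close>, so that its left-hand side is meaningful (then \<open>\<bar>f\<bar> powr \<theta>\<close> is integrable too,
  for every \<open>\<theta> < 2\<close>). This loses nothing: the inequality for such \<open>f\<close> contains the Poincare
  inequality (\<open>\<theta> \<rightarrow> 1\<close>, applied to \<open>f\<close> plus large constants), and by truncation every smooth \<open>f\<close>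
  with \<open>\<integral> |\<nabla>f|\<^sup>2 d\<mu> < \<infinity>\<close> is then square integrable. For other \<open>f\<close> the right-hand side is infinite.
  The numerator is nonnegative by Jensen's inequality, so \<^const>\<open>ennreal\<close> does not truncate it.
\<close>

definition LO_inequality :: "nat \<Rightarrow> real \<Rightarrow> ennreal \<Rightarrow> (nat \<Rightarrow> real) measure \<Rightarrow> bool" where
  "LO_inequality d r C_LO \<mu> \<longleftrightarrow>
     (\<forall>f. smooth d f \<and> integrable \<mu> (\<lambda>x. (f x)\<^sup>2) \<longrightarrow>
        (SUP \<theta>\<in>{1<..<2}.
           ennreal (((\<integral>x. (f x)\<^sup>2 \<partial>\<mu>) - (\<integral>x. \<bar>f x\<bar> powr \<theta> \<partial>\<mu>) powr (2 / \<theta>))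
                    / (2 - \<theta>) powr (2 * (1 - 1 / r))))
        \<le> C_LO * (\<integral>\<^sup>+x. ennreal ((euclid_norm d (grad d f x))\<^sup>2) \<partial>\<mu>))"

text \<open>
  \<open>\<real>\<^sup>d\<^sup>n\<close> is identified with \<open>(\<real>\<^sup>d)\<^sup>n\<close> by consecutive blocks of length \<open>d\<close>: coordinate \<open>j < d\<close> of the
  block \<open>i < n\<close> is coordinate \<open>i * d + j\<close>.
\<close>

definition join_blocks :: "nat \<Rightarrow> nat \<Rightarrow> (nat \<Rightarrow> nat \<Rightarrow> real) \<Rightarrow> (nat \<Rightarrow> real)" where
  "join_blocks d n x = (\<lambda>k\<in>{..<d * n}. x (k div d) (k mod d))"

definition block :: "nat \<Rightarrow> (nat \<Rightarrow> real) \<Rightarrow> nat \<Rightarrow> (nat \<Rightarrow> real)" where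
  "block d x i = (\<lambda>j\<in>{..<d}. x (i * d + j))"

definition power_measure ::
  "nat \<Rightarrow> nat \<Rightarrow> (nat \<Rightarrow> real) measure \<Rightarrow> (nat \<Rightarrow> real) measure" where
  "power_measure d n \<mu> = distr (\<Pi>\<^sub>M i\<in>{..<n}. \<mu>) (borel_Rn (d * n)) (join_blocks d n)"

definition norm_p2 :: "nat \<Rightarrow> nat \<Rightarrow> real \<Rightarrow> (nat \<Rightarrow> real) \<Rightarrow> real" where
  "norm_p2 d n p x = (\<Sum>i<n. euclid_norm d (block d x i) powr p) powr (1 / p)"

text \<open>\<open>exp (- a)\<close> for \<open>a \<in> [0, \<infinity>]\<close>, with \<open>exp (- \<infinity>) = 0\<close>.\<close>

definition exp_minus :: "ennreal \<Rightarrow> real" where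
  "exp_minus a = (if a = \<infinity> then 0 else exp (- enn2real a))"

end

theory Submission
  imports Defs
begin

text \<open>
  Write \<open>s = 2(1 - 1/r) \<in> (0, 1)\<close>, so that \<open>2/s = r'\<close>, and \<open>E\<close> for the expectation under the
  measure at hand. The heart of the matter is that the Latala-Oleszkiewicz inequality for \<open>\<mu>\<close>
  implies a modified logarithmic Sobolev inequality (\<open>modified_log_Sobolev\<close>)
  \<open>Ent(e\<^sup>g) \<le> K E[(|\<nabla>g|\<^sup>2 + |\<nabla>g|\<^bsup>r'\<^esup>) e\<^sup>g]\<close> for bounded smooth \<open>g\<close> with bounded gradient,
  with \<open>K\<close> depending on \<open>r\<close> and the constant only; everything after it is the entropy method.

  \<^bold>\<open>From the hypothesis to the modified inequality.\<close> If \<open>h \<ge> 0\<close> vanishes outside a set of measure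
  \<open>e\<^sup>-\<^sup>u\<^sup>/\<^sup>2\<close>, then by Hoelder \<open>(E h\<^sup>\<theta>)\<^sup>2\<^sup>/\<^sup>\<theta>\<close> is at most a fixed fraction of \<open>E h\<^sup>2\<close> as soon as
  \<open>2 - \<theta>\<close> is of order \<open>1/u\<close>, and the hypothesis becomes \<open>u\<^sup>s E h\<^sup>2 \<le> const \<cdot> E |\<nabla>h|\<^sup>2\<close>. For
  \<open>f = e\<^sup>g\<^sup>/\<^sup>2\<close> normalised by \<open>E f = 1\<close>, Markov's inequality allows \<open>h\<close> to be the part of \<open>f\<close> above the
  level \<open>e\<^sup>u\<^sup>/\<^sup>2\<close> (\<open>Faber_Krahn_level\<close>). Summing these estimates over \<open>u = 4, 8, 16, \<dots>\<close> with weights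
  \<open>u\<^sup>1\<^sup>-\<^sup>s\<close> controls \<open>E f\<^sup>2 log f\<^sup>2\<close> over large values of \<open>f\<close> by
  \<open>E |\<nabla>f|\<^sup>2 (log f\<^sup>2)\<^sup>1\<^sup>-\<^sup>s = E f\<^sup>2 (|\<nabla>f| / f)\<^sup>2 (log f\<^sup>2)\<^sup>1\<^sup>-\<^sup>s\<close>, and Young's inequality with exponents
  \<open>1/s\<close> and \<open>1/(1-s)\<close> splits this into \<open>f\<^sup>2 (|\<nabla>f| / f)\<^sup>2\<^sup>/\<^sup>s\<close> and a fraction of \<open>f\<^sup>2 log f\<^sup>2\<close> that is
  absorbed. For moderate values of \<open>f\<close> the entropy integrand is at most a multiple of \<open>(f - 1)\<^sup>2\<close>, whose
  expectation is the variance, and the limit \<open>\<theta> \<rightarrow> 1\<close> of the hypothesis is a Poincare inequality for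
  positive functions (\<open>Poincare_positive\<close>).

  \<^bold>\<open>From one factor to concentration.\<close> Entropy is subadditive over product measures
  (\<open>ent_PiM_le\<close>), and the squares and the \<open>r'\<close>-th powers of the block gradients add up to the two
  norms in the statement. So \<open>Ent(e\<^sup>l\<^sup>f) \<le> K(l\<^sup>2 a\<^sup>2 + l\<^bsup>r'\<^esup> b\<^bsup>r'\<^esup>) E e\<^sup>l\<^sup>f\<close> with \<open>a\<close> and \<open>b\<close> the suprema of
  those norms, and the Herbst argument (\<open>Herbst_dyadic\<close>) turns this into
  \<open>E e\<^bsup>l(f - E f)\<^esup> \<le> exp(2K(l\<^sup>2 a\<^sup>2 + l\<^bsup>r'\<^esup> b\<^bsup>r'\<^esup>))\<close>. All of this is done for bounded \<open>f\<close>; the general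
  case follows by applying it to \<open>T tanh(f/T)\<close>, whose gradient is smaller, and letting \<open>T \<rightarrow> \<infinity>\<close>
  (\<open>Laplace_limit\<close>, which also yields the integrability of \<open>f\<close>). Chernoff's bound at \<open>l = w/t\<close>, where
  \<open>w\<close> is any number below the minimum in the exponent, finishes the proof.
\<close>

section \<open>Smooth functions on \<open>\<real>\<^sup>N\<close>\<close>

lemma space_borel_Rn: "space (borel_Rn N) = Rn N"
  by (simp add: borel_Rn_def Rn_def space_PiM)

lemma Rn_upd: "x \<in> Rn N \<Longrightarrow> i < N \<Longrightarrow> x(i := s) \<in> Rn N"
  unfolding Rn_def by (auto simp: PiE_def extensional_def)

lemma closed_Rn: "closed (Rn N)"
proof -
  have "Rn N = (\<Inter>i\<in>{N..}. {x. x i = undefined})"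
    unfolding Rn_def by (auto simp: PiE_def extensional_def)
  moreover have "closed {x::nat \<Rightarrow> real. x i = undefined}" for i
    by (intro closed_Collect_eq continuous_intros continuous_on_product_coordinates)
  ultimately show ?thesis by auto
qed

text \<open>
  The Borel sets of the function space with its product topology pull back to product-measurable
  sets, and \<open>Rn N\<close> is closed, so extending by zero keeps measurability.
\<close>

lemma continuous_on_Rn_measurable:
  assumes "continuous_on (Rn N) (f :: (nat \<Rightarrow> real) \<Rightarrow> real)"
  shows "f \<in> borel_measurable (borel_Rn N)"
proof -
  have 1: "(\<lambda>x. x) \<in> measurable (borel_Rn N) (borel :: (nat \<Rightarrow> real) measure)"
  proof (rule measurable_coordinatewise_then_product)
    fix i
    show "(\<lambda>x. x i) \<in> borel_measurable (borel_Rn N)"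
    proof (cases "i < N")
      case True
      then show ?thesis unfolding borel_Rn_def by (intro measurable_component_singleton) auto
    next
      case False
      have "(\<lambda>x. x i) \<in> borel_measurable (borel_Rn N) \<longleftrightarrow> (\<lambda>x. undefined :: real) \<in> borel_measurable (borel_Rn N)"
        by (rule measurable_cong) (use False in \<open>auto simp: space_borel_Rn Rn_def PiE_def extensional_def\<close>)
      then show ?thesis by simp
    qed
  qed
  have 2: "(\<lambda>x. indicator (Rn N) x *\<^sub>R f x) \<in> borel_measurable borel"
    using assms closed_Rn by (intro borel_measurable_continuous_on_indicator) auto
  have "(\<lambda>x. indicator (Rn N) x *\<^sub>R f x) \<in> borel_measurable (borel_Rn N)"
    using measurable_compose[OF 1 2] by simp
  then show ?thesis
    by (subst measurable_cong[where g="\<lambda>x. indicator (Rn N) x *\<^sub>R f x"]) (auto simp: space_borel_Rn)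
qed

lemma partial_deriv_cong:
  assumes "\<And>x. x \<in> Rn N \<Longrightarrow> f x = g x" "i < N" "x \<in> Rn N"
  shows "partial_deriv i f x = partial_deriv i g x"
  unfolding partial_deriv_def using assms Rn_upd by simp

lemma C_k_cong:
  assumes "\<And>x. x \<in> Rn N \<Longrightarrow> f x = g x" "C_k N k f"
  shows "C_k N k g"
  using assms
proof (induction k arbitrary: f g)
  case 0
  then show ?case using continuous_on_cong[of "Rn N" "Rn N" f g] by simp
next
  case (Suc k)
  have c: "continuous_on (Rn N) g"
    using Suc.prems continuous_on_cong[of "Rn N" "Rn N" f g] by simp
  have "(\<lambda>s. f (x(i := s))) = (\<lambda>s. g (x(i := s)))" if "i < N" "x \<in> Rn N" for x i
    using that Suc.prems(1) Rn_upd by blast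
  then have "\<forall>i<N. \<forall>x\<in>Rn N. (\<lambda>s. g (x(i := s))) differentiable at (x i)"
    using Suc.prems(2) by (metis C_k.simps(2))
  moreover have "C_k N k (partial_deriv i g)" if "i < N" for i
    using Suc.IH[of "partial_deriv i f" "partial_deriv i g"] Suc.prems partial_deriv_cong[of N f g] that
    by auto
  ultimately show ?case using c by simp
qed

lemma C_k_SucD: "C_k N (Suc k) f \<Longrightarrow> C_k N k f"
  by (induction k arbitrary: f) auto

lemma partial_deriv_eqI:
  assumes "((\<lambda>s. f (x(i := s))) has_real_derivative D) (at (x i))"
  shows "partial_deriv i f x = D"
  unfolding partial_deriv_def using assms by (rule DERIV_imp_deriv)

lemma C_k_partial_DERIV:
  assumes "C_k N (Suc k) f" "i < N" "x \<in> Rn N"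
  shows "((\<lambda>s. f (x(i := s))) has_real_derivative partial_deriv i f x) (at (x i))"
  using assms unfolding partial_deriv_def
  by (auto simp: DERIV_deriv_iff_real_differentiable)

text \<open>
  Since \<open>C_k\<close> refers to \<open>partial_deriv\<close> only through its values on \<open>Rn N\<close>, any candidate for the
  partial derivatives may be used.
\<close>

lemma C_k_SucI:
  assumes "continuous_on (Rn N) f"
    and "\<And>i x. i < N \<Longrightarrow> x \<in> Rn N \<Longrightarrow> ((\<lambda>s. f (x(i := s))) has_real_derivative D i x) (at (x i))"
    and "\<And>i. i < N \<Longrightarrow> C_k N k (D i)"
  shows "C_k N (Suc k) f"
proof -
  have "D i x = partial_deriv i f x" if "i < N" "x \<in> Rn N" for i x
    using partial_deriv_eqI[where f=f, OF assms(2)[OF that]] by simp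
  then have "C_k N k (partial_deriv i f)" if "i < N" for i
    using that C_k_cong[OF _ assms(3)[OF that]] by blast
  moreover have "(\<lambda>s. f (x(i := s))) differentiable at (x i)" if "i < N" "x \<in> Rn N" for i x
    using assms(2)[OF that] real_differentiable_def by blast
  ultimately show ?thesis using assms(1) by simp
qed

lemma C_k_continuous: "C_k N k f \<Longrightarrow> continuous_on (Rn N) f"
  by (cases k) auto

lemma C_k_const: "C_k N k (\<lambda>x. c)"
proof (induction k arbitrary: c)
  case (Suc k)
  show ?case by (rule C_k_SucI[where D="\<lambda>i x. 0"]) (auto intro: Suc)
qed auto

lemma C_k_add: "C_k N k f \<Longrightarrow> C_k N k g \<Longrightarrow> C_k N k (\<lambda>x. f x + g x)"
proof (induction k arbitrary: f g)
  case (Suc k)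
  show ?case
    by (rule C_k_SucI[where D="\<lambda>i x. partial_deriv i f x + partial_deriv i g x"])
       (use Suc in \<open>auto simp del: fun_upd_apply intro!: continuous_intros derivative_intros C_k_partial_DERIV[where k=k]\<close>)
qed (auto intro: continuous_intros)

lemma C_k_mult: "C_k N k f \<Longrightarrow> C_k N k g \<Longrightarrow> C_k N k (\<lambda>x. f x * g x)"
proof (induction k arbitrary: f g)
  case (Suc k)
  show ?case
  proof (rule C_k_SucI[where D="\<lambda>i x. partial_deriv i f x * g x + partial_deriv i g x * f x"])
    fix i x assume ix: "i < N" "x \<in> Rn N"
    show "((\<lambda>s. f (x(i := s)) * g (x(i := s))) has_real_derivative
             partial_deriv i f x * g x + partial_deriv i g x * f x) (at (x i))"
      using DERIV_mult[OF C_k_partial_DERIV[OF Suc.prems(1) ix] C_k_partial_DERIV[OF Suc.prems(2) ix]]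
      by (simp del: fun_upd_apply)
  next
    fix i assume "i < N"
    then show "C_k N k (\<lambda>x. partial_deriv i f x * g x + partial_deriv i g x * f x)"
      using Suc.prems C_k_SucD by (intro C_k_add Suc.IH) auto
  qed (use Suc.prems C_k_continuous in \<open>auto intro!: continuous_intros\<close>)
qed (auto intro: continuous_intros)

lemma DERIV_comp_partial:
  assumes "C_k N (Suc k) f" "i < N" "x \<in> Rn N" and "\<And>y. (\<phi> has_real_derivative \<phi>' y) (at y)"
  shows "((\<lambda>s. \<phi> (f (x(i := s)))) has_real_derivative \<phi>' (f x) * partial_deriv i f x) (at (x i))"
  using DERIV_chain2[OF assms(4) C_k_partial_DERIV[OF assms(1,2,3)]] by simp

lemma C_k_comp:
  assumes "C_k N (Suc k) f" and "\<And>y. (\<phi> has_real_derivative \<phi>' y) (at y)"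
    and "C_k N k (\<lambda>x. \<phi>' (f x))"
  shows "C_k N (Suc k) (\<lambda>x. \<phi> (f x))"
proof (rule C_k_SucI[where D="\<lambda>i x. \<phi>' (f x) * partial_deriv i f x"])
  have "continuous_on UNIV \<phi>"
    using assms(2) by (meson DERIV_isCont continuous_at_imp_continuous_on)
  then show "continuous_on (Rn N) (\<lambda>x. \<phi> (f x))"
    using C_k_continuous[OF assms(1)] by (rule continuous_on_compose2) auto
qed (use assms in \<open>auto intro!: DERIV_comp_partial C_k_mult\<close>)

lemma smooth_const: "smooth N (\<lambda>x. c)"
  by (simp add: smooth_def C_k_const)

lemma smooth_add: "smooth N f \<Longrightarrow> smooth N g \<Longrightarrow> smooth N (\<lambda>x. f x + g x)"
  by (simp add: smooth_def C_k_add)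

lemma smooth_mult: "smooth N f \<Longrightarrow> smooth N g \<Longrightarrow> smooth N (\<lambda>x. f x * g x)"
  by (simp add: smooth_def C_k_mult)

lemma smooth_comp:
  assumes "smooth N f" "\<And>y. (\<phi> has_real_derivative \<phi>' y) (at y)" "smooth N (\<lambda>x. \<phi>' (f x))"
  shows "smooth N (\<lambda>x. \<phi> (f x))"
  using assms C_k_comp[of N _ f \<phi> \<phi>'] C_k_SucD unfolding smooth_def by blast

text \<open>
  The exponential is its own derivative, so the \<open>C_k\<close> statement for the derivative is the induction
  hypothesis. The same works for \<open>tanh\<close>, whose derivative is a polynomial in \<open>tanh\<close>; every auxiliary
  function below is built from these and from \<open>ln cosh\<close>, a primitive of \<open>tanh\<close>.
\<close>

lemma smooth_exp: assumes "smooth N f" shows "smooth N (\<lambda>x. exp (f x))"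
proof -
  have "C_k N k (\<lambda>x. exp (f x))" for k
  proof (induction k)
    case 0
    have "continuous_on (Rn N) f" using assms by (auto simp: smooth_def intro: C_k_continuous)
    then show ?case by (auto intro!: continuous_intros)
  next
    case (Suc k)
    have "C_k N (Suc k) f" using assms unfolding smooth_def by blast
    from C_k_comp[OF this DERIV_exp Suc] show ?case .
  qed
  then show ?thesis by (simp add: smooth_def)
qed

lemma DERIV_tanh_real: "(tanh has_real_derivative 1 - (tanh y)\<^sup>2) (at (y::real))"
  by (auto intro!: derivative_eq_intros)

lemma smooth_tanh: assumes "smooth N f" shows "smooth N (\<lambda>x. tanh (f x))"
proof -
  have c: "continuous_on UNIV (tanh :: real \<Rightarrow> real)"
    by (meson DERIV_tanh_real DERIV_isCont continuous_at_imp_continuous_on)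
  have "C_k N k (\<lambda>x. tanh (f x))" for k
  proof (induction k)
    case 0
    have "continuous_on (Rn N) f" using assms by (auto simp: smooth_def intro: C_k_continuous)
    with c have "continuous_on (Rn N) (\<lambda>x. tanh (f x))" by (rule continuous_on_compose2) auto
    then show ?case by simp
  next
    case (Suc k)
    have "C_k N k (\<lambda>x. 1 + (-1) * (tanh (f x) * tanh (f x)))"
      by (intro C_k_add C_k_mult C_k_const Suc)
    then have "C_k N k (\<lambda>x. 1 - (tanh (f x))\<^sup>2)" by (simp add: power2_eq_square)
    note d = this
    have "C_k N (Suc k) f" using assms unfolding smooth_def by blast
    from C_k_comp[OF this DERIV_tanh_real d] show ?case .
  qed
  then show ?thesis by (simp add: smooth_def)
qed

lemma smooth_ln_cosh: assumes "smooth N f" shows "smooth N (\<lambda>x. ln (cosh (f x)))"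
proof (rule smooth_comp[OF assms _ smooth_tanh[OF assms]])
  show "((\<lambda>y. ln (cosh y)) has_real_derivative tanh y) (at y)" for y :: real
    using cosh_real_pos[of y] by (auto intro!: derivative_eq_intros simp: tanh_def)
qed

lemma smooth_continuous: "smooth N f \<Longrightarrow> continuous_on (Rn N) f"
  by (auto simp: smooth_def intro: C_k_continuous)

lemma smooth_partial: "smooth N f \<Longrightarrow> i < N \<Longrightarrow> smooth N (partial_deriv i f)"
  unfolding smooth_def by (metis C_k.simps(2))

lemma grad_comp:
  assumes "smooth N f" "x \<in> Rn N" "\<And>y. (\<phi> has_real_derivative \<phi>' y) (at y)"
  shows "grad N (\<lambda>x. \<phi> (f x)) x = (\<lambda>i\<in>{..<N}. \<phi>' (f x) * grad N f x i)"
proof -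
  have c: "C_k N (Suc 0) f" using assms(1) unfolding smooth_def by blast
  have "partial_deriv i (\<lambda>x. \<phi> (f x)) x = \<phi>' (f x) * partial_deriv i f x" if "i < N" for i
    by (rule partial_deriv_eqI) (rule DERIV_comp_partial[OF c that assms(2,3)])
  then show ?thesis unfolding grad_def by (auto simp: fun_eq_iff)
qed

lemma L2_set_scale: "L2_set (\<lambda>i. c * v i) A = \<bar>c\<bar> * L2_set v A"
  unfolding L2_set_def by (simp add: power_mult_distrib real_sqrt_mult flip: sum_distrib_left)

lemma L2_set_restrict: "L2_set (restrict v A) A = L2_set v A"
  unfolding L2_set_def by (intro arg_cong[of _ _ sqrt] sum.cong) auto

lemma norm_grad_comp:
  assumes "smooth N f" "x \<in> Rn N" "\<And>y. (\<phi> has_real_derivative \<phi>' y) (at y)"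
  shows "euclid_norm N (grad N (\<lambda>x. \<phi> (f x)) x) = \<bar>\<phi>' (f x)\<bar> * euclid_norm N (grad N f x)"
  by (simp add: grad_comp[OF assms] L2_set_restrict L2_set_scale)

lemma norm_p2_scale:
  assumes "p > 0"
  shows "norm_p2 d n p (\<lambda>i\<in>{..<d*n}. c * v i) = \<bar>c\<bar> * norm_p2 d n p v"
proof -
  have "euclid_norm d (block d (\<lambda>i\<in>{..<d*n}. c * v i) i) = \<bar>c\<bar> * euclid_norm d (block d v i)" if "i < n" for i
  proof -
    have "i * d + j < d * n" if "j < d" for j
    proof -
      have "i * d + j < Suc i * d" using that by simp
      also have "\<dots> \<le> n * d" using \<open>i < n\<close> by (intro mult_le_mono1) simp
      finally show ?thesis by (simp add: mult.commute)
    qed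
    then have "L2_set (block d (\<lambda>i\<in>{..<d*n}. c * v i) i) {..<d} = L2_set (\<lambda>j. c * block d v i j) {..<d}"
      unfolding L2_set_def by (intro arg_cong[of _ _ sqrt] sum.cong) (auto simp: block_def)
    then show ?thesis by (simp add: L2_set_scale)
  qed
  then have "norm_p2 d n p (\<lambda>i\<in>{..<d*n}. c * v i)
     = (\<Sum>i<n. \<bar>c\<bar> powr p * euclid_norm d (block d v i) powr p) powr (1/p)"
    unfolding norm_p2_def
    by (intro arg_cong[of _ _ "\<lambda>z. z powr (1/p)"] sum.cong) (auto simp: powr_mult)
  also have "\<dots> = \<bar>c\<bar> * norm_p2 d n p v"
    using assms unfolding norm_p2_def
    by (simp flip: sum_distrib_left add: powr_mult sum_nonneg powr_powr)
  finally show ?thesis .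
qed

lemma smooth_norm_grad_measurable:
  assumes "smooth N f"
  shows "(\<lambda>x. euclid_norm N (grad N f x)) \<in> borel_measurable (borel_Rn N)"
proof -
  have "(\<lambda>x. partial_deriv i f x) \<in> borel_measurable (borel_Rn N)" if "i < N" for i
    using smooth_partial[OF assms that] by (intro continuous_on_Rn_measurable smooth_continuous)
  then have "(\<lambda>x. sqrt (\<Sum>i<N. (partial_deriv i f x)\<^sup>2)) \<in> borel_measurable (borel_Rn N)"
    by (intro measurable_compose[OF _ borel_measurable_sqrt] borel_measurable_sum borel_measurable_power) auto
  then show ?thesis
    by (simp add: grad_def L2_set_restrict) (simp add: L2_set_def)
qed

section \<open>Entropy: duality, tensorization and the Herbst argument\<close>

lemma (in prob_space) integrable_bounded:
  fixes f :: "'a \<Rightarrow> real"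
  assumes "f \<in> borel_measurable M" "\<And>x. x \<in> space M \<Longrightarrow> \<bar>f x\<bar> \<le> B"
  shows "integrable M f"
  using assms by (intro integrable_const_bound[where B=B]) auto

definition ent :: "'a measure \<Rightarrow> ('a \<Rightarrow> real) \<Rightarrow> real" where
  "ent M F = (\<integral>x. F x * ln (F x) \<partial>M) - (\<integral>x. F x \<partial>M) * ln (\<integral>x. F x \<partial>M)"

lemma ent_cong: "(\<And>x. x \<in> space M \<Longrightarrow> F x = G x) \<Longrightarrow> ent M F = ent M G"
  unfolding ent_def by (simp cong: Bochner_Integration.integral_cong)

lemma abs_mult_ln_le:
  assumes "0 < c" "c \<le> x" "x \<le> (K::real)"
  shows "\<bar>x * ln x\<bar> \<le> K * (\<bar>ln c\<bar> + \<bar>ln K\<bar>)"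
proof -
  have "ln c \<le> ln x" "ln x \<le> ln K" using assms by auto
  then have "\<bar>ln x\<bar> \<le> \<bar>ln c\<bar> + \<bar>ln K\<bar>" by linarith
  then show ?thesis using assms unfolding abs_mult by (intro mult_mono) auto
qed

text \<open>
  Young's inequality for the conjugate pair \<open>x ln x - x\<close> and \<open>e\<^sup>y\<close>; it drives the duality formula for
  entropy.
\<close>

lemma mult_le_ln_exp:
  assumes "(x::real) > 0"
  shows "x * y \<le> x * ln x - x + exp y"
proof -
  have "1 + (y - ln x) \<le> exp (y - ln x)" by (rule exp_ge_add_one_self)
  then have "x * (1 + (y - ln x)) \<le> x * exp (y - ln x)" using assms by simp
  also have "\<dots> = exp y" using assms by (simp add: exp_diff)
  finally show ?thesis by (simp add: algebra_simps)
qed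

lemma (in prob_space) integral_between:
  assumes "F \<in> borel_measurable M" "\<And>x. x \<in> space M \<Longrightarrow> c \<le> F x \<and> F x \<le> (K::real)"
  shows "c \<le> (\<integral>x. F x \<partial>M)" "(\<integral>x. F x \<partial>M) \<le> K"
proof -
  have "integrable M F" using assms by (intro integrable_bounded[where B="\<bar>c\<bar> + \<bar>K\<bar>"]) fastforce+
  then show "c \<le> (\<integral>x. F x \<partial>M)" "(\<integral>x. F x \<partial>M) \<le> K"
    using assms by (auto intro!: integral_ge_const integral_le_const)
qed

text \<open>
  Entropy is a supremum of linear functionals of \<open>F\<close>, namely of \<open>E[F h]\<close> over \<open>E e\<^sup>h \<le> 1\<close>; this
  convexity is what makes it subadditive. The proof integrates the pointwise inequality for \<open>F / E F\<close>.
\<close>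

lemma (in prob_space) ent_variational:
  assumes [measurable]: "F \<in> borel_measurable M" "h \<in> borel_measurable M"
    and c: "0 < c" and F: "\<And>x. x \<in> space M \<Longrightarrow> c \<le> F x \<and> F x \<le> K"
    and h: "\<And>x. x \<in> space M \<Longrightarrow> \<bar>h x\<bar> \<le> B"
    and e: "(\<integral>x. exp (h x) \<partial>M) \<le> 1"
  shows "(\<integral>x. F x * h x \<partial>M) \<le> ent M F"
proof -
  define m where "m = (\<integral>x. F x \<partial>M)"
  have m: "m > 0" using integral_between(1)[OF assms(1) F] c unfolding m_def by linarith
  have i1: "integrable M F" using F c by (intro integrable_bounded[where B=K]) fastforce+
  have i2: "integrable M (\<lambda>x. F x * ln (F x))"
    using F c abs_mult_ln_le[of c "F _" K] by (intro integrable_bounded[where B="K * (\<bar>ln c\<bar> + \<bar>ln K\<bar>)"]) auto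
  have i3: "integrable M (\<lambda>x. exp (h x))"
    using h by (intro integrable_bounded[where B="exp B"]) fastforce+
  have i4: "integrable M (\<lambda>x. F x * h x)"
  proof (rule integrable_bounded[where B="K * B"])
    fix x assume "x \<in> space M"
    then show "\<bar>F x * h x\<bar> \<le> K * B"
      unfolding abs_mult using F[of x] h[of x] c by (intro mult_mono) auto
  qed auto
  have "(\<integral>x. F x * h x \<partial>M) \<le> (\<integral>x. F x * ln (F x) - ln m * F x - F x + m * exp (h x) \<partial>M)"
  proof (rule integral_mono)
    fix x assume "x \<in> space M"
    then have Fx: "F x > 0" using F[of x] c by auto
    have "F x / m * h x \<le> F x / m * ln (F x / m) - F x / m + exp (h x)"
      using Fx m by (intro mult_le_ln_exp) auto
    then have "m * (F x / m * h x) \<le> m * (F x / m * ln (F x / m) - F x / m + exp (h x))"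
      using m by (intro mult_left_mono) auto
    also have "m * (F x / m * h x) = F x * h x" using m by simp
    also have "m * (F x / m * ln (F x / m) - F x / m + exp (h x)) = F x * ln (F x) - ln m * F x - F x + m * exp (h x)"
      using m Fx by (simp add: ln_div field_simps)
    finally show "F x * h x \<le> F x * ln (F x) - ln m * F x - F x + m * exp (h x)" .
  qed (use i1 i2 i3 i4 in auto)
  also have "\<dots> = (\<integral>x. F x * ln (F x) \<partial>M) - ln m * m - m + m * (\<integral>x. exp (h x) \<partial>M)"
    using i1 i2 i3 by (simp add: m_def)
  also have "\<dots> \<le> ent M F"
    using m e mult_left_mono[of "\<integral>x. exp (h x) \<partial>M" 1 m] by (simp add: ent_def m_def mult.commute)
  finally show ?thesis .
qed

lemma integrable_ent_fst:
  assumes "prob_space A" "prob_space B"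
    and [measurable]: "F \<in> borel_measurable (A \<Otimes>\<^sub>M B)"
    and c: "0 < c" and F: "\<And>x y. x \<in> space A \<Longrightarrow> y \<in> space B \<Longrightarrow> c \<le> F (x, y) \<and> F (x, y) \<le> K"
  shows "integrable A (\<lambda>x. ent B (\<lambda>y. F (x, y)))"
proof -
  interpret A: prob_space A by fact
  interpret B: prob_space B by fact
  interpret pair_prob_space A B ..
  define L where "L = K * (\<bar>ln c\<bar> + \<bar>ln K\<bar>)"
  show ?thesis
  proof (rule A.integrable_bounded[where B="2 * L"])
    show "(\<lambda>x. ent B (\<lambda>y. F (x, y))) \<in> borel_measurable A" unfolding ent_def by measurable
    fix x assume x: "x \<in> space A"
    have "\<bar>F (x, y) * ln (F (x, y))\<bar> \<le> L" if "y \<in> space B" for y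
      using that x F c abs_mult_ln_le[of c "F (x, y)" K] by (auto simp: L_def)
    then have "- L \<le> F (x, y) * ln (F (x, y)) \<and> F (x, y) * ln (F (x, y)) \<le> L" if "y \<in> space B" for y
      using that by (simp add: abs_le_iff minus_le_iff)
    then have L: "- L \<le> (\<integral>y. F (x, y) * ln (F (x, y)) \<partial>B)" "(\<integral>y. F (x, y) * ln (F (x, y)) \<partial>B) \<le> L"
      using x by (auto intro!: B.integral_between)
    have "c \<le> (\<integral>y. F (x, y) \<partial>B)" "(\<integral>y. F (x, y) \<partial>B) \<le> K"
      using F x by (auto intro!: B.integral_between)
    from abs_mult_ln_le[OF c this] L show "\<bar>ent B (\<lambda>y. F (x, y))\<bar> \<le> 2 * L"
      unfolding ent_def L_def by linarith
  qed
qed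

lemma integrable_ent_snd:
  assumes "prob_space A" "prob_space B"
    and [measurable]: "F \<in> borel_measurable (A \<Otimes>\<^sub>M B)"
    and c: "0 < c" and F: "\<And>x y. x \<in> space A \<Longrightarrow> y \<in> space B \<Longrightarrow> c \<le> F (x, y) \<and> F (x, y) \<le> K"
  shows "integrable B (\<lambda>y. ent A (\<lambda>x. F (x, y)))"
proof -
  have "(\<lambda>(y, x). F (x, y)) \<in> borel_measurable (B \<Otimes>\<^sub>M A)" by measurable
  from integrable_ent_fst[OF assms(2,1) this c, of K] F show ?thesis by simp
qed

text \<open>
  Let \<open>\<phi>(y) = \<integral> F(x, y) dx\<close>. The entropy of \<open>F\<close> is the average entropy in \<open>x\<close> plus the entropy of \<open>\<phi>\<close>.
  The latter is \<open>E[\<phi> h]\<close> for \<open>h = ln(\<phi> / E \<phi>)\<close>, which is the \<open>x\<close>-average of \<open>E\<^sub>y[F(x, y) h(y)]\<close>, and by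
  duality each of these is at most the entropy of \<open>F(x, \<cdot>)\<close>.
\<close>

lemma ent_pair_le:
  assumes "prob_space A" "prob_space B"
    and [measurable]: "F \<in> borel_measurable (A \<Otimes>\<^sub>M B)"
    and c: "0 < c" and F: "\<And>x y. x \<in> space A \<Longrightarrow> y \<in> space B \<Longrightarrow> c \<le> F (x, y) \<and> F (x, y) \<le> K"
  shows "ent (A \<Otimes>\<^sub>M B) F \<le> (\<integral>x. ent B (\<lambda>y. F (x, y)) \<partial>A) + (\<integral>y. ent A (\<lambda>x. F (x, y)) \<partial>B)"
proof -
  interpret A: prob_space A by fact
  interpret B: prob_space B by fact
  interpret pair_prob_space A B ..
  define \<phi> where "\<phi> y = (\<integral>x. F (x, y) \<partial>A)" for y
  define m where "m = (\<integral>z. F z \<partial>(A \<Otimes>\<^sub>M B))"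
  have [measurable]: "\<phi> \<in> borel_measurable B" unfolding \<phi>_def by measurable
  have b: "c \<le> F z \<and> F z \<le> K" if "z \<in> space (A \<Otimes>\<^sub>M B)" for z
    using that F by (auto simp: space_pair_measure)
  obtain x0 y0 where "x0 \<in> space A" "y0 \<in> space B" using A.not_empty B.not_empty by auto
  then have K: "K > 0" using F[of x0 y0] c by auto
  define L where "L = K * (\<bar>ln c\<bar> + \<bar>ln K\<bar>)"
  have i0: "integrable (A \<Otimes>\<^sub>M B) F"
    using b c by (intro P.integrable_bounded[where B=K]) fastforce+
  have i1: "integrable (A \<Otimes>\<^sub>M B) (\<lambda>z. F z * ln (F z))"
    using b c abs_mult_ln_le[of c "F _" K] by (intro P.integrable_bounded[where B=L]) (auto simp: L_def)
  have \<phi>: "c \<le> \<phi> y \<and> \<phi> y \<le> K" if "y \<in> space B" for y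
    unfolding \<phi>_def using that F by (intro conjI A.integral_between) auto
  have m_eq: "m = (\<integral>y. \<phi> y \<partial>B)"
    unfolding m_def \<phi>_def using i0 by (simp add: integral_snd[of "\<lambda>x y. F (x, y)"])
  have m: "c \<le> m" "m \<le> K" unfolding m_def using b by (auto intro!: P.integral_between)
  have m0: "m > 0" using m c by auto
  define h where "h y = ln (\<phi> y / m)" for y
  have [measurable]: "h \<in> borel_measurable B" unfolding h_def by measurable
  define H where "H = 2 * (\<bar>ln c\<bar> + \<bar>ln K\<bar>)"
  have h: "\<bar>h y\<bar> \<le> H" if "y \<in> space B" for y
  proof -
    have "ln c \<le> ln (\<phi> y)" "ln (\<phi> y) \<le> ln K" "ln c \<le> ln m" "ln m \<le> ln K"
      using \<phi>[OF that] m c m0 by auto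
    moreover have "h y = ln (\<phi> y) - ln m" unfolding h_def using \<phi>[OF that] c m0 by (simp add: ln_div)
    moreover have "ln c \<le> \<bar>ln c\<bar>" "- ln c \<le> \<bar>ln c\<bar>" "ln K \<le> \<bar>ln K\<bar>" "- ln K \<le> \<bar>ln K\<bar>" by simp_all
    ultimately show ?thesis unfolding H_def by (intro abs_leI) simp_all
  qed
  have eh: "(\<integral>y. exp (h y) \<partial>B) \<le> 1"
  proof -
    have "(\<integral>y. exp (h y) \<partial>B) = (\<integral>y. \<phi> y / m \<partial>B)"
      by (rule Bochner_Integration.integral_cong) (use \<phi> c m0 in \<open>fastforce simp: h_def\<close>)+
    also have "\<dots> = 1" using m_eq m0 by simp
    finally show ?thesis by simp
  qed
  have entint: "integrable A (\<lambda>x. ent B (\<lambda>y. F (x, y)))"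
    using F by (intro integrable_ent_fst[OF assms(1,2) _ c]) auto
  have i\<phi>: "integrable B (\<lambda>y. \<phi> y * ln (\<phi> y))"
    using \<phi> c abs_mult_ln_le[of c "\<phi> _" K] by (intro B.integrable_bounded[where B=L]) (auto simp: L_def)
  have i\<phi>0: "integrable B \<phi>" using \<phi> c by (intro B.integrable_bounded[where B=K]) fastforce+
  have iFh: "integrable (A \<Otimes>\<^sub>M B) (\<lambda>z. F z * h (snd z))"
  proof (rule P.integrable_bounded[where B="K * H"])
    fix z assume "z \<in> space (A \<Otimes>\<^sub>M B)"
    then show "\<bar>F z * h (snd z)\<bar> \<le> K * H"
      unfolding abs_mult using b[of z] h[of "snd z"] c K
      by (intro mult_mono) (auto simp: space_pair_measure)
  qed measurable
  have s1: "(\<integral>y. ent A (\<lambda>x. F (x, y)) \<partial>B) = (\<integral>z. F z * ln (F z) \<partial>(A \<Otimes>\<^sub>M B)) - (\<integral>y. \<phi> y * ln (\<phi> y) \<partial>B)"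
    unfolding ent_def \<phi>_def[symmetric] using integrable_snd[of "\<lambda>x y. F (x, y) * ln (F (x, y))"] i\<phi> i1
    by (subst Bochner_Integration.integral_diff) (auto simp: integral_snd[of "\<lambda>x y. F (x, y) * ln (F (x, y))"] split_beta')
  have "(\<integral>y. \<phi> y * h y \<partial>B) = (\<integral>z. F z * h (snd z) \<partial>(A \<Otimes>\<^sub>M B))"
    using integral_snd[of "\<lambda>x y. F (x, y) * h y"] iFh by (simp add: \<phi>_def split_beta')
  also have "\<dots> = (\<integral>x. (\<integral>y. F (x, y) * h y \<partial>B) \<partial>A)"
    using iFh by (subst integral_fst'[symmetric]) (auto simp: split_beta')
  also have "\<dots> \<le> (\<integral>x. ent B (\<lambda>y. F (x, y)) \<partial>A)"
  proof (rule integral_mono)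
    show "integrable A (\<lambda>x. \<integral>y. F (x, y) * h y \<partial>B)"
      using integrable_fst'[OF iFh] by simp
    fix x assume "x \<in> space A"
    then show "(\<integral>y. F (x, y) * h y \<partial>B) \<le> ent B (\<lambda>y. F (x, y))"
      using F c h eh by (intro B.ent_variational[where c=c and K=K and B=H]) auto
  qed (rule entint)
  finally have s2: "(\<integral>y. \<phi> y * h y \<partial>B) \<le> (\<integral>x. ent B (\<lambda>y. F (x, y)) \<partial>A)" .
  have "(\<integral>y. \<phi> y * h y \<partial>B) = (\<integral>y. \<phi> y * ln (\<phi> y) - \<phi> y * ln m \<partial>B)"
  proof (rule Bochner_Integration.integral_cong)
    fix y assume "y \<in> space B"
    then have "\<phi> y > 0" using \<phi> c by fastforce
    then show "\<phi> y * h y = \<phi> y * ln (\<phi> y) - \<phi> y * ln m"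
      using m0 by (simp add: h_def ln_div algebra_simps)
  qed simp
  also have "\<dots> = (\<integral>y. \<phi> y * ln (\<phi> y) \<partial>B) - m * ln m"
    using i\<phi> i\<phi>0 by (simp add: m_eq)
  finally have "(\<integral>y. \<phi> y * h y \<partial>B) = (\<integral>y. \<phi> y * ln (\<phi> y) \<partial>B) - m * ln m" .
  then show ?thesis using s1 s2 unfolding ent_def[of "A \<Otimes>\<^sub>M B"] m_def[symmetric] by linarith
qed

text \<open>
  Subadditivity of entropy for finite powers, in the form used later: the entropies in single
  coordinates are already bounded by averages of functions \<open>G i\<close>. Freezing a coordinate preserves
  these bounds, so the induction adds one coordinate at a time with \<open>ent_pair_le\<close>.
\<close>

lemma ent_PiM_le:
  fixes \<mu> :: "'a measure" and F :: "('i \<Rightarrow> 'a) \<Rightarrow> real"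
  assumes "finite I" and p: "prob_space \<mu>" and "0 < c"
    and "F \<in> borel_measurable (Pi\<^sub>M I (\<lambda>_. \<mu>))"
    and "\<And>x. x \<in> space (Pi\<^sub>M I (\<lambda>_. \<mu>)) \<Longrightarrow> c \<le> F x \<and> F x \<le> K"
    and "\<And>i. i \<in> I \<Longrightarrow> G i \<in> borel_measurable (Pi\<^sub>M I (\<lambda>_. \<mu>))"
    and "\<And>i x. i \<in> I \<Longrightarrow> x \<in> space (Pi\<^sub>M I (\<lambda>_. \<mu>)) \<Longrightarrow> \<bar>G i x\<bar> \<le> B"
    and "\<And>i x. i \<in> I \<Longrightarrow> x \<in> space (Pi\<^sub>M I (\<lambda>_. \<mu>)) \<Longrightarrow>
           ent \<mu> (\<lambda>y. F (x(i := y))) \<le> (\<integral>y. G i (x(i := y)) \<partial>\<mu>)"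
  shows "ent (Pi\<^sub>M I (\<lambda>_. \<mu>)) F \<le> (\<Sum>i\<in>I. \<integral>x. G i x \<partial>Pi\<^sub>M I (\<lambda>_. \<mu>))"
  using assms(1,4-)
proof (induction I arbitrary: F G rule: finite_induct)
  case empty
  interpret prob_space "Pi\<^sub>M {} (\<lambda>_. \<mu>)" by (rule prob_space_PiM) (rule p)
  have "ent (Pi\<^sub>M {} (\<lambda>_. \<mu>)) F = ent (Pi\<^sub>M {} (\<lambda>_. \<mu>)) (\<lambda>_ :: 'i \<Rightarrow> 'a. F (\<lambda>_. undefined))"
    by (intro ent_cong) (simp add: space_PiM)
  then show ?case by (simp add: ent_def prob_space)
next
  case (insert i I)
  interpret \<mu>: prob_space \<mu> by (rule p)
  interpret I: prob_space "Pi\<^sub>M I (\<lambda>_. \<mu>)" by (rule prob_space_PiM) (rule p)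
  interpret ins: prob_space "Pi\<^sub>M (insert i I) (\<lambda>_. \<mu>)" by (rule prob_space_PiM) (rule p)
  interpret pair_prob_space \<mu> "Pi\<^sub>M I (\<lambda>_. \<mu>)" ..
  let ?U = "\<lambda>(y, x). x(i := y)"
  let ?P = "\<mu> \<Otimes>\<^sub>M Pi\<^sub>M I (\<lambda>_. \<mu>)"
  have d: "distr ?P (Pi\<^sub>M (insert i I) (\<lambda>_. \<mu>)) ?U = Pi\<^sub>M (insert i I) (\<lambda>_. \<mu>)"
    using insert.hyps p by (intro distr_pair_PiM_eq_PiM) auto
  have U[measurable]: "?U \<in> measurable ?P (Pi\<^sub>M (insert i I) (\<lambda>_. \<mu>))"
    by (simp add: split_beta')
  have sp: "x(i := y) \<in> space (Pi\<^sub>M (insert i I) (\<lambda>_. \<mu>))" if "x \<in> space (Pi\<^sub>M I (\<lambda>_. \<mu>))" "y \<in> space \<mu>" for x y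
    using that by (auto simp: space_PiM PiE_def extensional_def)
  have int: "(\<integral>x. f x \<partial>Pi\<^sub>M (insert i I) (\<lambda>_. \<mu>)) = (\<integral>z. f (?U z) \<partial>?P)"
    if "f \<in> borel_measurable (Pi\<^sub>M (insert i I) (\<lambda>_. \<mu>))" for f :: "_ \<Rightarrow> real"
    by (subst d[symmetric], subst integral_distr[OF U that]) simp
  note [measurable] = insert.prems(1)
  have Gm[measurable]: "G j \<in> borel_measurable (Pi\<^sub>M (insert i I) (\<lambda>_. \<mu>))" if "j \<in> insert i I" for j
    using insert.prems(3) that .
  have Gint: "integrable ?P (\<lambda>z. G j (?U z))" if j: "j \<in> insert i I" for j
  proof (rule P.integrable_bounded[where B=B])
    show "(\<lambda>z. G j (?U z)) \<in> borel_measurable ?P" using measurable_compose[OF U Gm[OF j]] .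
    fix z assume "z \<in> space ?P"
    then show "\<bar>G j (?U z)\<bar> \<le> B" using insert.prems(4)[OF j] sp by (auto simp: space_pair_measure)
  qed
  have Fm: "(\<lambda>z. F (?U z)) \<in> borel_measurable ?P" using measurable_compose[OF U insert.prems(1)] .
  have Fb: "c \<le> F (?U (y, x)) \<and> F (?U (y, x)) \<le> K" if "y \<in> space \<mu>" "x \<in> space (Pi\<^sub>M I (\<lambda>_. \<mu>))" for x y
    using insert.prems(2) sp[OF that(2,1)] by simp
  have "ent (Pi\<^sub>M (insert i I) (\<lambda>_. \<mu>)) F = ent ?P (\<lambda>z. F (?U z))"
    unfolding ent_def by (simp add: int)
  also have "\<dots> \<le> (\<integral>y. ent (Pi\<^sub>M I (\<lambda>_. \<mu>)) (\<lambda>x. F (?U (y, x))) \<partial>\<mu>) + (\<integral>x. ent \<mu> (\<lambda>y. F (?U (y, x))) \<partial>Pi\<^sub>M I (\<lambda>_. \<mu>))"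
    using Fb by (intro ent_pair_le[OF p I.prob_space_axioms Fm \<open>0 < c\<close>]) 
  also have "\<dots> \<le> (\<Sum>j\<in>I. \<integral>x. G j x \<partial>Pi\<^sub>M (insert i I) (\<lambda>_. \<mu>)) + (\<integral>x. G i x \<partial>Pi\<^sub>M (insert i I) (\<lambda>_. \<mu>))"
  proof (rule add_mono)
    have "(\<integral>y. ent (Pi\<^sub>M I (\<lambda>_. \<mu>)) (\<lambda>x. F (?U (y, x))) \<partial>\<mu>) \<le> (\<integral>y. (\<Sum>j\<in>I. \<integral>x. G j (?U (y, x)) \<partial>Pi\<^sub>M I (\<lambda>_. \<mu>)) \<partial>\<mu>)"
    proof (rule integral_mono)
      show "integrable \<mu> (\<lambda>y. \<Sum>j\<in>I. \<integral>x. G j (?U (y, x)) \<partial>Pi\<^sub>M I (\<lambda>_. \<mu>))"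
        using integrable_fst'[OF Gint] by (intro Bochner_Integration.integrable_sum) auto
    next
      fix y assume y: "y \<in> space \<mu>"
      have Um: "(\<lambda>x. ?U (y, x)) \<in> measurable (Pi\<^sub>M I (\<lambda>_. \<mu>)) (Pi\<^sub>M (insert i I) (\<lambda>_. \<mu>))"
        using measurable_compose[OF measurable_Pair1'[OF y] U] by simp
      show "ent (Pi\<^sub>M I (\<lambda>_. \<mu>)) (\<lambda>x. F (?U (y, x))) \<le> (\<Sum>j\<in>I. \<integral>x. G j (?U (y, x)) \<partial>Pi\<^sub>M I (\<lambda>_. \<mu>))"
      proof (rule insert.IH)
        show "(\<lambda>x. F (?U (y, x))) \<in> borel_measurable (Pi\<^sub>M I (\<lambda>_. \<mu>))"
          using measurable_compose[OF Um insert.prems(1)] .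
        show "c \<le> F (?U (y, x)) \<and> F (?U (y, x)) \<le> K" if "x \<in> space (Pi\<^sub>M I (\<lambda>_. \<mu>))" for x
          using Fb y that by auto
        fix j assume j: "j \<in> I"
        then have ji: "j \<noteq> i" using insert.hyps by auto
        show "(\<lambda>x. G j (?U (y, x))) \<in> borel_measurable (Pi\<^sub>M I (\<lambda>_. \<mu>))"
          using measurable_compose[OF Um Gm[of j]] j by (simp del: fun_upd_apply)
        fix x assume x: "x \<in> space (Pi\<^sub>M I (\<lambda>_. \<mu>))"
        show "\<bar>G j (?U (y, x))\<bar> \<le> B" using insert.prems(4)[of j] sp[OF x y] j by auto
        show "ent \<mu> (\<lambda>z. F (?U (y, x(j := z)))) \<le> (\<integral>z. G j (?U (y, x(j := z))) \<partial>\<mu>)"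
          using insert.prems(5)[of j, OF _ sp[OF x y]] j ji by (simp add: fun_upd_twist del: fun_upd_apply)
      qed
    next
      show "integrable \<mu> (\<lambda>y. ent (Pi\<^sub>M I (\<lambda>_. \<mu>)) (\<lambda>x. F (?U (y, x))))"
        using Fb by (intro integrable_ent_fst[OF p I.prob_space_axioms Fm \<open>0 < c\<close>])
    qed
    also have "\<dots> = (\<Sum>j\<in>I. \<integral>x. G j x \<partial>Pi\<^sub>M (insert i I) (\<lambda>_. \<mu>))"
      using integrable_fst'[OF Gint] integral_fst'[OF Gint]
      by (subst Bochner_Integration.integral_sum) (auto simp: int intro!: sum.cong)
    finally show "(\<integral>y. ent (Pi\<^sub>M I (\<lambda>_. \<mu>)) (\<lambda>x. F (?U (y, x))) \<partial>\<mu>) \<le> (\<Sum>j\<in>I. \<integral>x. G j x \<partial>Pi\<^sub>M (insert i I) (\<lambda>_. \<mu>))" .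
  next
    show "(\<integral>x. ent \<mu> (\<lambda>y. F (?U (y, x))) \<partial>Pi\<^sub>M I (\<lambda>_. \<mu>)) \<le> (\<integral>x. G i x \<partial>Pi\<^sub>M (insert i I) (\<lambda>_. \<mu>))"
    proof -
      have G': "integrable ?P (\<lambda>(y, x). G i (?U (y, x)))" using Gint[of i] by (simp add: split_beta')
      have "(\<integral>x. ent \<mu> (\<lambda>y. F (?U (y, x))) \<partial>Pi\<^sub>M I (\<lambda>_. \<mu>)) \<le> (\<integral>x. (\<integral>y. G i (?U (y, x)) \<partial>\<mu>) \<partial>Pi\<^sub>M I (\<lambda>_. \<mu>))"
      proof (rule integral_mono)
        show "integrable (Pi\<^sub>M I (\<lambda>_. \<mu>)) (\<lambda>x. ent \<mu> (\<lambda>y. F (?U (y, x))))"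
          using Fb by (intro integrable_ent_snd[OF p I.prob_space_axioms Fm \<open>0 < c\<close>])
        show "integrable (Pi\<^sub>M I (\<lambda>_. \<mu>)) (\<lambda>x. \<integral>y. G i (?U (y, x)) \<partial>\<mu>)"
          using integrable_snd[OF G'] .
        fix x assume x: "x \<in> space (Pi\<^sub>M I (\<lambda>_. \<mu>))"
        obtain y0 where "y0 \<in> space \<mu>" using \<mu>.not_empty by auto
        from insert.prems(5)[of i, OF _ sp[OF x this]]
        show "ent \<mu> (\<lambda>y. F (?U (y, x))) \<le> (\<integral>y. G i (?U (y, x)) \<partial>\<mu>)"
          by (simp del: fun_upd_apply)
      qed
      also have "\<dots> = (\<integral>x. G i x \<partial>Pi\<^sub>M (insert i I) (\<lambda>_. \<mu>))"
        using integral_snd[OF G'] by (simp add: int split_beta')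
      finally show ?thesis .
    qed
  qed
  also have "\<dots> = (\<Sum>j\<in>insert i I. \<integral>x. G j x \<partial>Pi\<^sub>M (insert i I) (\<lambda>_. \<mu>))"
    using insert.hyps by simp
  finally show ?case .
qed

lemma exp_le_quadratic:
  assumes "\<bar>x::real\<bar> \<le> 1/2"
  shows "exp x \<le> 1 + x + 2 * x\<^sup>2"
proof -
  have "1 \<le> 1 + x\<^sup>2 * (1 - 2 * x)" using assms by auto
  also have "\<dots> = (1 - x) * (1 + x + 2 * x\<^sup>2)" by (simp add: algebra_simps power2_eq_square)
  finally have 1: "1 \<le> (1 - x) * (1 + x + 2 * x\<^sup>2)" .
  have "1 - x \<le> exp (- x)" using exp_ge_add_one_self[of "-x"] by simp
  moreover have "0 \<le> 1 + x + 2 * x\<^sup>2" using assms zero_le_power2[of x] by linarith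
  ultimately have "(1 - x) * (1 + x + 2 * x\<^sup>2) \<le> exp (- x) * (1 + x + 2 * x\<^sup>2)"
    by (rule mult_right_mono)
  with 1 have "exp x * 1 \<le> exp x * (exp (- x) * (1 + x + 2 * x\<^sup>2))"
    by (intro mult_left_mono) auto
  then show ?thesis by (simp add: exp_minus mult.assoc[symmetric])
qed

text \<open>
  The Herbst argument without differentiation in \<open>l\<close>. Let \<open>Z(l) = E e\<^sup>l\<^sup>F\<close>. Jensen's inequality under
  the measure with density \<open>e\<^sup>l\<^sup>F / Z(l)\<close>, together with the entropy bound, gives
  \<open>ln Z(l) \<le> 2 ln Z(l/2) + \<kappa> l\<^sup>2\<close>. Iterating along \<open>l = 1, 1/2, 1/4, \<dots>\<close> the errors form a geometric
  series with sum at most \<open>2 \<kappa>\<close>, and \<open>2\<^sup>k ln Z(2\<^sup>-\<^sup>k)\<close> tends to \<open>E F\<close>.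
\<close>

lemma (in prob_space) Herbst_dyadic:
  assumes [measurable]: "F \<in> borel_measurable M" and F: "\<And>x. x \<in> space M \<Longrightarrow> \<bar>F x\<bar> \<le> B"
    and ent: "\<And>l. 0 < l \<Longrightarrow> l \<le> 1 \<Longrightarrow> ent M (\<lambda>x. exp (l * F x)) \<le> \<kappa> * l\<^sup>2 * (\<integral>x. exp (l * F x) \<partial>M)"
  shows "(\<integral>x. exp (F x) \<partial>M) \<le> exp ((\<integral>x. F x \<partial>M) + 2 * \<kappa>)"
proof -
  define Z where "Z l = (\<integral>x. exp (l * F x) \<partial>M)" for l
  obtain x0 where "x0 \<in> space M" using not_empty by auto
  then have B: "B \<ge> 0" using F[of x0] by auto
  have lF: "\<bar>l * F x\<bar> \<le> B" if "0 \<le> l" "l \<le> 1" "x \<in> space M" for l x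
    unfolding abs_mult using mult_mono[of "\<bar>l\<bar>" 1 "\<bar>F x\<bar>" B] F[OF that(3)] that by auto
  have iF: "integrable M F" using F by (intro integrable_bounded[where B=B]) auto
  have ie: "integrable M (\<lambda>x. exp (l * F x))" if "0 \<le> l" "l \<le> 1" for l
    using lF[OF that] by (intro integrable_bounded[where B="exp B"]) fastforce+
  have ief: "integrable M (\<lambda>x. exp (l * F x) * F x)" if "0 \<le> l" "l \<le> 1" for l
  proof (rule integrable_bounded[where B="exp B * B"])
    fix x assume "x \<in> space M"
    then show "\<bar>exp (l * F x) * F x\<bar> \<le> exp B * B"
      unfolding abs_mult using lF[OF that, of x] F[of x] by (intro mult_mono) auto
  qed auto
  have Z0: "Z l > 0" if "0 \<le> l" "l \<le> 1" for l
  proof -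
    have "exp (-B) \<le> Z l" unfolding Z_def
      using lF[OF that] by (intro integral_ge_const ie that) (auto simp: abs_le_iff minus_le_iff)
    then show ?thesis using exp_gt_zero[of "-B"] by linarith
  qed
  have step: "ln (Z l) \<le> 2 * ln (Z (l / 2)) + \<kappa> * l\<^sup>2" if l: "0 < l" "l \<le> 1" for l
  proof -
    define T where "T = (\<integral>x. exp (l * F x) * F x \<partial>M)"
    \<comment> \<open>\<open>q\<close> is the mean of \<open>- l F / 2\<close> under the tilted measure; the tangent of the exponential at \<open>q\<close>
      replaces Jensen's inequality.\<close>
    define q where "q = - (l * T / (2 * Z l))"
    have Zl: "Z l > 0" "Z (l/2) > 0" using Z0 l by auto
    have "ent M (\<lambda>x. exp (l * F x)) = l * T - Z l * ln (Z l)"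
      unfolding ent_def Z_def T_def by (simp flip: integral_mult_right_zero add: mult_ac)
    then have "l * T \<le> Z l * ln (Z l) + \<kappa> * l\<^sup>2 * Z l" using ent[OF l] by (simp add: Z_def)
    then have "l * T \<le> Z l * (ln (Z l) + \<kappa> * l\<^sup>2)" by (simp add: algebra_simps)
    then have q: "- (ln (Z l) + \<kappa> * l\<^sup>2) / 2 \<le> q"
      unfolding q_def using Zl by (simp add: field_simps)
    have "exp q * Z l = (\<integral>x. exp q * (exp (l * F x) * (1 - q) - (l / 2) * (exp (l * F x) * F x)) \<partial>M)"
    proof -
      have "(\<integral>x. exp q * (exp (l * F x) * (1 - q) - (l / 2) * (exp (l * F x) * F x)) \<partial>M)
        = exp q * (Z l * (1 - q) - (l / 2) * T)"
        using ie[of l] ief[of l] l unfolding Z_def T_def by simp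
      also have "\<dots> = exp q * Z l" using Zl unfolding q_def by (simp add: field_simps)
      finally show ?thesis by simp
    qed
    also have "\<dots> \<le> Z (l / 2)"
      unfolding Z_def
    proof (rule integral_mono)
      fix x assume "x \<in> space M"
      have "1 + (- (l / 2) * F x - q) \<le> exp (- (l / 2) * F x - q)" by (rule exp_ge_add_one_self)
      then have "exp q * exp (l * F x) * (1 + (- (l / 2) * F x - q)) \<le> exp q * exp (l * F x) * exp (- (l / 2) * F x - q)"
        by (intro mult_left_mono) auto
      also have "\<dots> = exp (l / 2 * F x)" by (simp flip: exp_add)
      finally show "exp q * (exp (l * F x) * (1 - q) - (l / 2) * (exp (l * F x) * F x)) \<le> exp (l / 2 * F x)"
        by (simp add: algebra_simps)
    qed (use ie[of l] ie[of "l/2"] ief[of l] l in auto)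
    finally have "ln (exp q * Z l) \<le> ln (Z (l / 2))" using Zl by simp
    then have "q + ln (Z l) \<le> ln (Z (l / 2))" using Zl by (simp add: ln_mult)
    then show ?thesis using q by argo
  qed
  have tele: "ln (Z 1) \<le> 2 ^ k * ln (Z (1 / 2 ^ k)) + 2 * \<kappa> * (1 - 1 / 2 ^ k)" for k :: nat
  proof (induction k)
    case (Suc k)
    have "(2::real) ^ k * ln (Z (1 / 2 ^ k)) \<le> 2 ^ k * (2 * ln (Z (1 / 2 ^ k / 2)) + \<kappa> * (1 / 2 ^ k)\<^sup>2)"
      by (intro mult_left_mono step) auto
    also have "\<dots> = 2 ^ Suc k * ln (Z (1 / 2 ^ Suc k)) + \<kappa> / 2 ^ k"
      by (simp add: field_simps power2_eq_square)
    finally show ?case using Suc by (simp add: field_simps)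
  qed simp
  have lim: "\<forall>\<^sub>F k in sequentially. ln (Z 1) \<le> (\<integral>x. F x \<partial>M) + 2 * B\<^sup>2 * (1/2) ^ k + 2 * \<kappa> * (1 - (1/2) ^ k)"
  proof -
    have "(\<lambda>k. B * (1/2) ^ k) \<longlonglongrightarrow> B * 0" by (intro tendsto_intros LIMSEQ_power_zero) auto
    then have "\<forall>\<^sub>F k in sequentially. B * (1/2) ^ k < 1/2" by (rule order_tendstoD) auto
    then show ?thesis
    proof eventually_elim
      case (elim k)
      define e :: real where "e = 1 / 2 ^ k"
      have e: "0 < e" "e \<le> 1" by (auto simp: e_def)
      have "Z e \<le> (\<integral>x. 1 + e * F x + 2 * e\<^sup>2 * B\<^sup>2 \<partial>M)"
        unfolding Z_def
      proof (rule integral_mono)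
        fix x assume x: "x \<in> space M"
        have "\<bar>e * F x\<bar> \<le> e * B" unfolding abs_mult using F[OF x] e by simp
        then have eF: "\<bar>e * F x\<bar> \<le> 1/2" using elim by (simp add: e_def power_one_over field_simps)
        have "(F x)\<^sup>2 \<le> B\<^sup>2" using F[OF x] by (metis abs_le_square_iff abs_of_nonneg B)
        then have "2 * e\<^sup>2 * (F x)\<^sup>2 \<le> 2 * e\<^sup>2 * B\<^sup>2" using mult_left_mono[of _ _ "2 * e\<^sup>2"] by simp
        then show "exp (e * F x) \<le> 1 + e * F x + 2 * e\<^sup>2 * B\<^sup>2"
          using exp_le_quadratic[OF eF] by (simp add: power_mult_distrib)
      qed (use ie[of e] iF e in auto)
      also have "\<dots> = 1 + e * (\<integral>x. F x \<partial>M) + 2 * e\<^sup>2 * B\<^sup>2" using iF by (simp add: prob_space)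
      finally have "Z e - 1 \<le> e * (\<integral>x. F x \<partial>M) + 2 * e\<^sup>2 * B\<^sup>2" by simp
      then have "ln (Z e) \<le> e * (\<integral>x. F x \<partial>M) + 2 * e\<^sup>2 * B\<^sup>2"
        using ln_le_minus_one[OF Z0[of e]] e by linarith
      then have "2 ^ k * ln (Z e) \<le> 2 ^ k * (e * (\<integral>x. F x \<partial>M) + 2 * e\<^sup>2 * B\<^sup>2)" by (intro mult_left_mono) auto
      also have "\<dots> = (\<integral>x. F x \<partial>M) + 2 * B\<^sup>2 * (1/2) ^ k"
        unfolding e_def by (simp add: field_simps power2_eq_square power_one_over)
      finally show ?case using tele[of k] unfolding e_def by (simp add: power_one_over)
    qed
  qed
  have "(\<lambda>k. (\<integral>x. F x \<partial>M) + 2 * B\<^sup>2 * (1/2) ^ k + 2 * \<kappa> * (1 - (1/2) ^ k))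
      \<longlonglongrightarrow> (\<integral>x. F x \<partial>M) + 2 * B\<^sup>2 * 0 + 2 * \<kappa> * (1 - 0)"
    by (intro tendsto_intros LIMSEQ_power_zero) auto
  from tendsto_lowerbound[OF this lim] have "ln (Z 1) \<le> (\<integral>x. F x \<partial>M) + 2 * \<kappa>" by simp
  then have "exp (ln (Z 1)) \<le> exp ((\<integral>x. F x \<partial>M) + 2 * \<kappa>)" by simp
  moreover have "exp (ln (Z 1)) = Z 1" using Z0[of 1] by (intro exp_ln) auto
  ultimately have "Z 1 \<le> exp ((\<integral>x. F x \<partial>M) + 2 * \<kappa>)" by simp
  then show ?thesis unfolding Z_def mult_1 .
qed

section \<open>Level-set inequalities\<close>

text \<open>
  All integrands for bounded functions belong to this class. Its closure properties discharge the
  integrability side conditions.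
\<close>

definition bounded_measurable :: "'a measure \<Rightarrow> ('a \<Rightarrow> real) \<Rightarrow> bool" where
  "bounded_measurable M f \<longleftrightarrow> f \<in> borel_measurable M \<and> (\<exists>B. \<forall>x\<in>space M. \<bar>f x\<bar> \<le> B)"

lemma bounded_measurableI: "f \<in> borel_measurable M \<Longrightarrow> (\<And>x. x \<in> space M \<Longrightarrow> \<bar>f x\<bar> \<le> B) \<Longrightarrow> bounded_measurable M f"
  unfolding bounded_measurable_def by blast

lemma bounded_measurable_measurable: "bounded_measurable M f \<Longrightarrow> f \<in> borel_measurable M"
  unfolding bounded_measurable_def by blast

lemma bounded_measurableE:
  assumes "bounded_measurable M f" obtains B where "B > 0" "\<And>x. x \<in> space M \<Longrightarrow> \<bar>f x\<bar> \<le> B"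
proof -
  obtain B where B: "\<forall>x\<in>space M. \<bar>f x\<bar> \<le> B" using assms unfolding bounded_measurable_def by blast
  have "\<bar>f x\<bar> \<le> max B 1" if "x \<in> space M" for x using B that by fastforce
  then show ?thesis using that[of "max B 1"] by auto
qed

lemma bounded_measurable_const: "bounded_measurable M (\<lambda>_. c)" by (rule bounded_measurableI) auto

lemma bounded_measurable_add: assumes "bounded_measurable M f" "bounded_measurable M g" shows "bounded_measurable M (\<lambda>x. f x + g x)"
proof -
  obtain B C where "\<And>x. x \<in> space M \<Longrightarrow> \<bar>f x\<bar> \<le> B" "\<And>x. x \<in> space M \<Longrightarrow> \<bar>g x\<bar> \<le> C"
    using assms by (metis bounded_measurableE)
  then show ?thesis using assms[THEN bounded_measurable_measurable]
    by (intro bounded_measurableI[where B="B + C"]) (auto intro: order_trans[OF abs_triangle_ineq add_mono])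
qed

lemma bounded_measurable_mult: assumes "bounded_measurable M f" "bounded_measurable M g" shows "bounded_measurable M (\<lambda>x. f x * g x)"
proof -
  obtain B C where "B > 0" "\<And>x. x \<in> space M \<Longrightarrow> \<bar>f x\<bar> \<le> B" "\<And>x. x \<in> space M \<Longrightarrow> \<bar>g x\<bar> \<le> C"
    using assms by (metis bounded_measurableE)
  then show ?thesis using assms[THEN bounded_measurable_measurable]
    by (intro bounded_measurableI[where B="B * C"]) (auto intro: mult_mono simp: abs_mult)
qed

lemma bounded_measurable_diff: "bounded_measurable M f \<Longrightarrow> bounded_measurable M g \<Longrightarrow> bounded_measurable M (\<lambda>x. f x - g x)"
  using bounded_measurable_add[of M f "\<lambda>x. (-1) * g x"] bounded_measurable_mult[OF bounded_measurable_const, of M g "-1"] by simp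

lemma bounded_measurable_power: "bounded_measurable M f \<Longrightarrow> bounded_measurable M (\<lambda>x. f x ^ n)"
  by (induction n) (auto intro: bounded_measurable_const bounded_measurable_mult)

lemma bounded_measurable_max: assumes "bounded_measurable M f" shows "bounded_measurable M (\<lambda>x. max c (f x))"
proof -
  obtain B where "\<And>x. x \<in> space M \<Longrightarrow> \<bar>f x\<bar> \<le> B" using assms by (metis bounded_measurableE)
  then show ?thesis using bounded_measurable_measurable[OF assms] by (intro bounded_measurableI[where B="\<bar>c\<bar> + B"]) fastforce+
qed

lemma bounded_measurable_exp: assumes "bounded_measurable M f" shows "bounded_measurable M (\<lambda>x. exp (f x))"
proof -
  obtain B where "\<And>x. x \<in> space M \<Longrightarrow> \<bar>f x\<bar> \<le> B" using assms by (metis bounded_measurableE)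
  then show ?thesis using bounded_measurable_measurable[OF assms] by (intro bounded_measurableI[where B="exp B"]) fastforce+
qed

lemma bounded_measurable_powr: assumes "bounded_measurable M f" "p \<ge> 0" "\<And>x. x \<in> space M \<Longrightarrow> 0 \<le> f x" shows "bounded_measurable M (\<lambda>x. f x powr p)"
proof -
  obtain B where "\<And>x. x \<in> space M \<Longrightarrow> \<bar>f x\<bar> \<le> B" using assms by (metis bounded_measurableE)
  then show ?thesis using bounded_measurable_measurable[OF assms(1)] assms(2,3)
    by (intro bounded_measurableI[where B="B powr p"]) (auto intro!: powr_mono2)
qed

lemma bounded_measurable_abs_powr: "bounded_measurable M f \<Longrightarrow> p \<ge> 0 \<Longrightarrow> bounded_measurable M (\<lambda>x. \<bar>f x\<bar> powr p)"
  by (rule bounded_measurable_powr) (auto simp: bounded_measurable_def)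

lemma bounded_measurable_indicator: "{x \<in> space M. P x} \<in> sets M \<Longrightarrow> bounded_measurable M (\<lambda>x. of_bool (P x))"
  by (rule bounded_measurableI[where B=1]) (auto simp: of_bool_def)

lemma bounded_measurable_indicator_le:
  assumes "bounded_measurable M f" shows "bounded_measurable M (\<lambda>x. of_bool (c \<le> f x))" "bounded_measurable M (\<lambda>x. of_bool (c < f x))"
proof -
  note [measurable] = bounded_measurable_measurable[OF assms]
  show "bounded_measurable M (\<lambda>x. of_bool (c \<le> f x))" "bounded_measurable M (\<lambda>x. of_bool (c < f x))"
    by (auto intro!: bounded_measurable_indicator)
qed

lemma bounded_measurable_sum: "(\<And>i. i \<in> A \<Longrightarrow> bounded_measurable M (f i)) \<Longrightarrow> bounded_measurable M (\<lambda>x. \<Sum>i\<in>A. f i x)"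
  by (induction A rule: infinite_finite_induct) (auto intro: bounded_measurable_const bounded_measurable_add)

lemma (in prob_space) bounded_measurable_integrable: "bounded_measurable M f \<Longrightarrow> integrable M f"
  unfolding bounded_measurable_def using integrable_bounded by blast

lemmas bounded_measurable_intros = bounded_measurable_const bounded_measurable_add bounded_measurable_mult bounded_measurable_diff bounded_measurable_power bounded_measurable_max bounded_measurable_exp bounded_measurable_sum bounded_measurable_indicator_le

text \<open>
  Hoelder's inequality \<open>E h\<^sup>\<theta> \<le> (E h\<^sup>2)\<^sup>\<theta>\<^sup>/\<^sup>2 \<mu>(h > 0)\<^bsup>1 - \<theta>/2\<^esup>\<close>, obtained by integrating Young's inequality
  between \<open>h\<^sup>2\<close> and the constant \<open>E h\<^sup>2 / p\<close> over the set where \<open>h > 0\<close>.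
\<close>

lemma (in prob_space) Hoelder_support:
  assumes h: "bounded_measurable M h" "\<And>x. x \<in> space M \<Longrightarrow> 0 \<le> h x" and p: "0 < p" "(\<integral>x. of_bool (0 < h x) \<partial>M) \<le> p"
    and \<theta>: "0 < \<theta>" "\<theta> < 2"
  shows "(\<integral>x. h x powr \<theta> \<partial>M) powr (2 / \<theta>) \<le> p powr (2 / \<theta> - 1) * (\<integral>x. (h x)\<^sup>2 \<partial>M)"
proof -
  define S where "S = (\<integral>x. (h x)\<^sup>2 \<partial>M)"
  have i2: "integrable M (\<lambda>x. (h x)\<^sup>2)" by (intro bounded_measurable_integrable bounded_measurable_intros h)
  have i\<theta>: "integrable M (\<lambda>x. h x powr \<theta>)" using h \<theta> by (intro bounded_measurable_integrable bounded_measurable_powr) auto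
  have i0: "integrable M (\<lambda>x. of_bool (0 < h x) :: real)" by (intro bounded_measurable_integrable bounded_measurable_intros h)
  have "S \<ge> 0" unfolding S_def by simp
  then consider "S = 0" | "S > 0" by linarith
  then show ?thesis
  proof cases
    case 1
    then have "AE x in M. (h x)\<^sup>2 = 0" using i2 unfolding S_def by (subst (asm) integral_nonneg_eq_0_iff_AE) auto
    then have "AE x in M. h x powr \<theta> = 0" by eventually_elim simp
    then have "(\<integral>x. h x powr \<theta> \<partial>M) = 0"
      using integral_cong_AE[of "\<lambda>x. h x powr \<theta>" M "\<lambda>x. 0"] i\<theta> by simp
    then show ?thesis using 1 by (simp add: S_def)
  next
    case 2
    define a where "a = \<theta> / 2"
    have a: "0 < a" "a < 1" using \<theta> by (auto simp: a_def)
    define w where "w = (S / p) powr (1 - a)"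
    have w: "w > 0" using 2 p by (simp add: w_def)
    have "w * (\<integral>x. h x powr \<theta> \<partial>M) = (\<integral>x. w * h x powr \<theta> \<partial>M)" by simp
    also have "\<dots> \<le> (\<integral>x. a * (h x)\<^sup>2 + (1 - a) * (S / p) * of_bool (0 < h x) \<partial>M)"
    proof (rule integral_mono)
      fix x assume "x \<in> space M"
      then consider "h x = 0" | "h x > 0" using h(2) by fastforce
      then show "w * h x powr \<theta> \<le> a * (h x)\<^sup>2 + (1 - a) * (S / p) * of_bool (0 < h x)"
      proof cases
        case 1 then show ?thesis by simp
      next
        case pos: 2
        have "((h x)\<^sup>2) powr a * (S / p) powr (1 - a) \<le> a * (h x)\<^sup>2 + (1 - a) * (S / p)"
          using a pos 2 p by (intro Youngs_inequality_0) auto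
        moreover have "((h x)\<^sup>2) powr a = h x powr \<theta>"
          using pos by (simp add: a_def powr_powr flip: powr_numeral)
        ultimately show ?thesis using pos by (simp add: w_def mult.commute)
      qed
    qed (use i2 i\<theta> i0 in auto)
    also have "\<dots> = a * S + (1 - a) * (S / p) * (\<integral>x. of_bool (0 < h x) \<partial>M)"
      using i2 i0 by (simp add: S_def)
    also have "\<dots> \<le> a * S + (1 - a) * (S / p) * p"
      using a 2 p by (intro add_left_mono mult_left_mono) auto
    also have "\<dots> = a * S + (1 - a) * S" using p by simp
    also have "\<dots> = S" by (simp add: algebra_simps)
    finally have "(\<integral>x. h x powr \<theta> \<partial>M) \<le> S / w" using w by (simp add: field_simps)
    also have "S / w = S powr a * p powr (1 - a)"
      using 2 p a unfolding w_def by (simp add: powr_divide powr_diff field_simps)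
    finally have "(\<integral>x. h x powr \<theta> \<partial>M) powr (2/\<theta>) \<le> (S powr a * p powr (1 - a)) powr (2/\<theta>)"
      using \<theta> by (intro powr_mono2) auto
    also have "\<dots> = S * p powr ((1 - a) * (2/\<theta>))"
      using 2 p \<theta> by (simp add: powr_mult powr_powr a_def)
    also have "(1 - a) * (2/\<theta>) = 2/\<theta> - 1" using \<theta> by (simp add: a_def field_simps)
    finally show ?thesis by (simp add: S_def mult.commute)
  qed
qed

abbreviation grad_norm :: "nat \<Rightarrow> ((nat \<Rightarrow> real) \<Rightarrow> real) \<Rightarrow> (nat \<Rightarrow> real) \<Rightarrow> real" where
  "grad_norm N f x \<equiv> euclid_norm N (grad N f x)"

lemma grad_norm_nonneg: "0 \<le> grad_norm N f x" by (rule L2_set_nonneg)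

locale LO_space = prob_space \<mu> for \<mu> :: "(nat \<Rightarrow> real) measure" +
  fixes d :: nat and r :: real and C_LO :: ennreal
  assumes sets_\<mu>: "sets \<mu> = sets (borel_Rn d)"
    and r: "1 < r" "r < 2" and LO: "LO_inequality d r C_LO \<mu>" and C_LO: "C_LO < \<infinity>"
begin

text \<open>
  The exponent of \<open>2 - \<theta>\<close> in the hypothesis; \<open>2/s\<close> is the dual exponent of \<open>r\<close>.
\<close>

definition "s = 2 * (1 - 1 / r)"
definition "c = enn2real C_LO"

lemma s: "0 < s" "s < 1"
  using r by (auto simp: s_def field_simps)

lemma c: "0 \<le> c" "C_LO = ennreal c"
  using C_LO by (auto simp: c_def)

lemma space_\<mu>: "space \<mu> = Rn d"
  using sets_eq_imp_space_eq[OF sets_\<mu>] space_borel_Rn by simp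

lemma measurable_smooth: "smooth d f \<Longrightarrow> f \<in> borel_measurable \<mu>"
  using continuous_on_Rn_measurable[OF smooth_continuous] measurable_cong_sets[OF sets_\<mu> refl] by blast

lemma measurable_grad_norm: "smooth d f \<Longrightarrow> grad_norm d f \<in> borel_measurable \<mu>"
  using smooth_norm_grad_measurable measurable_cong_sets[OF sets_\<mu> refl] by blast

lemma LO_real:
  assumes f: "smooth d f" "bounded_measurable \<mu> f" "bounded_measurable \<mu> (grad_norm d f)" and \<theta>: "1 < \<theta>" "\<theta> < 2"
  shows "(\<integral>x. (f x)\<^sup>2 \<partial>\<mu>) - (\<integral>x. \<bar>f x\<bar> powr \<theta> \<partial>\<mu>) powr (2 / \<theta>) \<le> c * (2 - \<theta>) powr s * (\<integral>x. (grad_norm d f x)\<^sup>2 \<partial>\<mu>)"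
    (is "?L \<le> c * ?w * ?I")
proof -
  have i: "integrable \<mu> (\<lambda>x. (f x)\<^sup>2)" by (intro bounded_measurable_integrable bounded_measurable_intros f)
  have i2: "integrable \<mu> (\<lambda>x. (grad_norm d f x)\<^sup>2)" by (intro bounded_measurable_integrable bounded_measurable_intros f)
  have "ennreal (?L / ?w) \<le> (SUP \<theta>\<in>{1<..<2}.
           ennreal (((\<integral>x. (f x)\<^sup>2 \<partial>\<mu>) - (\<integral>x. \<bar>f x\<bar> powr \<theta> \<partial>\<mu>) powr (2 / \<theta>))
                    / (2 - \<theta>) powr (2 * (1 - 1 / r))))"
    unfolding s_def using \<theta> by (intro SUP_upper) auto
  also have "\<dots> \<le> C_LO * (\<integral>\<^sup>+x. ennreal ((grad_norm d f x)\<^sup>2) \<partial>\<mu>)"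
    using LO f(1) i unfolding LO_inequality_def by blast
  also have "\<dots> = ennreal (c * ?I)"
    using c i2 by (simp add: nn_integral_eq_integral ennreal_mult)
  finally have "?L / ?w \<le> c * ?I" using c by (subst (asm) ennreal_le_iff) auto
  then show ?thesis using \<theta> by (simp add: field_simps)
qed

end

text \<open>
  A smooth approximation of the positive part, with derivative \<open>(1 + tanh(y/e))/2 \<in> [0, 1]\<close> and uniform
  error at most \<open>e\<close>. It is needed because the hypothesis concerns smooth functions, while
  truncations at a level are only Lipschitz.
\<close>

definition softpos :: "real \<Rightarrow> real \<Rightarrow> real" where
  "softpos e y = y / 2 + e / 2 * ln (cosh (y / e))"

lemma softpos_DERIV:
  assumes "e > 0"
  shows "(softpos e has_real_derivative (1 + tanh (y / e)) / 2) (at y)"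
  unfolding softpos_def using assms cosh_real_pos[of "y/e"]
  by (auto intro!: derivative_eq_intros simp: tanh_def field_simps)

lemma softpos_approx:
  assumes "e > 0"
  shows "\<bar>softpos e y - max 0 y\<bar> \<le> e"
proof -
  define u where "u = y / e"
  have 1: "cosh u \<le> exp \<bar>u\<bar>" "exp \<bar>u\<bar> / 2 \<le> cosh u"
    by (auto simp: cosh_def abs_if)
  have "ln (cosh u) \<le> ln (exp \<bar>u\<bar>)" using 1 cosh_real_pos[of u] by (subst ln_le_cancel_iff) auto
  moreover have "ln (exp \<bar>u\<bar> / 2) \<le> ln (cosh u)" using 1 cosh_real_pos[of u] by (subst ln_le_cancel_iff) auto
  moreover have "ln (exp \<bar>u\<bar> / 2) = \<bar>u\<bar> - ln 2" by (simp add: ln_div)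
  moreover have "ln 2 \<le> (1::real)" using ln_le_minus_one[of "2::real"] by simp
  ultimately have 2: "\<bar>ln (cosh u) - \<bar>u\<bar>\<bar> \<le> 1" by auto
  have "max 0 y = y / 2 + e / 2 * \<bar>u\<bar>" using assms by (auto simp: u_def max_def abs_if field_simps)
  then have "softpos e y - max 0 y = e / 2 * (ln (cosh u) - \<bar>u\<bar>)"
    by (simp add: softpos_def u_def algebra_simps)
  then have "\<bar>softpos e y - max 0 y\<bar> = e / 2 * \<bar>ln (cosh u) - \<bar>u\<bar>\<bar>" using assms by (simp only: abs_mult)
  also have "\<dots> \<le> e / 2 * 1" using assms 2 by (intro mult_left_mono) auto
  finally show ?thesis using assms by simp
qed

lemma smooth_softpos:
  assumes "smooth N f"
  shows "smooth N (\<lambda>x. softpos e (f x))"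
proof -
  have "smooth N (\<lambda>x. 1/2 * f x + e / 2 * ln (cosh (1 / e * f x)))"
    by (intro smooth_add smooth_mult smooth_const smooth_ln_cosh assms)
  then show ?thesis by (simp add: softpos_def)
qed

lemma tanh_scaled_limit:
  "(\<lambda>n. tanh (y * real (Suc n))) \<longlonglongrightarrow> sgn y"
proof -
  have pos: "(\<lambda>n. tanh (y * real (Suc n))) \<longlonglongrightarrow> 1" if "y > 0" for y
  proof (rule filterlim_compose[OF tanh_real_at_top])
    show "filterlim (\<lambda>n. y * real (Suc n)) at_top sequentially"
      by (rule filterlim_tendsto_pos_mult_at_top[OF tendsto_const that])
         (rule filterlim_compose[OF filterlim_real_sequentially filterlim_Suc])
  qed
  consider "y > 0" | "y = 0" | "y < 0" by linarith
  then show ?thesis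
  proof cases
    case 3
    have "(\<lambda>n. - tanh (- y * real (Suc n))) \<longlonglongrightarrow> - 1"
      using 3 by (intro tendsto_minus pos) auto
    then show ?thesis using 3 by simp
  qed (use pos in auto)
qed

context LO_space begin

text \<open>
  Apply the hypothesis to \<open>softpos\<close> of \<open>f - k\<close> with parameter \<open>1/(n+1)\<close> and let \<open>n \<rightarrow> \<infinity>\<close> by dominated
  convergence. In the limit the gradient is multiplied by \<open>1\<close>, \<open>1/2\<close> or \<open>0\<close> according to the sign of
  \<open>f - k\<close>.
\<close>

lemma LO_positive_part:
  assumes f: "smooth d f" "bounded_measurable \<mu> f" "bounded_measurable \<mu> (grad_norm d f)" and \<theta>: "1 < \<theta>" "\<theta> < 2"
  shows "(\<integral>x. (max 0 (f x - k))\<^sup>2 \<partial>\<mu>) - (\<integral>x. (max 0 (f x - k)) powr \<theta> \<partial>\<mu>) powr (2 / \<theta>)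
    \<le> c * (2 - \<theta>) powr s * (\<integral>x. of_bool (k \<le> f x) * (grad_norm d f x)\<^sup>2 \<partial>\<mu>)"
proof -
  define e where "e n = 1 / real (Suc n)" for n
  have e: "0 < e n" "e n \<le> 1" for n by (auto simp: e_def)
  have e0: "e \<longlonglongrightarrow> 0" unfolding e_def by (rule LIMSEQ_Suc[OF lim_1_over_n])
  define h where "h n x = softpos (e n) (f x - k)" for n x
  define v where "v n y = (1 + tanh (y / e n)) / 2" for n y
  define h0 where "h0 x = max 0 (f x - k)" for x
  have fk: "smooth d (\<lambda>x. f x - k)" using smooth_add[OF f(1) smooth_const[of d "-k"]] by simp
  have hs: "smooth d (h n)" for n unfolding h_def by (intro smooth_softpos fk)
  have vb: "0 \<le> v n y" "v n y \<le> 1" for n y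
    using tanh_real_bounds[of "y / e n"] by (auto simp: v_def)
  have vlim: "(\<lambda>n. v n y) \<longlonglongrightarrow> (1 + sgn y) / 2" for y
    using tanh_scaled_limit[of y] unfolding v_def e_def by (auto intro!: tendsto_intros)
  have hg: "grad_norm d (h n) x = v n (f x - k) * grad_norm d f x" if "x \<in> space \<mu>" for n x
  proof -
    have "((\<lambda>y. softpos (e n) (y - k)) has_real_derivative v n (y - k)) (at y)" for y
      unfolding v_def using DERIV_shift[of "softpos (e n)" _ y "-k"] softpos_DERIV[OF e(1), of n "y - k"] by simp
    from norm_grad_comp[OF f(1) _ this, of x] that vb[of n "f x - k"] show ?thesis
      by (simp add: h_def[abs_def] space_\<mu>)
  qed
  obtain B where B: "B > 0" "\<And>x. x \<in> space \<mu> \<Longrightarrow> \<bar>f x\<bar> \<le> B" by (rule bounded_measurableE[OF f(2)]) auto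
  obtain G where G: "G > 0" "\<And>x. x \<in> space \<mu> \<Longrightarrow> \<bar>grad_norm d f x\<bar> \<le> G" by (rule bounded_measurableE[OF f(3)]) auto
  define B' where "B' = B + \<bar>k\<bar> + 1"
  have hap: "\<bar>h n x - h0 x\<bar> \<le> e n" for n x unfolding h_def h0_def using e softpos_approx by blast
  have hb: "\<bar>h n x\<bar> \<le> B'" if "x \<in> space \<mu>" for n x
    using hap[of n x] e[of n] B(2)[OF that] unfolding h0_def B'_def by linarith
  have hlim: "(\<lambda>n. h n x) \<longlonglongrightarrow> h0 x" for x
  proof (rule LIM_zero_cancel, rule Lim_null_comparison[OF _ e0])
    show "\<forall>\<^sub>F n in sequentially. norm (h n x - h0 x) \<le> e n" using hap by auto
  qed
  have bmh: "bounded_measurable \<mu> (h n)" for n using hb measurable_smooth[OF hs] by (intro bounded_measurableI) auto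
  have gb: "\<bar>grad_norm d (h n) x\<bar> \<le> G" if "x \<in> space \<mu>" for n x
  proof -
    have "v n (f x - k) * grad_norm d f x \<le> 1 * G"
      using vb[of n "f x - k"] G(2)[OF that] grad_norm_nonneg[of d f x] by (intro mult_mono) auto
    then show ?thesis using hg[OF that] vb[of n "f x - k"] grad_norm_nonneg[of d f x] by simp
  qed
  have bmg: "bounded_measurable \<mu> (grad_norm d (h n))" for n using gb measurable_grad_norm[OF hs] by (intro bounded_measurableI) auto
  have bmh0: "bounded_measurable \<mu> h0" unfolding h0_def by (intro bounded_measurable_intros f)
  note m[measurable] = bounded_measurable_measurable[OF bmh] bounded_measurable_measurable[OF bmg] bounded_measurable_measurable[OF bmh0]
    bounded_measurable_measurable[OF f(2)] bounded_measurable_measurable[OF f(3)]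
  have l1: "(\<lambda>n. \<integral>x. (h n x)\<^sup>2 \<partial>\<mu>) \<longlonglongrightarrow> (\<integral>x. (h0 x)\<^sup>2 \<partial>\<mu>)"
  proof (rule integral_dominated_convergence[where w="\<lambda>_. B'\<^sup>2"])
    show "AE x in \<mu>. (\<lambda>n. (h n x)\<^sup>2) \<longlonglongrightarrow> (h0 x)\<^sup>2" using hlim by (auto intro!: tendsto_intros)
    show "AE x in \<mu>. norm ((h n x)\<^sup>2) \<le> B'\<^sup>2" for n
      using hb power_mono[of "\<bar>h n _\<bar>" B' 2] by auto
  qed auto
  have h0n: "0 \<le> h0 x" for x by (simp add: h0_def)
  have l2: "(\<lambda>n. \<integral>x. \<bar>h n x\<bar> powr \<theta> \<partial>\<mu>) \<longlonglongrightarrow> (\<integral>x. \<bar>h0 x\<bar> powr \<theta> \<partial>\<mu>)"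
  proof (rule integral_dominated_convergence[where w="\<lambda>_. B' powr \<theta>"])
    show "AE x in \<mu>. (\<lambda>n. \<bar>h n x\<bar> powr \<theta>) \<longlonglongrightarrow> \<bar>h0 x\<bar> powr \<theta>"
      using \<theta> hlim by (intro AE_I2 tendsto_powr') (auto intro!: tendsto_intros)
    show "AE x in \<mu>. norm (\<bar>h n x\<bar> powr \<theta>) \<le> B' powr \<theta>" for n
      using hb \<theta> by (intro AE_I2) (auto intro!: powr_mono2)
  qed auto
  have l3: "(\<lambda>n. \<integral>x. (grad_norm d (h n) x)\<^sup>2 \<partial>\<mu>) \<longlonglongrightarrow> (\<integral>x. ((1 + sgn (f x - k)) / 2 * grad_norm d f x)\<^sup>2 \<partial>\<mu>)"
  proof (rule integral_dominated_convergence[where w="\<lambda>_. G\<^sup>2"])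
    have "(\<lambda>n. (v n (f x - k) * grad_norm d f x)\<^sup>2) \<longlonglongrightarrow> ((1 + sgn (f x - k)) / 2 * grad_norm d f x)\<^sup>2" for x
      by (intro tendsto_intros vlim)
    then show "AE x in \<mu>. (\<lambda>n. (grad_norm d (h n) x)\<^sup>2) \<longlonglongrightarrow> ((1 + sgn (f x - k)) / 2 * grad_norm d f x)\<^sup>2"
      using hg by (intro AE_I2) simp
    show "AE x in \<mu>. norm ((grad_norm d (h n) x)\<^sup>2) \<le> G\<^sup>2" for n
      using gb power_mono[of "\<bar>grad_norm d (h n) _\<bar>" G 2] by auto
  qed (auto simp: sgn_if)
  have "(\<integral>x. (h0 x)\<^sup>2 \<partial>\<mu>) - (\<integral>x. \<bar>h0 x\<bar> powr \<theta> \<partial>\<mu>) powr (2 / \<theta>)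
     \<le> c * (2 - \<theta>) powr s * (\<integral>x. ((1 + sgn (f x - k)) / 2 * grad_norm d f x)\<^sup>2 \<partial>\<mu>)"
  proof (rule LIMSEQ_le)
    show "(\<lambda>n. (\<integral>x. (h n x)\<^sup>2 \<partial>\<mu>) - (\<integral>x. \<bar>h n x\<bar> powr \<theta> \<partial>\<mu>) powr (2 / \<theta>))
      \<longlonglongrightarrow> (\<integral>x. (h0 x)\<^sup>2 \<partial>\<mu>) - (\<integral>x. \<bar>h0 x\<bar> powr \<theta> \<partial>\<mu>) powr (2 / \<theta>)"
      using \<theta> by (intro tendsto_diff l1 tendsto_powr' l2 tendsto_const) auto
    show "(\<lambda>n. c * (2 - \<theta>) powr s * (\<integral>x. (grad_norm d (h n) x)\<^sup>2 \<partial>\<mu>))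
      \<longlonglongrightarrow> c * (2 - \<theta>) powr s * (\<integral>x. ((1 + sgn (f x - k)) / 2 * grad_norm d f x)\<^sup>2 \<partial>\<mu>)"
      by (intro tendsto_mult l3 tendsto_const)
  qed (use LO_real[OF hs bmh bmg \<theta>] in auto)
  also have "(\<integral>x. ((1 + sgn (f x - k)) / 2 * grad_norm d f x)\<^sup>2 \<partial>\<mu>) \<le> (\<integral>x. of_bool (k \<le> f x) * (grad_norm d f x)\<^sup>2 \<partial>\<mu>)"
  proof (rule integral_mono)
    show "integrable \<mu> (\<lambda>x. of_bool (k \<le> f x) * (grad_norm d f x)\<^sup>2)" by (intro bounded_measurable_integrable bounded_measurable_intros f)
    have "bounded_measurable \<mu> (\<lambda>x. of_bool (k \<le> f x) + of_bool (k < f x) :: real)" by (intro bounded_measurable_intros f)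
    then have "bounded_measurable \<mu> (\<lambda>x. (1/2 * (of_bool (k \<le> f x) + of_bool (k < f x)) * grad_norm d f x)\<^sup>2)" by (intro bounded_measurable_intros f) 
    moreover have "1/2 * (of_bool (k \<le> y) + of_bool (k < y)) = (1 + sgn (y - k)) / 2" for y :: real
      by (auto simp: sgn_if)
    ultimately show "integrable \<mu> (\<lambda>x. ((1 + sgn (f x - k)) / 2 * grad_norm d f x)\<^sup>2)"
      by (simp only: bounded_measurable_integrable)
    show "((1 + sgn (f x - k)) / 2 * grad_norm d f x)\<^sup>2 \<le> of_bool (k \<le> f x) * (grad_norm d f x)\<^sup>2" for x
      by (auto simp: sgn_if power_mult_distrib power2_eq_square)
  qed
  finally show ?thesis using c by (simp add: h0_def mult_left_mono)
qed

text \<open>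
  The limit \<open>\<theta> \<rightarrow> 1\<close>. For positive \<open>f\<close> the subtracted term tends to \<open>(E f)\<^sup>2\<close> directly; the bound
  \<open>f\<^sup>\<theta> \<le> B\<^bsup>\<theta> - 1\<^esup> f\<close> for \<open>f \<le> B\<close> reduces this to a limit of real functions.
\<close>

lemma Poincare_positive:
  assumes f: "smooth d f" "bounded_measurable \<mu> f" "bounded_measurable \<mu> (grad_norm d f)" and pos: "\<And>x. x \<in> space \<mu> \<Longrightarrow> 0 < f x"
  shows "(\<integral>x. (f x)\<^sup>2 \<partial>\<mu>) - (\<integral>x. f x \<partial>\<mu>)\<^sup>2 \<le> c * (\<integral>x. (grad_norm d f x)\<^sup>2 \<partial>\<mu>)"
proof -
  define m where "m = (\<integral>x. f x \<partial>\<mu>)"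
  define I where "I = (\<integral>x. (grad_norm d f x)\<^sup>2 \<partial>\<mu>)"
  have I: "I \<ge> 0" unfolding I_def by simp
  obtain B where B: "B > 0" "\<And>x. x \<in> space \<mu> \<Longrightarrow> \<bar>f x\<bar> \<le> B" by (rule bounded_measurableE[OF f(2)]) auto
  have m0: "m \<ge> 0" unfolding m_def using pos by (intro integral_nonneg_AE AE_I2) (simp add: less_imp_le)
  have bnd: "(\<integral>x. (f x)\<^sup>2 \<partial>\<mu>) \<le> (B powr (\<theta> - 1) * m) powr (2 / \<theta>) + c * I" if \<theta>: "1 < \<theta>" "\<theta> < 2" for \<theta>
  proof -
    have "(\<integral>x. \<bar>f x\<bar> powr \<theta> \<partial>\<mu>) \<le> (\<integral>x. B powr (\<theta> - 1) * f x \<partial>\<mu>)"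
    proof (rule integral_mono)
      show "integrable \<mu> (\<lambda>x. \<bar>f x\<bar> powr \<theta>)" using \<theta> f by (intro bounded_measurable_integrable bounded_measurable_abs_powr) auto
      show "integrable \<mu> (\<lambda>x. B powr (\<theta> - 1) * f x)" by (intro bounded_measurable_integrable bounded_measurable_intros f)
      fix x assume x: "x \<in> space \<mu>"
      have "\<bar>f x\<bar> powr \<theta> = f x powr (\<theta> - 1) * f x" using pos[OF x] by (simp add: powr_diff)
      also have "\<dots> \<le> B powr (\<theta> - 1) * f x"
        using pos[OF x] B(2)[OF x] \<theta> by (intro mult_right_mono powr_mono2) auto
      finally show "\<bar>f x\<bar> powr \<theta> \<le> B powr (\<theta> - 1) * f x" .
    qed
    then have "(\<integral>x. \<bar>f x\<bar> powr \<theta> \<partial>\<mu>) powr (2 / \<theta>) \<le> (B powr (\<theta> - 1) * m) powr (2 / \<theta>)"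
      using \<theta> by (intro powr_mono2) (auto simp: m_def)
    moreover have "c * (2 - \<theta>) powr s * I \<le> c * I"
    proof -
      have "(2 - \<theta>) powr s \<le> 1" using \<theta> s by (intro powr_le1) auto
      then have "(c * I) * (2 - \<theta>) powr s \<le> (c * I) * 1" using c I by (intro mult_left_mono) auto
      then show ?thesis by (simp add: mult_ac)
    qed
    ultimately show ?thesis using LO_real[OF f \<theta>] unfolding I_def by linarith
  qed
  have "((\<lambda>\<theta>. (B powr (\<theta> - 1) * m) powr (2 / \<theta>) + c * I) \<longlongrightarrow> (B powr (1 - 1) * m) powr (2 / 1) + c * I) (at_right 1)"
    using B m0 by (intro tendsto_add tendsto_powr' tendsto_mult tendsto_const tendsto_divide tendsto_diff tendsto_ident_at) auto
  moreover have "\<forall>\<^sub>F \<theta> in at_right (1::real). (\<integral>x. (f x)\<^sup>2 \<partial>\<mu>) \<le> (B powr (\<theta> - 1) * m) powr (2 / \<theta>) + c * I"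
    using bnd by (auto simp: eventually_at_right[of "1::real" 2] intro!: exI[of _ 2])
  ultimately have "(\<integral>x. (f x)\<^sup>2 \<partial>\<mu>) \<le> (B powr (1 - 1) * m) powr (2 / 1) + c * I"
    by (rule tendsto_lowerbound) simp
  then show ?thesis using B m0 by (simp add: m_def I_def)
qed

text \<open>
  By Markov's inequality \<open>f\<close> exceeds \<open>e\<^sup>u\<^sup>/\<^sup>2\<close> with probability at most \<open>e\<^sup>-\<^sup>u\<^sup>/\<^sup>2\<close>. With
  \<open>2 - \<theta> = 2/u\<close>, Hoelder's inequality makes the subtracted term at most \<open>e\<^sup>-\<^sup>1\<^sup>/\<^sup>2 \<le> 2/3\<close> of the
  second moment, so a third of the second moment survives on the left-hand side.
\<close>

lemma Faber_Krahn_level: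
  assumes f: "smooth d f" "bounded_measurable \<mu> f" "bounded_measurable \<mu> (grad_norm d f)" and pos: "\<And>x. x \<in> space \<mu> \<Longrightarrow> 0 < f x"
    and m: "(\<integral>x. f x \<partial>\<mu>) \<le> 1" and u: "u \<ge> 4"
  shows "u powr s * (\<integral>x. (max 0 (f x - exp (u / 2)))\<^sup>2 \<partial>\<mu>)
    \<le> 6 * c * (\<integral>x. of_bool (exp (u / 2) \<le> f x) * (grad_norm d f x)\<^sup>2 \<partial>\<mu>)"
proof -
  define k where "k = exp (u / 2)"
  define h where "h x = max 0 (f x - k)" for x
  define S where "S = (\<integral>x. (h x)\<^sup>2 \<partial>\<mu>)"
  define I where "I = (\<integral>x. of_bool (k \<le> f x) * (grad_norm d f x)\<^sup>2 \<partial>\<mu>)"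
  \<comment> \<open>The hypothesis \<open>u \<ge> 4\<close> keeps \<open>\<theta>\<close> at or above \<open>3/2\<close>, inside the admissible range.\<close>
  define \<theta> where "\<theta> = 2 - 2 / u"
  have \<theta>: "1 < \<theta>" "\<theta> < 2" using u by (auto simp: \<theta>_def field_simps)
  have k: "k > 0" by (simp add: k_def)
  have h: "bounded_measurable \<mu> h" unfolding h_def by (intro bounded_measurable_intros f)
  have I: "I \<ge> 0" unfolding I_def by (intro integral_nonneg_AE AE_I2) simp
  have S: "S \<ge> 0" unfolding S_def by simp
  have "(\<integral>x. of_bool (0 < h x) \<partial>\<mu>) \<le> (\<integral>x. 1 / k * f x \<partial>\<mu>)"
  proof (rule integral_mono)
    show "of_bool (0 < h x) \<le> 1 / k * f x" if "x \<in> space \<mu>" for x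
      using pos[OF that] k by (auto simp: h_def field_simps)
  qed (intro bounded_measurable_integrable bounded_measurable_intros f h)+
  also have "\<dots> \<le> 1 / k" using m k by (simp add: field_simps)
  finally have "(\<integral>x. h x powr \<theta> \<partial>\<mu>) powr (2 / \<theta>) \<le> (1 / k) powr (2 / \<theta> - 1) * S"
    unfolding S_def using k \<theta> by (intro Hoelder_support[OF h]) (auto simp: h_def)
  also have "\<dots> \<le> 2 / 3 * S"
  proof (rule mult_right_mono[OF _ S])
    have "u \<noteq> 0" "\<theta> > 0" using u \<theta> by auto
    moreover have "2 - \<theta> = 2 / u" by (simp add: \<theta>_def)
    moreover have "2 / \<theta> - 1 = (2 - \<theta>) / \<theta>" using \<open>\<theta> > 0\<close> by (simp add: diff_divide_distrib)
    ultimately have "2 / \<theta> - 1 = 2 / (u * \<theta>)" by simp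
    then have "(1 / k) powr (2 / \<theta> - 1) = exp (- (1 / \<theta>))"
      using u by (simp add: k_def powr_def ln_div)
    also have "\<dots> \<le> exp (- (1 / 2))" using \<theta> by (simp add: field_simps)
    also have "\<dots> \<le> 2 / 3"
    proof -
      have "1 + 1 / 2 \<le> exp (1 / 2 :: real)" by (rule exp_ge_add_one_self)
      then show ?thesis by (simp add: exp_minus field_simps)
    qed
    finally show "(1 / k) powr (2 / \<theta> - 1) \<le> 2 / 3" .
  qed
  finally have "S / 3 \<le> c * (2 - \<theta>) powr s * I"
    using LO_positive_part[OF f \<theta>, of k] by (simp add: S_def h_def I_def)
  also have "\<dots> \<le> c * (2 * u powr (- s)) * I"
  proof (intro mult_right_mono[OF _ I] mult_left_mono c(1))
    have "(2 - \<theta>) powr s = 2 powr s * u powr (- s)"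
      using u by (simp add: \<theta>_def powr_divide powr_minus field_simps)
    also have "2 powr s \<le> (2::real) powr 1" using s by (intro powr_mono) auto
    finally show "(2 - \<theta>) powr s \<le> 2 * u powr (- s)" using u by simp
  qed
  finally have "u powr s * S \<le> u powr s * (6 * c * u powr (- s) * I)" by (intro mult_left_mono) auto
  also have "\<dots> = (u powr s * u powr (- s)) * (6 * c * I)" by (simp add: mult_ac)
  also have "u powr s * u powr (- s) = 1" using u by (simp flip: powr_add)
  finally show ?thesis by (simp add: S_def I_def h_def k_def)
qed

end

section \<open>The modified logarithmic Sobolev inequality\<close>

lemma abs_between_le: "a \<le> x \<Longrightarrow> x \<le> b \<Longrightarrow> \<bar>x::real\<bar> \<le> \<bar>a\<bar> + \<bar>b\<bar>"
  by auto

lemma dyadic_level_exists: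
  fixes L :: real
  assumes "8 \<le> L" "L < 8 * 2 ^ J"
  shows "\<exists>j<J. 8 * 2 ^ j \<le> L \<and> L < 16 * 2 ^ j"
  using assms
proof (induction J)
  case (Suc J)
  show ?case
  proof (cases "L < 8 * 2 ^ J")
    case True
    then show ?thesis using Suc less_Suc_eq by blast
  next
    case False
    then show ?thesis using Suc.prems by (intro exI[of _ J]) auto
  qed
qed auto

text \<open>
  A geometric sum is comparable to its largest term, which is at most \<open>L\<^sup>a\<close>.
\<close>

lemma dyadic_sum_le:
  fixes a L :: real
  assumes a: "0 < a" and L: "4 \<le> L"
  shows "(\<Sum>j<J. (4 * 2 ^ j) powr a * of_bool (4 * 2 ^ j \<le> L)) \<le> 2 powr a / (2 powr a - 1) * L powr a"
proof -
  define q where "q = 2 powr a"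
  define \<kappa> where "\<kappa> = q / (q - 1)"
  have q: "q > 1" using powr_less_mono[of 0 a 2] a by (simp add: q_def)
  have \<kappa>: "\<kappa> > 0" "\<kappa> = (\<kappa> - 1) * q" using q by (auto simp: \<kappa>_def field_simps)
  have step: "(4 * 2 ^ Suc j) powr a = q * (4 * 2 ^ j) powr a" for j :: nat
    using powr_mult[of 2 "4 * 2 ^ j :: real" a] by (simp add: q_def mult_ac)
  have geo: "(\<Sum>j<J. (4 * 2 ^ j) powr a) \<le> (\<kappa> - 1) * (4 * 2 ^ J) powr a" for J :: nat
  proof (induction J)
    case 0
    have "\<kappa> - 1 \<ge> 0" using q by (simp add: \<kappa>_def field_simps)
    then show ?case by simp
  next
    case (Suc J)
    have "(\<Sum>j<Suc J. (4 * 2 ^ j) powr a) \<le> \<kappa> * (4 * 2 ^ J) powr a" using Suc by (simp add: algebra_simps)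
    also have "\<dots> = (\<kappa> - 1) * (4 * 2 ^ Suc J) powr a" by (subst \<kappa>(2)) (simp only: step mult_ac)
    finally show ?case .
  qed
  have "(\<Sum>j<J. (4 * 2 ^ j) powr a * of_bool (4 * 2 ^ j \<le> L)) \<le> \<kappa> * L powr a"
  proof (induction J)
    case 0
    then show ?case using \<kappa> by simp
  next
    case (Suc J)
    show ?case
    proof (cases "4 * 2 ^ J \<le> L")
      case True
      have "(\<Sum>j<Suc J. (4 * 2 ^ j) powr a * of_bool (4 * 2 ^ j \<le> L)) \<le> (\<Sum>j<Suc J. (4 * 2 ^ j) powr a)"
        by (intro sum_mono) auto
      also have "\<dots> \<le> \<kappa> * (4 * 2 ^ J) powr a" using geo[of J] by (simp add: algebra_simps)
      also have "\<dots> \<le> \<kappa> * L powr a" using \<kappa> True a by (intro mult_left_mono powr_mono2) auto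
      finally show ?thesis .
    next
      case False
      then show ?thesis using Suc by simp
    qed
  qed
  then show ?thesis by (simp add: \<kappa>_def q_def)
qed

text \<open>
  A single level suffices for the lower bound: the dyadic \<open>u\<close> with \<open>u \<le> L/2 < 2u\<close> lies so far below
  \<open>L\<close> that subtracting \<open>e\<^sup>u\<^sup>/\<^sup>2\<close> from \<open>y = e\<^sup>L\<^sup>/\<^sup>2\<close> costs at most a third of \<open>y\<close>.
\<close>

lemma multiscale_lower:
  fixes y L :: real
  assumes y: "y > 0" and L: "L = 2 * ln y" "8 \<le> L" "L < 8 * 2 ^ J"
  shows "L * y\<^sup>2 \<le> 9 * (\<Sum>j<J. 4 * 2 ^ j * (max 0 (y - exp (4 * 2 ^ j / 2)))\<^sup>2)"
proof -
  obtain j where j: "j < J" "8 * 2 ^ j \<le> L" "L < 16 * 2 ^ j"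
    using dyadic_level_exists[OF L(2,3)] by blast
  define u :: real where "u = 4 * 2 ^ j"
  have u: "2 * u \<le> L" "L < 4 * u" "u > 0" using j by (auto simp: u_def)
  have y_eq: "y = exp (L / 2)" using L y by simp
  have "exp (u / 2) = y * exp (- ((L - u) / 2))" unfolding y_eq by (simp add: field_simps flip: exp_add)
  also have "\<dots> \<le> y * exp (- 2)"
    using u L y by (intro mult_left_mono) auto
  also have "\<dots> \<le> y * (1 / 3)"
  proof -
    have "1 + 2 \<le> exp (2::real)" by (rule exp_ge_add_one_self)
    then have "exp (- 2) \<le> (1 / 3 :: real)" by (simp add: exp_minus field_simps)
    then show ?thesis using y by simp
  qed
  finally have k: "exp (u / 2) \<le> y / 3" by simp
  then have "(2 / 3 * y) ^ 2 \<le> (max 0 (y - exp (u / 2)))\<^sup>2" using y by (intro power_mono) auto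
  then have "4 / 9 * y\<^sup>2 \<le> (max 0 (y - exp (u / 2)))\<^sup>2" by (simp add: power_mult_distrib power2_eq_square)
  then have 1: "u * (4 / 9 * y\<^sup>2) \<le> u * (max 0 (y - exp (u / 2)))\<^sup>2" using u by simp
  have "L * y\<^sup>2 \<le> (4 * u) * y\<^sup>2" using u by (intro mult_right_mono) auto
  also have "\<dots> \<le> 9 * (u * (4 / 9 * y\<^sup>2))" by simp
  also have "\<dots> \<le> 9 * (u * (max 0 (y - exp (u / 2)))\<^sup>2)" using 1 by simp
  also have "\<dots> \<le> 9 * (\<Sum>j<J. 4 * 2 ^ j * (max 0 (y - exp (4 * 2 ^ j / 2)))\<^sup>2)"
    unfolding u_def using j(1)
    by (intro mult_left_mono member_le_sum[where f="\<lambda>j. 4 * 2 ^ j * (max 0 (y - exp (4 * 2 ^ j / 2)))\<^sup>2"]) auto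
  finally show ?thesis .
qed


text \<open>
  The function \<open>y\<^sup>2 ln y\<^sup>2 - y\<^sup>2 + 1\<close> vanishes to second order at \<open>y = 1\<close>, so on bounded ranges it is
  controlled by \<open>(y - 1)\<^sup>2\<close>; beyond \<open>y = e\<^sup>2\<close> its leading term alone dominates it.
\<close>

lemma entropy_kernel_le:
  assumes y: "(y::real) > 0"
  shows "y\<^sup>2 * (2 * ln y) - y\<^sup>2 + 1 \<le> y\<^sup>2 * (2 * ln y) * of_bool (4 \<le> 2 * ln y) + 20 * (y - 1)\<^sup>2"
proof (cases "4 \<le> 2 * ln y")
  case True
  then have "exp 2 \<le> y" using y by (simp add: ln_ge_iff)
  then have "1 \<le> y" using one_le_exp_iff[of "2::real"] by linarith
  then have "1 \<le> y\<^sup>2" by simp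
  then have "1 - y\<^sup>2 \<le> 20 * (y - 1)\<^sup>2" using zero_le_power2[of "y - 1"] by linarith
  then show ?thesis using True by simp
next
  case False
  then have "y < exp 2" using y by (simp add: ln_ge_iff not_le)
  also have "exp 2 = exp 1 * exp (1::real)" by (simp flip: exp_add)
  also have "\<dots> \<le> 3 * 3" using exp_le by (intro mult_mono) auto
  finally have y9: "y < 9" by simp
  have "y\<^sup>2 * (2 * ln y) - y\<^sup>2 + 1 \<le> y\<^sup>2 * (2 * (y - 1)) - y\<^sup>2 + 1"
    using ln_le_minus_one[OF y] by (simp add: mult_left_mono)
  also have "\<dots> = (2 * y + 1) * (y - 1)\<^sup>2" by (simp add: power2_eq_square algebra_simps)
  also have "\<dots> \<le> 20 * (y - 1)\<^sup>2" using y9 by (intro mult_right_mono) auto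
  finally show ?thesis using False by simp
qed

lemma medium_level_le:
  assumes y: "(y::real) > 0"
  shows "y\<^sup>2 * (2 * ln y) * (of_bool (4 \<le> 2 * ln y) - of_bool (8 \<le> 2 * ln y)) \<le> 16 * (y - 1)\<^sup>2"
proof (cases "4 \<le> 2 * ln y \<and> 2 * ln y < 8")
  case True
  then have "exp 2 \<le> y" using y by (simp add: ln_ge_iff)
  moreover have "exp 2 = exp 1 * exp (1::real)" by (simp flip: exp_add)
  moreover have "(2::real) * 2 \<le> exp 1 * exp 1" using exp_ge_add_one_self[of "1::real"] by (intro mult_mono) auto
  ultimately have "4 \<le> y" by simp
  then have "0 \<le> y * (y - 4) + 2" using y by (intro add_nonneg_nonneg mult_nonneg_nonneg) auto
  then have "y\<^sup>2 \<le> 2 * (y - 1)\<^sup>2" by (simp add: power2_eq_square algebra_simps)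
  moreover have "y\<^sup>2 * (2 * ln y) \<le> y\<^sup>2 * 8" using True by (intro mult_left_mono) auto
  ultimately show ?thesis using True by simp
next
  case False
  then show ?thesis by auto
qed

text \<open>
  Young's inequality with exponents \<open>1/s\<close> and \<open>1/(1-s)\<close>. The constant is placed on the first term so
  that \<open>L\<close> comes back with coefficient \<open>1/2\<close> and can be absorbed. This is where the power \<open>2/s\<close>
  of the gradient originates.
\<close>

lemma Young_gradient:
  fixes A z L s :: real
  assumes s: "0 < s" "s < 1" and A: "0 \<le> A" and z: "0 \<le> z" and L: "4 \<le> L"
  shows "A * z\<^sup>2 * L powr (1 - s) \<le> (2 * A) powr (1 / s) * z powr (2 / s) + L / 2"
proof (cases "A = 0 \<or> z = 0")
  case True
  then show ?thesis using L s by auto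
next
  case False
  then have Az: "A > 0" "z > 0" using A z by auto
  define a where "a = (2 * A * z\<^sup>2) powr (1 / s)"
  have a: "a > 0" using Az by (simp add: a_def)
  have "A * z\<^sup>2 * L powr (1 - s) = A * z\<^sup>2 * 2 powr (1 - s) * (L / 2) powr (1 - s)"
    using L by (simp add: powr_divide)
  also have "\<dots> \<le> A * z\<^sup>2 * 2 * (L / 2) powr (1 - s)"
    using powr_mono[of "1 - s" 1 "2::real"] s Az by (intro mult_right_mono mult_left_mono) auto
  also have "\<dots> = a powr s * (L / 2) powr (1 - s)"
    using s Az by (simp add: a_def powr_powr mult_ac)
  also have "\<dots> \<le> s * a + (1 - s) * (L / 2)"
    using s a L by (intro Youngs_inequality_0) auto
  also have "\<dots> \<le> 1 * a + 1 * (L / 2)"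
    using s a L by (intro add_mono mult_right_mono) auto
  also have "a = (2 * A) powr (1 / s) * z powr (2 / s)"
    using Az by (simp add: a_def powr_mult powr_powr flip: powr_numeral)
  finally show ?thesis by simp
qed

context LO_space begin

text \<open>
  The constant in front of \<open>(|\<nabla>f| / f)\<^sup>2 (ln f\<^sup>2)\<^sup>1\<^sup>-\<^sup>s\<close> after summing over the levels:
  \<open>9\<close> from \<open>multiscale_lower\<close>, \<open>6 c\<close> from \<open>Faber_Krahn_level\<close>, and the factor of \<open>dyadic_sum_le\<close>.
\<close>

definition "young_const = 54 * c * (2 powr (1 - s) / (2 powr (1 - s) - 1))"

lemma young_const_nonneg: "young_const \<ge> 0"
proof -
  have "2 powr (1 - s) > 1" using powr_less_mono[of 0 "1 - s" 2] s by simp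
  then show ?thesis using c by (simp add: young_const_def)
qed

text \<open>
  With \<open>T k = E[f\<^sup>2 L; L \<ge> k]\<close>, \<open>L = ln f\<^sup>2\<close>, the dyadic levels give \<open>T 8 \<le> E' + T 4 / 2\<close>, where \<open>E'\<close> is the
  term with the power \<open>2/s\<close> of the gradient. The range \<open>4 \<le> L < 8\<close> contributes a multiple of the
  variance \<open>V\<close> of \<open>f\<close>; as \<open>T 4\<close> is finite, the two bounds can be solved for it:
  \<open>T 4 \<le> 2 E' + 32 V\<close>. The remaining values of \<open>f\<close> cost another multiple of \<open>V\<close>.
\<close>

lemma entropy_kernel_integral:
  assumes f: "smooth d f" "bounded_measurable \<mu> f" "bounded_measurable \<mu> (grad_norm d f)" and b: "b > 0" "\<And>x. x \<in> space \<mu> \<Longrightarrow> b \<le> f x"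
    and m: "(\<integral>x. f x \<partial>\<mu>) = 1"
  shows "(\<integral>x. (f x)\<^sup>2 * (2 * ln (f x)) - (f x)\<^sup>2 + 1 \<partial>\<mu>)
    \<le> 52 * c * (\<integral>x. (grad_norm d f x)\<^sup>2 \<partial>\<mu>)
      + 2 * (2 * young_const) powr (1 / s) * (\<integral>x. (f x)\<^sup>2 * (grad_norm d f x / f x) powr (2 / s) \<partial>\<mu>)"
proof -
  have pos: "0 < f x" if "x \<in> space \<mu>" for x using b that by force
  obtain B where B: "B > 0" "\<And>x. x \<in> space \<mu> \<Longrightarrow> \<bar>f x\<bar> \<le> B" by (rule bounded_measurableE[OF f(2)]) auto
  define L where "L x = 2 * ln (f x)" for x
  define N where "N x = grad_norm d f x" for x
  define V where "V = (\<integral>x. (f x - 1)\<^sup>2 \<partial>\<mu>)"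
  define T where "T k = (\<integral>x. (f x)\<^sup>2 * L x * of_bool (k \<le> L x) \<partial>\<mu>)" for k
  define E where "E = (2 * young_const) powr (1 / s) * (\<integral>x. (f x)\<^sup>2 * (N x / f x) powr (2 / s) \<partial>\<mu>)"
  note [measurable] = bounded_measurable_measurable[OF f(2)] bounded_measurable_measurable[OF f(3)]
  have lnB: "ln b \<le> ln (f x)" "ln (f x) \<le> ln B" if "x \<in> space \<mu>" for x
    using B b pos that by (auto simp: abs_le_iff)
  have bmL: "bounded_measurable \<mu> L"
  proof (rule bounded_measurableI[where B="2 * (\<bar>ln b\<bar> + \<bar>ln B\<bar>)"])
    fix x assume "x \<in> space \<mu>"
    from abs_between_le[OF lnB[OF this]] show "\<bar>L x\<bar> \<le> 2 * (\<bar>ln b\<bar> + \<bar>ln B\<bar>)"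
      unfolding L_def by (simp add: abs_mult)
  qed (simp add: L_def[abs_def])
  have bmN: "bounded_measurable \<mu> N" unfolding N_def using f(3) .
  have N0: "0 \<le> N x" for x by (simp add: N_def grad_norm_nonneg)
  have bmq: "bounded_measurable \<mu> (\<lambda>x. N x / f x)"
  proof -
    have "bounded_measurable \<mu> (\<lambda>x. 1 / f x)"
    proof (rule bounded_measurableI[where B="1 / b"])
      show "\<bar>1 / f x\<bar> \<le> 1 / b" if "x \<in> space \<mu>" for x
        using frac_le[of 1 1 b "f x"] b pos[OF that] that by simp
    qed simp
    from bounded_measurable_mult[OF bmN this] show ?thesis by simp
  qed
  have bmqp: "bounded_measurable \<mu> (\<lambda>x. (N x / f x) powr (2 / s))"
    using pos N0 s by (intro bounded_measurable_powr[OF bmq]) (auto intro!: divide_nonneg_pos)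
  \<comment> \<open>Finitely many levels reach above the bounded function.\<close>
  obtain J where J: "2 * \<bar>ln B\<bar> < 2 ^ J" using real_arch_pow[of 2 "2 * \<bar>ln B\<bar>"] by auto
  have LJ: "L x < 8 * 2 ^ J" if "x \<in> space \<mu>" for x
    using lnB[OF that] J unfolding L_def by (simp add: abs_le_iff abs_less_iff)
  let ?u = "\<lambda>j::nat. 4 * 2 ^ j :: real"
  \<comment> \<open>The level inequality multiplied by \<open>u\<^sup>1\<^sup>-\<^sup>s\<close>.\<close>
  have level: "(\<integral>x. ?u j * (max 0 (f x - exp (?u j / 2)))\<^sup>2 \<partial>\<mu>) \<le> (\<integral>x. 6 * c * (N x)\<^sup>2 * (?u j powr (1 - s) * of_bool (?u j \<le> L x)) \<partial>\<mu>)" for j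
  proof -
    have u: "?u j \<ge> 4" by simp
    have "?u j powr (1 - s) * (?u j powr s * (\<integral>x. (max 0 (f x - exp (?u j / 2)))\<^sup>2 \<partial>\<mu>))
      \<le> ?u j powr (1 - s) * (6 * c * (\<integral>x. of_bool (exp (?u j / 2) \<le> f x) * (N x)\<^sup>2 \<partial>\<mu>))"
      unfolding N_def by (intro mult_left_mono Faber_Krahn_level f pos u) (auto simp: m)
    moreover have "?u j powr (1 - s) * ?u j powr s = ?u j" by (simp flip: powr_add)
    ultimately have "?u j * (\<integral>x. (max 0 (f x - exp (?u j / 2)))\<^sup>2 \<partial>\<mu>)
      \<le> ?u j powr (1 - s) * (6 * c * (\<integral>x. of_bool (exp (?u j / 2) \<le> f x) * (N x)\<^sup>2 \<partial>\<mu>))"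
      by (simp only: mult.assoc[symmetric])
    also have "(\<integral>x. of_bool (exp (?u j / 2) \<le> f x) * (N x)\<^sup>2 \<partial>\<mu>) = (\<integral>x. of_bool (?u j \<le> L x) * (N x)\<^sup>2 \<partial>\<mu>)"
    proof (rule Bochner_Integration.integral_cong)
      fix x assume "x \<in> space \<mu>"
      then have "exp (?u j / 2) \<le> f x \<longleftrightarrow> ?u j / 2 \<le> ln (f x)" using pos by (simp add: ln_ge_iff)
      then show "of_bool (exp (?u j / 2) \<le> f x) * (N x)\<^sup>2 = of_bool (?u j \<le> L x) * (N x)\<^sup>2"
        unfolding L_def by (simp add: field_simps)
    qed simp
    finally show ?thesis by (simp add: mult_ac flip: integral_mult_right_zero)
  qed
  have T8: "T 8 \<le> E + T 4 / 2"
  proof -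
    have "T 8 \<le> (\<integral>x. 9 * (\<Sum>j<J. ?u j * (max 0 (f x - exp (?u j / 2)))\<^sup>2) \<partial>\<mu>)"
      unfolding T_def
    proof (rule integral_mono)
      fix x assume x: "x \<in> space \<mu>"
      show "(f x)\<^sup>2 * L x * of_bool (8 \<le> L x) \<le> 9 * (\<Sum>j<J. ?u j * (max 0 (f x - exp (?u j / 2)))\<^sup>2)"
      proof (cases "8 \<le> L x")
        case True
        then show ?thesis using multiscale_lower[OF pos[OF x] L_def True LJ[OF x]] by (simp add: mult.commute)
      qed (auto intro!: sum_nonneg)
    qed (intro bounded_measurable_integrable bounded_measurable_intros f bmL)+
    also have "\<dots> = 9 * (\<Sum>j<J. \<integral>x. ?u j * (max 0 (f x - exp (?u j / 2)))\<^sup>2 \<partial>\<mu>)"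
      by (subst integral_mult_right_zero, subst Bochner_Integration.integral_sum)
         (intro bounded_measurable_integrable bounded_measurable_intros f refl)+
    also have "\<dots> \<le> 9 * (\<Sum>j<J. \<integral>x. 6 * c * (N x)\<^sup>2 * (?u j powr (1 - s) * of_bool (?u j \<le> L x)) \<partial>\<mu>)"
      by (intro mult_left_mono sum_mono level) auto
    also have "\<dots> = (\<integral>x. 9 * (\<Sum>j<J. 6 * c * (N x)\<^sup>2 * (?u j powr (1 - s) * of_bool (?u j \<le> L x))) \<partial>\<mu>)"
      by (subst integral_mult_right_zero, subst Bochner_Integration.integral_sum)
         (intro bounded_measurable_integrable bounded_measurable_intros bmN bmL refl)+
    also have "\<dots> \<le> (\<integral>x. (2 * young_const) powr (1 / s) * ((f x)\<^sup>2 * (N x / f x) powr (2 / s)) + 1/2 * ((f x)\<^sup>2 * L x * of_bool (4 \<le> L x)) \<partial>\<mu>)"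
    proof (rule integral_mono)
      fix x assume x: "x \<in> space \<mu>"
      have "9 * (\<Sum>j<J. 6 * c * (N x)\<^sup>2 * (?u j powr (1 - s) * of_bool (?u j \<le> L x)))
        = 9 * (6 * c * (N x)\<^sup>2 * (\<Sum>j<J. ?u j powr (1 - s) * of_bool (?u j \<le> L x)))"
        by (simp only: sum_distrib_left)
      also have "\<dots> = 54 * c * (N x)\<^sup>2 * (\<Sum>j<J. ?u j powr (1 - s) * of_bool (?u j \<le> L x))"
        by simp
      also have "\<dots> \<le> (2 * young_const) powr (1 / s) * ((f x)\<^sup>2 * (N x / f x) powr (2 / s)) + 1/2 * ((f x)\<^sup>2 * L x * of_bool (4 \<le> L x))"
      proof (cases "4 \<le> L x")
        case True
        have "54 * c * (N x)\<^sup>2 * (\<Sum>j<J. ?u j powr (1 - s) * of_bool (?u j \<le> L x))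
          \<le> 54 * c * (N x)\<^sup>2 * (2 powr (1 - s) / (2 powr (1 - s) - 1) * L x powr (1 - s))"
          using c s True by (intro mult_left_mono dyadic_sum_le) auto
        also have "\<dots> = (f x)\<^sup>2 * (young_const * (N x / f x)\<^sup>2 * L x powr (1 - s))"
          using pos[OF x] by (simp add: young_const_def power_divide)
        also have "\<dots> \<le> (f x)\<^sup>2 * ((2 * young_const) powr (1 / s) * (N x / f x) powr (2 / s) + L x / 2)"
          using pos[OF x] N0 by (intro mult_left_mono Young_gradient s young_const_nonneg True divide_nonneg_pos) auto
        also have "\<dots> = (2 * young_const) powr (1 / s) * ((f x)\<^sup>2 * (N x / f x) powr (2 / s)) + 1/2 * ((f x)\<^sup>2 * L x * of_bool (4 \<le> L x))"
          using True by (simp add: algebra_simps)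
        finally show ?thesis .
      next
        case False
        have "L x < ?u j" for j :: nat
        proof -
          have "1 \<le> (2::real) ^ j" by simp
          then show ?thesis using False by linarith
        qed
        then show ?thesis using False by (simp add: not_le[symmetric])
      qed
      finally show "9 * (\<Sum>j<J. 6 * c * (N x)\<^sup>2 * (?u j powr (1 - s) * of_bool (?u j \<le> L x))) \<le> \<dots>" .
    qed (intro bounded_measurable_integrable bounded_measurable_intros f bmN bmL bmqp)+
    also have "\<dots> = E + T 4 / 2"
    proof -
      have "integrable \<mu> (\<lambda>x. (f x)\<^sup>2 * (N x / f x) powr (2 / s))" "integrable \<mu> (\<lambda>x. (f x)\<^sup>2 * L x * of_bool (4 \<le> L x))"
        by (intro bounded_measurable_integrable bounded_measurable_intros f bmL bmqp)+
      then show ?thesis by (simp add: E_def T_def)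
    qed
    finally show ?thesis .
  qed
  have T4: "T 4 \<le> T 8 + 16 * V"
  proof -
    have "T 4 \<le> (\<integral>x. (f x)\<^sup>2 * L x * of_bool (8 \<le> L x) + 16 * (f x - 1)\<^sup>2 \<partial>\<mu>)"
      unfolding T_def
    proof (rule integral_mono)
      fix x assume x: "x \<in> space \<mu>"
      from medium_level_le[OF pos[OF x]]
      show "(f x)\<^sup>2 * L x * of_bool (4 \<le> L x) \<le> (f x)\<^sup>2 * L x * of_bool (8 \<le> L x) + 16 * (f x - 1)\<^sup>2"
        unfolding L_def by (simp add: right_diff_distrib)
    qed (intro bounded_measurable_integrable bounded_measurable_intros f bmL)+
    also have "\<dots> = T 8 + 16 * V"
    proof -
      have "integrable \<mu> (\<lambda>x. (f x)\<^sup>2 * L x * of_bool (8 \<le> L x))" "integrable \<mu> (\<lambda>x. (f x - 1)\<^sup>2)"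
        by (intro bounded_measurable_integrable bounded_measurable_intros f bmL)+
      then show ?thesis by (simp add: V_def T_def)
    qed
    finally show ?thesis .
  qed
  have V: "V \<le> c * (\<integral>x. (N x)\<^sup>2 \<partial>\<mu>)"
  proof -
    have i: "integrable \<mu> f" "integrable \<mu> (\<lambda>x. (f x)\<^sup>2)" by (intro bounded_measurable_integrable bounded_measurable_intros f)+
    have "V = (\<integral>x. (f x)\<^sup>2 - 2 * f x + 1 \<partial>\<mu>)" unfolding V_def by (simp add: power2_eq_square algebra_simps)
    also have "\<dots> = (\<integral>x. (f x)\<^sup>2 \<partial>\<mu>) - (\<integral>x. f x \<partial>\<mu>)\<^sup>2" using i m by (simp add: prob_space)
    finally show ?thesis using Poincare_positive[OF f pos] by (simp add: N_def)
  qed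
  have "(\<integral>x. (f x)\<^sup>2 * (2 * ln (f x)) - (f x)\<^sup>2 + 1 \<partial>\<mu>) \<le> (\<integral>x. (f x)\<^sup>2 * L x * of_bool (4 \<le> L x) + 20 * (f x - 1)\<^sup>2 \<partial>\<mu>)"
  proof (rule integral_mono)
    show "integrable \<mu> (\<lambda>x. (f x)\<^sup>2 * (2 * ln (f x)) - (f x)\<^sup>2 + 1)"
      unfolding L_def[symmetric] by (intro bounded_measurable_integrable bounded_measurable_intros f bmL)
    show "integrable \<mu> (\<lambda>x. (f x)\<^sup>2 * L x * of_bool (4 \<le> L x) + 20 * (f x - 1)\<^sup>2)"
      by (intro bounded_measurable_integrable bounded_measurable_intros f bmL)
    fix x assume x: "x \<in> space \<mu>"
    from entropy_kernel_le[OF pos[OF x]]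
    show "(f x)\<^sup>2 * (2 * ln (f x)) - (f x)\<^sup>2 + 1 \<le> (f x)\<^sup>2 * L x * of_bool (4 \<le> L x) + 20 * (f x - 1)\<^sup>2"
      by (simp add: L_def)
  qed
  also have "\<dots> = T 4 + 20 * V"
  proof -
    have "integrable \<mu> (\<lambda>x. (f x)\<^sup>2 * L x * of_bool (4 \<le> L x))" "integrable \<mu> (\<lambda>x. (f x - 1)\<^sup>2)"
      by (intro bounded_measurable_integrable bounded_measurable_intros f bmL)+
    then show ?thesis by (simp add: V_def T_def)
  qed
  also have "\<dots> \<le> 2 * E + 52 * V" using T8 T4 by linarith
  also have "\<dots> \<le> 2 * E + 52 * (c * (\<integral>x. (N x)\<^sup>2 \<partial>\<mu>))" using V by simp
  finally show ?thesis by (simp add: E_def N_def)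
qed

definition "mls_const = 13 * c + 2 * (2 * young_const) powr (1 / s)"

lemma mls_const_nonneg: "mls_const \<ge> 0" using c by (simp add: mls_const_def)

text \<open>
  Subtracting a constant from \<open>g\<close> makes \<open>f = e\<^sup>g\<^sup>/\<^sup>2\<close> have mean \<open>1\<close> and multiplies both sides by
  the same factor. Replacing \<open>- Z ln Z\<close> by its upper bound \<open>1 - Z\<close>, for \<open>Z = E f\<^sup>2\<close>, brings the
  entropy into the form of the preceding lemma.
\<close>

theorem modified_log_Sobolev:
  assumes g: "smooth d g" "bounded_measurable \<mu> g" "bounded_measurable \<mu> (grad_norm d g)"
  shows "ent \<mu> (\<lambda>x. exp (g x)) \<le> mls_const * (\<integral>x. ((grad_norm d g x)\<^sup>2 + grad_norm d g x powr (2 / s)) * exp (g x) \<partial>\<mu>)"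
proof -
  \<comment> \<open>Dividing by \<open>m\<close> normalises \<open>e\<^sup>g\<^sup>/\<^sup>2\<close> to mean \<open>1\<close>.\<close>
  define m where "m = (\<integral>x. exp (g x / 2) \<partial>\<mu>)"
  obtain B where B: "B > 0" "\<And>x. x \<in> space \<mu> \<Longrightarrow> \<bar>g x\<bar> \<le> B" by (rule bounded_measurableE[OF g(2)]) auto
  have bg2: "bounded_measurable \<mu> (\<lambda>x. g x / 2)" using bounded_measurable_mult[OF bounded_measurable_const g(2), of "1/2"] by simp
  have m: "m > 0"
  proof -
    have "exp (- B / 2) \<le> m" unfolding m_def
      using B by (intro integral_ge_const bounded_measurable_integrable bounded_measurable_intros bg2) (auto simp: abs_le_iff minus_le_iff)
    then show ?thesis using exp_gt_zero[of "- B / 2"] by linarith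
  qed
  define f where "f x = exp (1/2 * g x + - ln m)" for x
  define D where "D x = grad_norm d g x" for x
  have f_eq: "f x = exp (g x / 2) / m" for x using m by (simp add: f_def exp_diff)
  have fs: "smooth d f" unfolding f_def by (intro smooth_exp smooth_add smooth_mult smooth_const g)
  have fb: "bounded_measurable \<mu> f" unfolding f_def by (intro bounded_measurable_intros g)
  have gradf: "grad_norm d f x = f x * (D x / 2)" if "x \<in> space \<mu>" for x
  proof -
    have "((\<lambda>y. exp (1/2 * y + - ln m)) has_real_derivative exp (1/2 * y + - ln m) / 2) (at y)" for y
      by (auto intro!: derivative_eq_intros)
    from norm_grad_comp[OF g(1) _ this, of x] that show ?thesis
      by (simp add: f_def[abs_def] D_def space_\<mu>)
  qed
  have fg: "bounded_measurable \<mu> (grad_norm d f)"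
  proof -
    have b: "bounded_measurable \<mu> (\<lambda>x. f x * (1/2 * D x))" unfolding D_def by (intro bounded_measurable_intros fb g)
    show ?thesis unfolding bounded_measurable_def
    proof
      show "grad_norm d f \<in> borel_measurable \<mu>" by (rule measurable_grad_norm[OF fs])
      obtain C where "\<forall>x\<in>space \<mu>. \<bar>f x * (1/2 * D x)\<bar> \<le> C" using b unfolding bounded_measurable_def by blast
      moreover have "f x * (1/2 * D x) = grad_norm d f x" if "x \<in> space \<mu>" for x using gradf[OF that] by simp
      ultimately have "\<forall>x\<in>space \<mu>. \<bar>grad_norm d f x\<bar> \<le> C" by metis
      then show "\<exists>B. \<forall>x\<in>space \<mu>. \<bar>grad_norm d f x\<bar> \<le> B" by blast
    qed
  qed
  have f0: "0 < f x" for x by (simp add: f_def)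
  have D0: "0 \<le> D x" for x by (simp add: D_def grad_norm_nonneg)
  have fm: "(\<integral>x. f x \<partial>\<mu>) = 1" using m by (simp add: f_eq m_def)
  define b where "b = exp (1/2 * (- B) + - ln m)"
  have b: "b > 0" "\<And>x. x \<in> space \<mu> \<Longrightarrow> b \<le> f x"
    using B(2) by (auto simp: b_def f_def abs_le_iff minus_le_iff)
  have exp_eq: "exp (g x) = m\<^sup>2 * (f x)\<^sup>2" for x
    using m by (simp add: f_eq power_divide flip: exp_double)
  define Z where "Z = (\<integral>x. (f x)\<^sup>2 \<partial>\<mu>)"
  have iZ: "integrable \<mu> (\<lambda>x. (f x)\<^sup>2)" by (intro bounded_measurable_integrable bounded_measurable_intros fb)
  have Z: "Z > 0"
  proof -
    have "b\<^sup>2 \<le> Z" unfolding Z_def using b by (intro integral_ge_const iZ) (auto intro!: AE_I2 power_mono)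
    then show ?thesis using b(1) by (meson less_le_trans zero_less_power)
  qed
  have bl: "bounded_measurable \<mu> (\<lambda>x. 2 * ln (f x))" 
  proof -
    have "(\<lambda>x. 2 * ln (f x)) = (\<lambda>x. g x - 2 * ln m)" by (simp add: f_def)
    then show ?thesis by (simp only:) (intro bounded_measurable_intros g)
  qed
  have iL: "integrable \<mu> (\<lambda>x. (f x)\<^sup>2 * (2 * ln (f x)))" by (intro bounded_measurable_integrable bounded_measurable_intros fb bl)
  have "ent \<mu> (\<lambda>x. exp (g x)) = m\<^sup>2 * ((\<integral>x. (f x)\<^sup>2 * (2 * ln (f x)) \<partial>\<mu>) - Z * ln Z)"
  proof -
    have "(\<integral>x. exp (g x) * ln (exp (g x)) \<partial>\<mu>) = (\<integral>x. m\<^sup>2 * ((f x)\<^sup>2 * (2 * ln (f x))) + m\<^sup>2 * ln (m\<^sup>2) * (f x)\<^sup>2 \<partial>\<mu>)"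
    proof (rule Bochner_Integration.integral_cong)
      fix x
      have "ln (exp (g x)) = ln (m\<^sup>2) + 2 * ln (f x)"
        using m f0[of x] unfolding exp_eq by (simp add: ln_mult ln_realpow)
      then show "exp (g x) * ln (exp (g x)) = m\<^sup>2 * ((f x)\<^sup>2 * (2 * ln (f x))) + m\<^sup>2 * ln (m\<^sup>2) * (f x)\<^sup>2"
        unfolding exp_eq by (simp add: algebra_simps)
    qed simp
    also have "\<dots> = m\<^sup>2 * (\<integral>x. (f x)\<^sup>2 * (2 * ln (f x)) \<partial>\<mu>) + m\<^sup>2 * ln (m\<^sup>2) * Z"
      using iL iZ by (simp add: Z_def)
    finally have 1: "(\<integral>x. exp (g x) * ln (exp (g x)) \<partial>\<mu>) = \<dots>" .
    have 2: "(\<integral>x. exp (g x) \<partial>\<mu>) = m\<^sup>2 * Z" unfolding exp_eq Z_def by simp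
    have "ln (m\<^sup>2 * Z) = ln (m\<^sup>2) + ln Z" using m Z by (simp add: ln_mult)
    then show ?thesis unfolding ent_def 1 2 by (simp add: algebra_simps)
  qed
  also have "\<dots> \<le> m\<^sup>2 * (\<integral>x. (f x)\<^sup>2 * (2 * ln (f x)) - (f x)\<^sup>2 + 1 \<partial>\<mu>)"
  proof (rule mult_left_mono)
    have "Z * 0 \<le> Z * ln Z - Z + exp 0" using mult_le_ln_exp[OF Z, of 0] .
    then show "(\<integral>x. (f x)\<^sup>2 * (2 * ln (f x)) \<partial>\<mu>) - Z * ln Z \<le> (\<integral>x. (f x)\<^sup>2 * (2 * ln (f x)) - (f x)\<^sup>2 + 1 \<partial>\<mu>)"
      using iL iZ by (simp add: Z_def prob_space)
  qed simp
  also have "\<dots> \<le> m\<^sup>2 * (52 * c * (\<integral>x. (grad_norm d f x)\<^sup>2 \<partial>\<mu>)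
      + 2 * (2 * young_const) powr (1 / s) * (\<integral>x. (f x)\<^sup>2 * (grad_norm d f x / f x) powr (2 / s) \<partial>\<mu>))"
    by (intro mult_left_mono entropy_kernel_integral[OF fs fb fg b fm]) auto
  also have "\<dots> \<le> m\<^sup>2 * (52 * c * (\<integral>x. 1/4 * ((f x)\<^sup>2 * (D x)\<^sup>2) \<partial>\<mu>)
      + 2 * (2 * young_const) powr (1 / s) * (\<integral>x. (f x)\<^sup>2 * D x powr (2 / s) \<partial>\<mu>))"
  proof (intro mult_left_mono add_mono)
    show "(\<integral>x. (grad_norm d f x)\<^sup>2 \<partial>\<mu>) \<le> (\<integral>x. 1/4 * ((f x)\<^sup>2 * (D x)\<^sup>2) \<partial>\<mu>)"
      by (rule eq_refl, rule Bochner_Integration.integral_cong) (auto simp: gradf power_mult_distrib power_divide)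
    have bD: "bounded_measurable \<mu> (\<lambda>x. D x powr (2 / s))" using g(3) D0 s by (intro bounded_measurable_powr) (auto simp: D_def)
    show "(\<integral>x. (f x)\<^sup>2 * (grad_norm d f x / f x) powr (2 / s) \<partial>\<mu>) \<le> (\<integral>x. (f x)\<^sup>2 * D x powr (2 / s) \<partial>\<mu>)"
    proof (rule integral_mono')
      show "integrable \<mu> (\<lambda>x. (f x)\<^sup>2 * D x powr (2 / s))" by (intro bounded_measurable_integrable bounded_measurable_intros fb bD)
      fix x assume x: "x \<in> space \<mu>"
      have "grad_norm d f x / f x = D x / 2" using gradf[OF x] f0[of x] by simp
      then show "(f x)\<^sup>2 * (grad_norm d f x / f x) powr (2 / s) \<le> (f x)\<^sup>2 * D x powr (2 / s)"
        using D0[of x] s by (simp only:) (intro mult_left_mono powr_mono2, auto)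
    qed auto
  qed (use c in auto)
  also have "\<dots> \<le> mls_const * (\<integral>x. ((D x)\<^sup>2 + D x powr (2 / s)) * exp (g x) \<partial>\<mu>)"
  proof -
    have bD: "bounded_measurable \<mu> (\<lambda>x. D x powr (2 / s))" using g(3) D0 s by (intro bounded_measurable_powr) (auto simp: D_def)
    have i1: "integrable \<mu> (\<lambda>x. (f x)\<^sup>2 * (D x)\<^sup>2)" unfolding D_def by (intro bounded_measurable_integrable bounded_measurable_intros fb g)
    have i2: "integrable \<mu> (\<lambda>x. (f x)\<^sup>2 * D x powr (2 / s))" by (intro bounded_measurable_integrable bounded_measurable_intros fb bD)
    define P where "P = (\<integral>x. (f x)\<^sup>2 * (D x)\<^sup>2 \<partial>\<mu>)"
    define Q where "Q = (\<integral>x. (f x)\<^sup>2 * D x powr (2 / s) \<partial>\<mu>)"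
    have PQ: "P \<ge> 0" "Q \<ge> 0" unfolding P_def Q_def by simp_all
    define a where "a = 2 * (2 * young_const) powr (1 / s)"
    have "a \<ge> 0" by (simp add: a_def)
    have "(\<integral>x. ((D x)\<^sup>2 + D x powr (2 / s)) * exp (g x) \<partial>\<mu>) = (\<integral>x. m\<^sup>2 * ((f x)\<^sup>2 * (D x)\<^sup>2 + (f x)\<^sup>2 * D x powr (2 / s)) \<partial>\<mu>)"
      unfolding exp_eq by (simp add: algebra_simps)
    also have "\<dots> = m\<^sup>2 * (P + Q)" using i1 i2 by (simp add: P_def Q_def)
    finally have e: "(\<integral>x. ((D x)\<^sup>2 + D x powr (2 / s)) * exp (g x) \<partial>\<mu>) = m\<^sup>2 * (P + Q)" .
    have "13 * c * P + a * Q \<le> (13 * c + a) * (P + Q)"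
      using PQ \<open>a \<ge> 0\<close> c by (simp add: algebra_simps)
    then have "m\<^sup>2 * (13 * c * P + a * Q) \<le> m\<^sup>2 * ((13 * c + a) * (P + Q))" by (intro mult_left_mono) auto
    moreover have "(\<integral>x. 1/4 * ((f x)\<^sup>2 * (D x)\<^sup>2) \<partial>\<mu>) = 1/4 * P" unfolding P_def by (rule integral_mult_right_zero)
    ultimately show ?thesis unfolding e mls_const_def a_def[symmetric] Q_def[symmetric]
      by (simp add: mult_ac)
  qed
  finally show ?thesis by (simp add: D_def)
qed

end

section \<open>Laplace transforms on the product space\<close>

lemma block_index_less: "i < n \<Longrightarrow> j < d \<Longrightarrow> i * d + j < d * (n::nat)"
proof -
  assume "i < n" "j < d"
  have "i * d + j < Suc i * d" using \<open>j < d\<close> by simp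
  also have "\<dots> \<le> n * d" using \<open>i < n\<close> by (intro mult_le_mono1) simp
  finally show ?thesis by (simp add: mult.commute)
qed

lemma join_blocks_Rn: "join_blocks d n x \<in> Rn (d * n)"
  by (simp add: join_blocks_def Rn_def)

text \<open>
  Together with \<open>join_blocks_apply\<close> this says that varying coordinate \<open>j\<close> of block \<open>i\<close> is varying
  coordinate \<open>i d + j\<close> of the joined vector, so partial derivatives in a block are partial derivatives
  on the product.
\<close>

lemma join_blocks_upd:
  assumes "i < n" "j < d"
  shows "join_blocks d n (x(i := y(j := s))) = (join_blocks d n (x(i := y)))(i * d + j := s)"
proof
  fix k
  have "k = i * d + j \<longleftrightarrow> k div d = i \<and> k mod d = j"
    using assms by (metis div_mult_mod_eq div_mult_self3 mod_mult_self3 div_less mod_less add.right_neutral less_zeroE)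
  then show "join_blocks d n (x(i := y(j := s))) k = ((join_blocks d n (x(i := y)))(i * d + j := s)) k"
    using block_index_less[OF assms] by (auto simp: join_blocks_def)
qed

lemma join_blocks_apply:
  assumes "i < n" "j < d"
  shows "join_blocks d n x (i * d + j) = x i j"
  using block_index_less[OF assms] assms by (simp add: join_blocks_def)

lemma partial_deriv_block:
  assumes "i < n" "j < d"
  shows "partial_deriv j (\<lambda>y. f (join_blocks d n (x(i := y)))) y = partial_deriv (i * d + j) f (join_blocks d n (x(i := y)))"
  unfolding partial_deriv_def using assms by (simp add: join_blocks_upd join_blocks_apply fun_upd_same del: fun_upd_apply)

lemma continuous_join_blocks:
  assumes "i < n"
  shows "continuous_on A (\<lambda>y. join_blocks d n (x(i := y)))"
proof (rule continuous_on_coordinatewise_then_product)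
  fix k
  consider "k < d * n" "k div d = i" | "\<not> (k < d * n \<and> k div d = i)" by blast
  then show "continuous_on A (\<lambda>y. join_blocks d n (x(i := y)) k)"
  proof cases
    case 1
    have "continuous_on A (\<lambda>y :: nat \<Rightarrow> real. y (k mod d))"
      by (rule continuous_on_subset[OF continuous_on_product_coordinates]) auto
    then show ?thesis using 1 by (simp add: join_blocks_def)
  next
    case 2
    then have eq: "join_blocks d n (x(i := y)) k = join_blocks d n x k" for y
      by (auto simp: join_blocks_def)
    show ?thesis unfolding eq by simp
  qed
qed

lemma smooth_block:
  assumes "smooth (d * n) f" "i < n"
  shows "smooth d (\<lambda>y. f (join_blocks d n (x(i := y))))"
proof -
  have "C_k d k (\<lambda>y. f (join_blocks d n (x(i := y))))" if "C_k (d * n) k f" for k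
    using that
  proof (induction k arbitrary: f)
    case 0
    show ?case unfolding C_k.simps
      by (rule continuous_on_compose2[OF C_k_continuous[OF 0] continuous_join_blocks[OF assms(2)]])
         (auto intro: join_blocks_Rn)
  next
    case (Suc k)
    show ?case
    proof (rule C_k_SucI[where D="\<lambda>j y. partial_deriv (i * d + j) f (join_blocks d n (x(i := y)))"])
      show "continuous_on (Rn d) (\<lambda>y. f (join_blocks d n (x(i := y))))"
        by (rule continuous_on_compose2[OF C_k_continuous[OF Suc.prems] continuous_join_blocks[OF assms(2)]])
           (auto intro: join_blocks_Rn)
    next
      fix j y assume j: "j < d" and "y \<in> Rn d"
      show "((\<lambda>s. f (join_blocks d n (x(i := y(j := s))))) has_real_derivative
             partial_deriv (i * d + j) f (join_blocks d n (x(i := y)))) (at (y j))"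
        using C_k_partial_DERIV[OF Suc.prems block_index_less[OF assms(2) j] join_blocks_Rn, of "x(i := y)"] j assms(2)
        by (simp add: join_blocks_upd join_blocks_apply fun_upd_same del: fun_upd_apply)
    next
      fix j assume "j < d"
      then show "C_k d k (\<lambda>y. partial_deriv (i * d + j) f (join_blocks d n (x(i := y))))"
        using Suc.prems block_index_less[OF assms(2)] by (intro Suc.IH) auto
    qed
  qed
  then show ?thesis using assms(1) by (auto simp: smooth_def)
qed

lemma grad_block:
  assumes "i < n"
  shows "grad d (\<lambda>y. f (join_blocks d n (x(i := y)))) y = block d (grad (d * n) f (join_blocks d n (x(i := y)))) i"
  unfolding grad_def block_def
  using partial_deriv_block[OF assms] block_index_less[OF assms]
  by (auto simp: fun_eq_iff restrict_def simp del: fun_upd_apply)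

lemma sum_block_norms_squared:
  "(\<Sum>i<n. (euclid_norm d (block d v i))\<^sup>2) = (euclid_norm (d * n) v)\<^sup>2"
proof -
  have "(euclid_norm d (block d v i))\<^sup>2 = sum (\<lambda>k. (v k)\<^sup>2) {i * d..<i * d + d}" for i
  proof -
    have "(euclid_norm d (block d v i))\<^sup>2 = (\<Sum>j<d. (v (i * d + j))\<^sup>2)"
      unfolding L2_set_def by (simp add: block_def sum_nonneg)
    also have "\<dots> = sum (\<lambda>k. (v k)\<^sup>2) {i * d..<i * d + d}"
      using sum.shift_bounds_nat_ivl[of "\<lambda>k. (v k)\<^sup>2" 0 "i * d" d] by (simp add: add.commute atLeast0LessThan)
    finally show ?thesis .
  qed
  then have "(\<Sum>i<n. (euclid_norm d (block d v i))\<^sup>2) = (\<Sum>k<n * d. (v k)\<^sup>2)"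
    using sum.nat_group[of "\<lambda>k. (v k)\<^sup>2" d n] by simp
  also have "\<dots> = (euclid_norm (d * n) v)\<^sup>2"
    unfolding L2_set_def by (simp add: sum_nonneg mult.commute)
  finally show ?thesis .
qed

lemma sum_block_norms_powr:
  assumes "p > 0"
  shows "(\<Sum>i<n. euclid_norm d (block d v i) powr p) = norm_p2 d n p v powr p"
  unfolding norm_p2_def using assms by (simp add: powr_powr sum_nonneg)

lemma norm_p2_nonneg: "0 \<le> norm_p2 d n p v" by (simp add: norm_p2_def)

context LO_space begin

lemma p: "2 / s > 2" using s by (simp add: field_simps)

lemma measurable_join_blocks:
  "join_blocks d n \<in> measurable (Pi\<^sub>M {..<n} (\<lambda>_. \<mu>)) (borel_Rn (d * n))"
  unfolding borel_Rn_def join_blocks_def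
proof (rule measurable_restrict)
  fix k assume k: "k \<in> {..<d * n}"
  then have "d > 0" by (cases d) auto
  have "k div d < n" using k less_mult_imp_div_less[of k n d] by (simp add: mult.commute)
  have "(\<lambda>y. y (k mod d)) \<in> borel_measurable (borel_Rn d)"
    unfolding borel_Rn_def using \<open>d > 0\<close> by (intro measurable_component_singleton) auto
  then have 1: "(\<lambda>y. y (k mod d)) \<in> borel_measurable \<mu>" using measurable_cong_sets[OF sets_\<mu> refl] by blast
  have "(\<lambda>x. x (k div d)) \<in> measurable (Pi\<^sub>M {..<n} (\<lambda>_. \<mu>)) \<mu>"
    using \<open>k div d < n\<close> by (intro measurable_component_singleton) auto
  from measurable_compose[OF this 1] show "(\<lambda>x. x (k div d) (k mod d)) \<in> borel_measurable (Pi\<^sub>M {..<n} (\<lambda>_. \<mu>))" .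
qed

lemma prob_space_power: "prob_space (power_measure d n \<mu>)"
proof -
  interpret Q: prob_space "Pi\<^sub>M {..<n} (\<lambda>_. \<mu>)" by (rule prob_space_PiM) (rule prob_space_axioms)
  show ?thesis unfolding power_measure_def by (rule Q.prob_space_distr[OF measurable_join_blocks])
qed

lemma sets_power: "sets (power_measure d n \<mu>) = sets (borel_Rn (d * n))"
  by (simp add: power_measure_def)

lemma space_power: "space (power_measure d n \<mu>) = Rn (d * n)"
  by (simp add: power_measure_def space_borel_Rn)

lemma integral_power:
  fixes f :: "(nat \<Rightarrow> real) \<Rightarrow> real"
  assumes "f \<in> borel_measurable (borel_Rn (d * n))"
  shows "(\<integral>x. f x \<partial>power_measure d n \<mu>) = (\<integral>x. f (join_blocks d n x) \<partial>Pi\<^sub>M {..<n} (\<lambda>_. \<mu>))"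
  unfolding power_measure_def by (rule integral_distr[OF measurable_join_blocks assms]) 

text \<open>
  The modified logarithmic Sobolev inequality is applied in every block to \<open>l f\<close>. Since the blocks
  of the gradient sum to \<open>l\<^sup>2 |\<nabla>f|\<^sup>2\<close> and \<open>l\<^sup>p \<parallel>\<nabla>f\<parallel>\<^sup>p\<close> with \<open>p = 2/s > 2\<close>, and \<open>l\<^sup>p \<le> l\<^sup>2\<close> for \<open>l \<le> 1\<close>, the
  entropy of \<open>e\<^sup>l\<^sup>f\<close> satisfies the hypothesis of the Herbst argument.
\<close>

theorem Laplace_bounded:
  fixes f :: "(nat \<Rightarrow> real) \<Rightarrow> real"
  assumes f: "smooth (d * n) f" and B: "\<And>x. x \<in> Rn (d * n) \<Longrightarrow> \<bar>f x\<bar> \<le> B"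
    and a: "\<And>x. x \<in> Rn (d * n) \<Longrightarrow> grad_norm (d * n) f x \<le> a"
    and b: "\<And>x. x \<in> Rn (d * n) \<Longrightarrow> norm_p2 d n (2 / s) (grad (d * n) f x) \<le> b"
  shows "(\<integral>x. exp (f x) \<partial>power_measure d n \<mu>) \<le> exp ((\<integral>x. f x \<partial>power_measure d n \<mu>) + 2 * (mls_const * (a\<^sup>2 + b powr (2 / s))))"
proof -
  let ?Q = "Pi\<^sub>M {..<n} (\<lambda>_. \<mu>)"
  interpret Q: prob_space ?Q by (rule prob_space_PiM) (rule prob_space_axioms)
  define F where "F x = f (join_blocks d n x)" for x
  define p where "p = 2 / s"
  have p2: "p > 2" using p by (simp add: p_def)
  have fm: "f \<in> borel_measurable (borel_Rn (d * n))" by (intro continuous_on_Rn_measurable smooth_continuous f)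
  have [measurable]: "F \<in> borel_measurable ?Q"
    unfolding F_def by (rule measurable_compose[OF measurable_join_blocks fm])
  have FB: "\<bar>F x\<bar> \<le> B" for x unfolding F_def by (rule B[OF join_blocks_Rn])
  have B0: "B \<ge> 0" using FB by (meson abs_ge_zero order_trans)
  have a0: "a \<ge> 0" using a[OF join_blocks_Rn] grad_norm_nonneg order_trans by blast
  have b0: "b \<ge> 0" using b[OF join_blocks_Rn] norm_p2_nonneg order_trans by blast
  define N where "N i x = euclid_norm d (block d (grad (d * n) f (join_blocks d n x)) i)" for i x
  have N0: "0 \<le> N i x" for i x by (simp add: N_def L2_set_nonneg)
  have N2: "(\<Sum>i<n. (N i x)\<^sup>2) \<le> a\<^sup>2" for x
    unfolding N_def sum_block_norms_squared using a[OF join_blocks_Rn] L2_set_nonneg by (intro power_mono) auto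
  have Np: "(\<Sum>i<n. N i x powr p) \<le> b powr p" for x
  proof -
    have "(\<Sum>i<n. N i x powr p) = norm_p2 d n p (grad (d * n) f (join_blocks d n x)) powr p"
      unfolding N_def using p2 by (intro sum_block_norms_powr) auto
    also have "\<dots> \<le> b powr p" using b[OF join_blocks_Rn] p2 s norm_p2_nonneg by (intro powr_mono2) (auto simp: p_def)
    finally show ?thesis .
  qed
  have Na: "N i x \<le> a" if "i < n" for i x
  proof -
    have "(N i x)\<^sup>2 \<le> (\<Sum>i<n. (N i x)\<^sup>2)" using that by (intro member_le_sum) auto
    also have "\<dots> \<le> a\<^sup>2" by (rule N2)
    finally show ?thesis using a0 by (rule power2_le_imp_le)
  qed
  have Nm[measurable]: "N i \<in> borel_measurable ?Q" if "i < n" for i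
  proof -
    have "(\<lambda>x. partial_deriv (i * d + j) f (join_blocks d n x)) \<in> borel_measurable ?Q" if "j < d" for j
      using block_index_less[OF \<open>i < n\<close> that]
      by (intro measurable_compose[OF measurable_join_blocks] continuous_on_Rn_measurable smooth_continuous smooth_partial f)
    moreover have "N i = (\<lambda>x. sqrt (\<Sum>j<d. (partial_deriv (i * d + j) f (join_blocks d n x))\<^sup>2))"
      unfolding N_def L2_set_def using block_index_less[OF \<open>i < n\<close>]
      by (intro ext arg_cong[of _ _ sqrt] sum.cong) (auto simp: block_def grad_def)
    ultimately show ?thesis
      by (simp only:) (intro measurable_compose[OF _ borel_measurable_sqrt] borel_measurable_sum borel_measurable_power, auto)
  qed
  have bmF: "bounded_measurable ?Q F" using FB by (intro bounded_measurableI) auto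
  have bmN: "bounded_measurable ?Q (N i)" if "i < n" for i using Na[OF that] N0 Nm[OF that] by (intro bounded_measurableI[where B=a]) auto
  have bmNp: "bounded_measurable ?Q (\<lambda>x. N i x powr p)" if "i < n" for i using bmN[OF that] N0 p2 by (intro bounded_measurable_powr) auto
  have "(\<integral>x. exp (F x) \<partial>?Q) \<le> exp ((\<integral>x. F x \<partial>?Q) + 2 * (mls_const * (a\<^sup>2 + b powr p)))"
  proof (rule Q.Herbst_dyadic[where B=B])
    fix l :: real assume l: "0 < l" "l \<le> 1"
    define G where "G i x = mls_const * (((l * N i x)\<^sup>2 + (l * N i x) powr p) * exp (l * F x))" for i x
    have G_eq: "G i x = mls_const * ((l\<^sup>2 * (N i x)\<^sup>2 + l powr p * N i x powr p) * exp (l * F x))" for i x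
      using l N0 by (simp add: G_def power_mult_distrib powr_mult)
    have bmG: "bounded_measurable ?Q (G i)" if "i < n" for i
      unfolding G_eq by (intro bounded_measurable_intros bmN bmNp bmF that)
    have lF: "\<bar>l * F x\<bar> \<le> B" for x
      unfolding abs_mult using mult_mono[of "\<bar>l\<bar>" 1 "\<bar>F x\<bar>" B] FB[of x] l by auto
    have Gb: "\<bar>G i x\<bar> \<le> mls_const * ((a\<^sup>2 + a powr p) * exp B)" if "i < n" for i x
    proof -
      have lN: "0 \<le> l * N i x" "l * N i x \<le> a"
        using l N0[of i x] Na[OF that, of x] mult_mono[of l 1 "N i x" a] by auto
      have "((l * N i x)\<^sup>2 + (l * N i x) powr p) * exp (l * F x) \<le> (a\<^sup>2 + a powr p) * exp B"
        using lN p2 lF[of x] by (intro mult_mono add_mono power_mono powr_mono2) (auto simp: abs_le_iff)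
      then show ?thesis unfolding G_def using mls_const_nonneg lN by (simp add: abs_mult mult_left_mono)
    qed
    have ie: "integrable ?Q (\<lambda>x. exp (l * F x))" by (intro Q.bounded_measurable_integrable bounded_measurable_intros bmF)
    have "ent ?Q (\<lambda>x. exp (l * F x)) \<le> (\<Sum>i<n. \<integral>x. G i x \<partial>?Q)"
    proof (rule ent_PiM_le[where c="exp (- B)" and K="exp B" and B="mls_const * ((a\<^sup>2 + a powr p) * exp B)"])
      show "exp (- B) \<le> exp (l * F x) \<and> exp (l * F x) \<le> exp B" for x
        using lF[of x] by (auto simp: abs_le_iff minus_le_iff)
      fix i x assume i: "i \<in> {..<n}" and x: "x \<in> space ?Q"
      show "ent \<mu> (\<lambda>y. exp (l * F (x(i := y)))) \<le> (\<integral>y. G i (x(i := y)) \<partial>\<mu>)"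
      proof -
        define g0 where "g0 y = F (x(i := y))" for y
        define g where "g y = l * g0 y" for y
        have g0s: "smooth d g0" unfolding g0_def F_def using i by (intro smooth_block f) auto
        have gs: "smooth d g" unfolding g_def by (intro smooth_mult smooth_const g0s)
        have ng0: "grad_norm d g0 y = N i (x(i := y))" for y
          unfolding g0_def F_def N_def using i by (subst grad_block) auto
        have ng: "grad_norm d g y = l * N i (x(i := y))" if "y \<in> space \<mu>" for y
        proof -
          have "grad_norm d (\<lambda>y. l * g0 y) y = \<bar>l\<bar> * grad_norm d g0 y"
            using that by (intro norm_grad_comp g0s) (auto simp: space_\<mu> intro!: derivative_eq_intros)
          then show ?thesis using l by (simp add: g_def[abs_def] ng0)
        qed
        have "bounded_measurable \<mu> g" using lF by (intro bounded_measurableI[where B=B] measurable_smooth gs) (simp add: g_def g0_def)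
        moreover have "bounded_measurable \<mu> (grad_norm d g)"
        proof (rule bounded_measurableI[where B="l * a"])
          show "\<bar>grad_norm d g y\<bar> \<le> l * a" if "y \<in> space \<mu>" for y
            using ng[OF that] l N0[of i "x(i := y)"] Na[of i "x(i := y)"] i by (simp add: mult_left_mono)
        qed (rule measurable_grad_norm[OF gs])
        ultimately have "ent \<mu> (\<lambda>y. exp (g y)) \<le> mls_const * (\<integral>y. ((grad_norm d g y)\<^sup>2 + grad_norm d g y powr (2 / s)) * exp (g y) \<partial>\<mu>)"
          by (intro modified_log_Sobolev gs)
        also have "\<dots> = (\<integral>y. mls_const * (((grad_norm d g y)\<^sup>2 + grad_norm d g y powr (2 / s)) * exp (g y)) \<partial>\<mu>)" by simp
        also have "\<dots> = (\<integral>y. G i (x(i := y)) \<partial>\<mu>)"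
          by (rule Bochner_Integration.integral_cong) (auto simp: G_def ng g_def g0_def p_def simp del: fun_upd_apply)
        finally show ?thesis by (simp add: g_def g0_def)
      qed
    qed (use bounded_measurable_measurable[OF bmG] Gb prob_space_axioms in auto)
    also have "\<dots> = (\<integral>x. (\<Sum>i<n. G i x) \<partial>?Q)"
      by (subst Bochner_Integration.integral_sum) (auto intro: Q.bounded_measurable_integrable bmG)
    also have "\<dots> \<le> (\<integral>x. mls_const * (a\<^sup>2 + b powr p) * l\<^sup>2 * exp (l * F x) \<partial>?Q)"
    proof (rule integral_mono)
      show "integrable ?Q (\<lambda>x. \<Sum>i<n. G i x)" by (intro Q.bounded_measurable_integrable bounded_measurable_sum bmG) auto
      show "integrable ?Q (\<lambda>x. mls_const * (a\<^sup>2 + b powr p) * l\<^sup>2 * exp (l * F x))" by (intro Q.bounded_measurable_integrable bounded_measurable_intros bmF)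
      fix x
      have "l powr p \<le> l powr 2" using l p2 by (intro powr_mono') auto
      then have lp: "l powr p \<le> l\<^sup>2" using l by simp
      have "(\<Sum>i<n. G i x) = mls_const * (exp (l * F x) * (l\<^sup>2 * (\<Sum>i<n. (N i x)\<^sup>2) + l powr p * (\<Sum>i<n. N i x powr p)))"
        unfolding G_eq by (simp add: sum_distrib_left sum.distrib algebra_simps)
      also have "\<dots> \<le> mls_const * (exp (l * F x) * (l\<^sup>2 * a\<^sup>2 + l\<^sup>2 * b powr p))"
        using N2 Np lp by (intro mult_left_mono add_mono mult_mono mls_const_nonneg) (auto intro: sum_nonneg)
      finally show "(\<Sum>i<n. G i x) \<le> mls_const * (a\<^sup>2 + b powr p) * l\<^sup>2 * exp (l * F x)" by (simp add: algebra_simps)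
    qed
    also have "\<dots> = mls_const * (a\<^sup>2 + b powr p) * l\<^sup>2 * (\<integral>x. exp (l * F x) \<partial>?Q)" by simp
    finally show "ent ?Q (\<lambda>x. exp (l * F x)) \<le> mls_const * (a\<^sup>2 + b powr p) * l\<^sup>2 * (\<integral>x. exp (l * F x) \<partial>?Q)" .
  qed (use FB in auto)
  then show ?thesis
    using integral_power[OF fm] integral_power[of "\<lambda>x. exp (f x)" n] fm by (simp add: F_def p_def)
qed

end

section \<open>Removing boundedness, and tail bounds\<close>

text \<open>
  The Laplace bound for the truncations \<open>X k\<close> bounds their variances uniformly. If \<open>P(|f| \<le> R) \<ge> 1/2\<close>
  then \<open>|X k| \<le> R\<close> on the same event, so a mean of \<open>X k\<close> far outside \<open>[-R, R]\<close> would contradict the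
  variance bound. Hence the means, and with them the second moments, are bounded, and Fatou's lemma
  shows that \<open>f\<close> is square integrable. The means then converge by dominated convergence, and Fatou's
  lemma passes the centred Laplace bound to the limit.
\<close>

lemma (in prob_space) Laplace_limit:
  fixes f :: "'a \<Rightarrow> real" and X :: "nat \<Rightarrow> 'a \<Rightarrow> real"
  assumes fm[measurable]: "f \<in> borel_measurable M" and X: "\<And>k. bounded_measurable M (X k)"
    and le: "\<And>k x. x \<in> space M \<Longrightarrow> \<bar>X k x\<bar> \<le> \<bar>f x\<bar>"
    and lim: "\<And>x. x \<in> space M \<Longrightarrow> (\<lambda>k. X k x) \<longlonglongrightarrow> f x"
    and L: "\<And>k l. (\<integral>x. exp (l * X k x) \<partial>M) \<le> exp (l * (\<integral>x. X k x \<partial>M) + \<Phi> l)"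
  shows "integrable M f" and "\<And>l. (\<integral>\<^sup>+x. ennreal (exp (l * (f x - (\<integral>y. f y \<partial>M)))) \<partial>M) \<le> ennreal (exp (\<Phi> l))"
proof -
  define m where "m k = (\<integral>x. X k x \<partial>M)" for k
  note [measurable] = bounded_measurable_measurable[OF X]
  have iX: "integrable M (X k)" for k by (intro bounded_measurable_integrable X)
  have centred: "(\<integral>x. exp (l * (X k x - m k)) \<partial>M) \<le> exp (\<Phi> l)" for k l
  proof -
    have "(\<integral>x. exp (l * (X k x - m k)) \<partial>M) = (\<integral>x. exp (- (l * m k)) * exp (l * X k x) \<partial>M)"
      by (simp add: algebra_simps flip: exp_add)
    also have "\<dots> = exp (- (l * m k)) * (\<integral>x. exp (l * X k x) \<partial>M)" by simp
    also have "\<dots> \<le> exp (- (l * m k)) * exp (l * m k + \<Phi> l)"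
      using L[of l k] by (intro mult_left_mono) (auto simp: m_def)
    also have "\<dots> = exp (\<Phi> l)" by (simp flip: exp_add)
    finally show ?thesis .
  qed
  define V where "V = 2 * (exp (\<Phi> 1) + exp (\<Phi> (-1)))"
  have V0: "V \<ge> 0" unfolding V_def by (simp add: add_nonneg_nonneg)
  \<comment> \<open>The Laplace bounds at \<open>1\<close> and \<open>-1\<close> control the variance through this inequality.\<close>
  have sq: "y\<^sup>2 \<le> 2 * (exp y + exp (- y))" for y :: real
  proof -
    have *: "y\<^sup>2 \<le> 2 * exp y" if "y \<ge> 0" for y :: real
      using exp_lower_Taylor_quadratic[OF that] that by simp
    show ?thesis
    proof (cases "y \<ge> 0")
      case True
      have "y\<^sup>2 \<le> 2 * exp y" by (rule *[OF True])
      also have "\<dots> \<le> 2 * (exp y + exp (- y))" by simp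
      finally show ?thesis .
    next
      case False
      have "y\<^sup>2 \<le> 2 * exp (- y)" using *[of "- y"] False by simp
      also have "\<dots> \<le> 2 * (exp y + exp (- y))" by simp
      finally show ?thesis .
    qed
  qed
  have bX: "bounded_measurable M (\<lambda>x. X k x - m k)" for k by (intro bounded_measurable_intros X)
  have var: "(\<integral>x. (X k x - m k)\<^sup>2 \<partial>M) \<le> V" for k
  proof -
    have i: "integrable M (\<lambda>x. exp (l * (X k x - m k)))" for l by (intro bounded_measurable_integrable bounded_measurable_intros bX)
    have "(\<integral>x. (X k x - m k)\<^sup>2 \<partial>M) \<le> (\<integral>x. 2 * (exp (1 * (X k x - m k)) + exp (-1 * (X k x - m k))) \<partial>M)"
    proof (rule integral_mono)
      show "integrable M (\<lambda>x. (X k x - m k)\<^sup>2)" by (intro bounded_measurable_integrable bounded_measurable_intros bX)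
      show "integrable M (\<lambda>x. 2 * (exp (1 * (X k x - m k)) + exp (-1 * (X k x - m k))))"
        by (intro bounded_measurable_integrable bounded_measurable_intros bX)
      show "(X k x - m k)\<^sup>2 \<le> 2 * (exp (1 * (X k x - m k)) + exp (-1 * (X k x - m k)))" for x
        using sq[of "X k x - m k"] by simp
    qed
    also have "\<dots> = 2 * ((\<integral>x. exp (1 * (X k x - m k)) \<partial>M) + (\<integral>x. exp (-1 * (X k x - m k)) \<partial>M))"
      by (subst integral_mult_right_zero, subst Bochner_Integration.integral_add) (rule i refl)+
    also have "\<dots> \<le> V" unfolding V_def by (intro mult_left_mono add_mono centred) auto
    finally show ?thesis .
  qed
  obtain R where R: "R \<ge> 0" "(1/2::real) \<le> (\<integral>x. of_bool (\<bar>f x\<bar> \<le> R) \<partial>M)"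
  proof -
    have "(\<lambda>n. \<integral>x. of_bool (\<bar>f x\<bar> \<le> real n) \<partial>M) \<longlonglongrightarrow> (\<integral>x. 1 \<partial>M :: real)"
    proof (rule integral_dominated_convergence[where w="\<lambda>_. 1"])
      show "AE x in M. (\<lambda>n. of_bool (\<bar>f x\<bar> \<le> real n) :: real) \<longlonglongrightarrow> 1"
      proof (rule AE_I2)
        fix x
        obtain N where "\<bar>f x\<bar> \<le> real N" using real_arch_simple by blast
        then have "\<forall>\<^sub>F n in sequentially. of_bool (\<bar>f x\<bar> \<le> real n) = (1::real)"
          by (intro eventually_sequentiallyI[of N]) auto
        then show "(\<lambda>n. of_bool (\<bar>f x\<bar> \<le> real n) :: real) \<longlonglongrightarrow> 1" by (rule tendsto_eventually)
      qed
    qed auto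
    then have "\<forall>\<^sub>F n in sequentially. (1/2::real) < (\<integral>x. of_bool (\<bar>f x\<bar> \<le> real n) \<partial>M)"
      by (rule order_tendstoD) (simp add: prob_space)
    then obtain n where "(1/2::real) < (\<integral>x. of_bool (\<bar>f x\<bar> \<le> real n) \<partial>M)"
      by (meson eventually_sequentially order_refl)
    then show ?thesis using that[of "real n"] by auto
  qed
  have bR: "bounded_measurable M (\<lambda>x. of_bool (\<bar>f x\<bar> \<le> R))" by (rule bounded_measurable_indicator) measurable
  have mk: "\<bar>m k\<bar> \<le> R + sqrt (2 * V)" for k
  proof (cases "\<bar>m k\<bar> \<le> R")
    case True
    then show ?thesis using V0 by (smt (verit) real_sqrt_ge_zero)
  next
    case False
    have "(\<bar>m k\<bar> - R)\<^sup>2 * (1/2) \<le> (\<bar>m k\<bar> - R)\<^sup>2 * (\<integral>x. of_bool (\<bar>f x\<bar> \<le> R) \<partial>M)"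
      using R by (intro mult_left_mono) auto
    also have "\<dots> = (\<integral>x. (\<bar>m k\<bar> - R)\<^sup>2 * of_bool (\<bar>f x\<bar> \<le> R) \<partial>M)" by simp
    also have "\<dots> \<le> (\<integral>x. (X k x - m k)\<^sup>2 \<partial>M)"
    proof (rule integral_mono)
      show "integrable M (\<lambda>x. (X k x - m k)\<^sup>2)" by (intro bounded_measurable_integrable bounded_measurable_intros bX)
      show "integrable M (\<lambda>x. (\<bar>m k\<bar> - R)\<^sup>2 * of_bool (\<bar>f x\<bar> \<le> R))" by (intro bounded_measurable_integrable bounded_measurable_intros bR)
      fix x assume x: "x \<in> space M"
      show "(\<bar>m k\<bar> - R)\<^sup>2 * of_bool (\<bar>f x\<bar> \<le> R) \<le> (X k x - m k)\<^sup>2"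
      proof (cases "\<bar>f x\<bar> \<le> R")
        case True
        then have "\<bar>m k\<bar> - R \<le> \<bar>X k x - m k\<bar>" using le[OF x, of k] by linarith
        then have "(\<bar>m k\<bar> - R)\<^sup>2 \<le> \<bar>X k x - m k\<bar>\<^sup>2" using False by (intro power_mono) auto
        then show ?thesis using True by simp
      qed simp
    qed
    also have "\<dots> \<le> V" by (rule var)
    finally have "(\<bar>m k\<bar> - R)\<^sup>2 \<le> 2 * V" by simp
    then have "\<bar>m k\<bar> - R \<le> sqrt (2 * V)" by (rule real_le_rsqrt)
    then show ?thesis by simp
  qed
  define W where "W = 2 * V + 2 * (R + sqrt (2 * V))\<^sup>2"
  have second: "(\<integral>x. (X k x)\<^sup>2 \<partial>M) \<le> W" for k
  proof -
    have i: "integrable M (\<lambda>x. (X k x - m k)\<^sup>2)" by (intro bounded_measurable_integrable bounded_measurable_intros bX)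
    have "(\<integral>x. (X k x)\<^sup>2 \<partial>M) \<le> (\<integral>x. 2 * (X k x - m k)\<^sup>2 + 2 * (m k)\<^sup>2 \<partial>M)"
    proof (rule integral_mono)
      show "integrable M (\<lambda>x. (X k x)\<^sup>2)" by (intro bounded_measurable_integrable bounded_measurable_intros X)
      show "integrable M (\<lambda>x. 2 * (X k x - m k)\<^sup>2 + 2 * (m k)\<^sup>2)" using i by simp
      show "(X k x)\<^sup>2 \<le> 2 * (X k x - m k)\<^sup>2 + 2 * (m k)\<^sup>2" for x
        using zero_le_power2[of "X k x - 2 * m k"] by (simp add: power2_eq_square algebra_simps)
    qed
    also have "\<dots> = 2 * (\<integral>x. (X k x - m k)\<^sup>2 \<partial>M) + 2 * (m k)\<^sup>2" using i by (simp add: prob_space)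
    also have "\<dots> \<le> 2 * V + 2 * (R + sqrt (2 * V))\<^sup>2"
      using var[of k] mk[of k] power_mono[of "\<bar>m k\<bar>" "R + sqrt (2 * V)" 2] by simp
    finally show ?thesis by (simp add: W_def)
  qed
  have f2: "(\<integral>\<^sup>+x. ennreal ((f x)\<^sup>2) \<partial>M) \<le> ennreal W"
  proof -
    have "(\<integral>\<^sup>+x. ennreal ((f x)\<^sup>2) \<partial>M) = (\<integral>\<^sup>+x. liminf (\<lambda>k. ennreal ((X k x)\<^sup>2)) \<partial>M)"
    proof (rule nn_integral_cong)
      fix x assume "x \<in> space M"
      then have "(\<lambda>k. ennreal ((X k x)\<^sup>2)) \<longlonglongrightarrow> ennreal ((f x)\<^sup>2)" by (intro tendsto_intros lim)
      from lim_imp_Liminf[OF _ this] show "ennreal ((f x)\<^sup>2) = liminf (\<lambda>k. ennreal ((X k x)\<^sup>2))" by simp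
    qed
    also have "\<dots> \<le> liminf (\<lambda>k. \<integral>\<^sup>+x. ennreal ((X k x)\<^sup>2) \<partial>M)" by (rule nn_integral_liminf) measurable
    also have "\<dots> \<le> liminf (\<lambda>k. ennreal W)"
    proof (intro Liminf_mono always_eventually allI)
      fix k
      have "integrable M (\<lambda>x. (X k x)\<^sup>2)" by (intro bounded_measurable_integrable bounded_measurable_intros X)
      then show "(\<integral>\<^sup>+x. ennreal ((X k x)\<^sup>2) \<partial>M) \<le> ennreal W"
        using second[of k] by (subst nn_integral_eq_integral) (auto intro: ennreal_leI)
    qed
    finally show ?thesis by (simp add: Liminf_const)
  qed
  have "integrable M (\<lambda>x. (f x)\<^sup>2)"
    by (rule integrableI_nonneg) (use f2 in \<open>auto simp: top_unique intro: le_less_trans[OF _ ennreal_less_top]\<close>)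
  then have "integrable M (\<lambda>x. 1 + (f x)\<^sup>2)" by simp
  then show int_f: "integrable M f"
  proof (rule Bochner_Integration.integrable_bound)
    have "\<bar>y\<bar> \<le> 1 + y\<^sup>2" for y :: real
      using zero_le_power2[of "\<bar>y\<bar> - 1"] by (simp add: power2_eq_square algebra_simps)
    then show "AE x in M. norm (f x) \<le> norm (1 + (f x)\<^sup>2)" by (intro AE_I2) (simp add: abs_of_nonneg)
  qed measurable
  have mlim: "m \<longlonglongrightarrow> (\<integral>x. f x \<partial>M)"
    unfolding m_def
    by (rule integral_dominated_convergence[where w="\<lambda>x. \<bar>f x\<bar>"]) (use int_f lim le in auto)
  fix l
  show "(\<integral>\<^sup>+x. ennreal (exp (l * (f x - (\<integral>y. f y \<partial>M)))) \<partial>M) \<le> ennreal (exp (\<Phi> l))"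
  proof -
    have "(\<integral>\<^sup>+x. ennreal (exp (l * (f x - (\<integral>y. f y \<partial>M)))) \<partial>M) = (\<integral>\<^sup>+x. liminf (\<lambda>k. ennreal (exp (l * (X k x - m k)))) \<partial>M)"
    proof (rule nn_integral_cong)
      fix x assume "x \<in> space M"
      then have "(\<lambda>k. ennreal (exp (l * (X k x - m k)))) \<longlonglongrightarrow> ennreal (exp (l * (f x - (\<integral>y. f y \<partial>M))))"
        by (intro tendsto_intros lim mlim)
      from lim_imp_Liminf[OF _ this]
      show "ennreal (exp (l * (f x - (\<integral>y. f y \<partial>M)))) = liminf (\<lambda>k. ennreal (exp (l * (X k x - m k))))" by simp
    qed
    also have "\<dots> \<le> liminf (\<lambda>k. \<integral>\<^sup>+x. ennreal (exp (l * (X k x - m k))) \<partial>M)" by (rule nn_integral_liminf) measurable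
    also have "\<dots> \<le> liminf (\<lambda>k. ennreal (exp (\<Phi> l)))"
    proof (intro Liminf_mono always_eventually allI)
      fix k
      have "integrable M (\<lambda>x. exp (l * (X k x - m k)))" by (intro bounded_measurable_integrable bounded_measurable_intros bX)
      then show "(\<integral>\<^sup>+x. ennreal (exp (l * (X k x - m k))) \<partial>M) \<le> ennreal (exp (\<Phi> l))"
        using centred[of l k] by (subst nn_integral_eq_integral) (auto intro: ennreal_leI)
    qed
    finally show ?thesis by (simp add: Liminf_const)
  qed
qed

lemma (in prob_space) Chernoff_two_sided:
  fixes f :: "'a \<Rightarrow> real"
  assumes [measurable]: "f \<in> borel_measurable M"
    and L: "(\<integral>\<^sup>+x. ennreal (exp (l * (f x - e))) \<partial>M) \<le> ennreal C"
      "(\<integral>\<^sup>+x. ennreal (exp (- l * (f x - e))) \<partial>M) \<le> ennreal C"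
    and l: "l \<ge> 0" and C: "C \<ge> 0"
  shows "measure M {x \<in> space M. t \<le> \<bar>f x - e\<bar>} \<le> 2 * (exp (- (l * t)) * C)"
proof -
  have one: "measure M {x \<in> space M. t \<le> h x} \<le> exp (- (l * t)) * C"
    if [measurable]: "h \<in> borel_measurable M" and h: "(\<integral>\<^sup>+x. ennreal (exp (l * h x)) \<partial>M) \<le> ennreal C" for h :: "'a \<Rightarrow> real"
  proof -
    have "emeasure M {x \<in> space M. t \<le> h x} = (\<integral>\<^sup>+x. indicator {x \<in> space M. t \<le> h x} x \<partial>M)"
      by (subst nn_integral_indicator) auto
    also have "\<dots> \<le> (\<integral>\<^sup>+x. ennreal (exp (- (l * t))) * ennreal (exp (l * h x)) \<partial>M)"
    proof (rule nn_integral_mono)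
      fix x
      have "1 \<le> exp (- (l * t)) * exp (l * h x)" if "t \<le> h x"
        using mult_left_mono[OF that l] by (simp flip: exp_add)
      then show "indicator {x \<in> space M. t \<le> h x} x \<le> ennreal (exp (- (l * t))) * ennreal (exp (l * h x))"
        by (auto simp: indicator_def simp flip: ennreal_mult ennreal_1 intro!: ennreal_leI)
    qed
    also have "\<dots> = ennreal (exp (- (l * t))) * (\<integral>\<^sup>+x. ennreal (exp (l * h x)) \<partial>M)"
      by (rule nn_integral_cmult) measurable
    also have "\<dots> \<le> ennreal (exp (- (l * t))) * ennreal C" by (intro mult_left_mono h) auto
    also have "\<dots> = ennreal (exp (- (l * t)) * C)" using C by (simp add: ennreal_mult)
    finally show ?thesis using C by (simp add: emeasure_eq_measure)
  qed
  have "measure M {x \<in> space M. t \<le> \<bar>f x - e\<bar>}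
     \<le> measure M ({x \<in> space M. t \<le> f x - e} \<union> {x \<in> space M. t \<le> - (f x - e)})"
    by (intro finite_measure_mono) auto
  also have "\<dots> \<le> measure M {x \<in> space M. t \<le> f x - e} + measure M {x \<in> space M. t \<le> - (f x - e)}"
    by (intro measure_Un_le) auto
  also have "\<dots> \<le> exp (- (l * t)) * C + exp (- (l * t)) * C"
    using L by (intro add_mono one) (auto simp: algebra_simps)
  finally show ?thesis by (simp add: mult_ac)
qed

lemma abs_tanh_le: "\<bar>tanh (x::real)\<bar> \<le> \<bar>x\<bar>"
proof -
  have "tanh y \<le> y" if "y \<ge> 0" for y :: real
  proof -
    have "(\<lambda>y. y - tanh y) 0 \<le> (\<lambda>y. y - tanh y) y"
    proof (rule DERIV_nonneg_imp_nondecreasing[OF that])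
      fix z :: real
      have "((\<lambda>y. y - tanh y) has_real_derivative 1 - (1 - (tanh z)\<^sup>2)) (at z)"
        by (intro DERIV_diff DERIV_ident DERIV_tanh_real)
      then show "\<exists>D. ((\<lambda>y. y - tanh y) has_real_derivative D) (at z) \<and> 0 \<le> D" by force
    qed
    then show ?thesis by simp
  qed
  from this[of "\<bar>x\<bar>"] show ?thesis by simp
qed

lemma scaled_tanh_limit: "(\<lambda>k. real (Suc k) * tanh (y / real (Suc k))) \<longlonglongrightarrow> y"
proof -
  have d: "((\<lambda>h. tanh h / h) \<longlongrightarrow> (1::real)) (at 0)"
    using DERIV_tanh_real[of 0] unfolding DERIV_def by simp
  show ?thesis
  proof (cases "y = 0")
    case False
    have "(\<lambda>k. y / real (Suc k)) \<longlonglongrightarrow> 0" by (rule LIMSEQ_Suc[OF lim_const_over_n])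
    then have "filterlim (\<lambda>k. y / real (Suc k)) (at 0) sequentially"
      using False by (intro filterlim_atI) auto
    from filterlim_compose[OF d this]
    have "(\<lambda>k. y * (tanh (y / real (Suc k)) / (y / real (Suc k)))) \<longlonglongrightarrow> y * 1" by (intro tendsto_intros)
    then show ?thesis using False by (simp add: mult.commute)
  qed simp
qed

context LO_space begin

text \<open>
  The function \<open>y \<mapsto> l T tanh(y/T)\<close> has derivative at most \<open>|l|\<close> in absolute value, so composing
  with it multiplies both gradient norms by at most \<open>|l|\<close>.
\<close>

lemma Laplace_truncated:
  fixes f :: "(nat \<Rightarrow> real) \<Rightarrow> real"
  assumes f: "smooth (d * n) f"
    and a: "\<And>x. x \<in> Rn (d * n) \<Longrightarrow> grad_norm (d * n) f x \<le> a"
    and b: "\<And>x. x \<in> Rn (d * n) \<Longrightarrow> norm_p2 d n (2 / s) (grad (d * n) f x) \<le> b"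
    and T: "T > 0"
  shows "(\<integral>x. exp (l * (T * tanh (f x / T))) \<partial>power_measure d n \<mu>)
    \<le> exp (l * (\<integral>x. T * tanh (f x / T) \<partial>power_measure d n \<mu>) + 2 * (mls_const * (l\<^sup>2 * a\<^sup>2 + (\<bar>l\<bar> * b) powr (2 / s))))"
proof -
  define \<phi> where "\<phi> y = l * (T * tanh (y / T))" for y
  define \<phi>' where "\<phi>' y = l * (1 - (tanh (y / T))\<^sup>2)" for y
  have D: "(\<phi> has_real_derivative \<phi>' y) (at y)" for y
  proof -
    have "((\<lambda>y. tanh (y / T)) has_real_derivative (1 - (tanh (y / T))\<^sup>2) * (1 / T)) (at y)"
      by (rule DERIV_chain2[OF DERIV_tanh_real DERIV_cdivide[OF DERIV_ident]])
    then have "((\<lambda>y. l * (T * tanh (y / T))) has_real_derivative l * (T * ((1 - (tanh (y / T))\<^sup>2) * (1 / T)))) (at y)"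
      by (intro DERIV_cmult)
    then show ?thesis using T by (simp add: \<phi>_def[abs_def] \<phi>'_def)
  qed
  have \<phi>': "\<bar>\<phi>' y\<bar> \<le> \<bar>l\<bar>" for y
  proof -
    have "(tanh (y / T))\<^sup>2 \<le> 1" using tanh_real_bounds[of "y / T"] by (simp add: abs_square_le_1 abs_le_iff)
    then have "\<bar>1 - (tanh (y / T))\<^sup>2\<bar> \<le> 1" by simp
    then show ?thesis unfolding \<phi>'_def abs_mult using mult_left_mono[of _ 1 "\<bar>l\<bar>"] by simp
  qed
  have s': "smooth (d * n) (\<lambda>x. \<phi> (f x))"
  proof -
    have "smooth (d * n) (\<lambda>x. l * (T * tanh (1 / T * f x)))" by (intro smooth_mult smooth_const smooth_tanh f)
    then show ?thesis by (simp add: \<phi>_def)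
  qed
  have "(\<integral>x. exp (\<phi> (f x)) \<partial>power_measure d n \<mu>)
    \<le> exp ((\<integral>x. \<phi> (f x) \<partial>power_measure d n \<mu>) + 2 * (mls_const * ((\<bar>l\<bar> * a)\<^sup>2 + (\<bar>l\<bar> * b) powr (2 / s))))"
  proof (rule Laplace_bounded[OF s', where B="\<bar>l\<bar> * T"])
    fix x :: "nat \<Rightarrow> real" assume x: "x \<in> Rn (d * n)"
    have "\<bar>tanh (f x / T)\<bar> \<le> 1" using tanh_real_bounds[of "f x / T"] by (simp add: abs_le_iff)
    then show "\<bar>\<phi> (f x)\<bar> \<le> \<bar>l\<bar> * T" unfolding \<phi>_def abs_mult using T by (intro mult_left_mono) auto
    show "grad_norm (d * n) (\<lambda>x. \<phi> (f x)) x \<le> \<bar>l\<bar> * a"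
      unfolding norm_grad_comp[OF f x D] using \<phi>' a[OF x] grad_norm_nonneg by (intro mult_mono) auto
    show "norm_p2 d n (2 / s) (grad (d * n) (\<lambda>x. \<phi> (f x)) x) \<le> \<bar>l\<bar> * b"
      unfolding grad_comp[OF f x D] using s \<phi>' b[OF x] norm_p2_nonneg
      by (subst norm_p2_scale) (auto intro!: mult_mono)
  qed
  then show ?thesis by (simp add: \<phi>_def power_mult_distrib)
qed

theorem concentration:
  fixes f :: "(nat \<Rightarrow> real) \<Rightarrow> real"
  assumes f: "smooth (d * n) f"
    and a: "\<And>x. x \<in> Rn (d * n) \<Longrightarrow> grad_norm (d * n) f x \<le> a"
    and b: "\<And>x. x \<in> Rn (d * n) \<Longrightarrow> norm_p2 d n (2 / s) (grad (d * n) f x) \<le> b"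
    and l: "l \<ge> 0"
  shows "measure (power_measure d n \<mu>) {x \<in> Rn (d * n). t \<le> \<bar>f x - (\<integral>y. f y \<partial>power_measure d n \<mu>)\<bar>}
    \<le> 2 * exp (- (l * t) + 2 * (mls_const * (l\<^sup>2 * a\<^sup>2 + (l * b) powr (2 / s))))"
proof -
  let ?P = "power_measure d n \<mu>"
  interpret P: prob_space ?P by (rule prob_space_power)
  define X where "X k x = real (Suc k) * tanh (f x / real (Suc k))" for k x
  define \<Phi> where "\<Phi> l = 2 * (mls_const * (l\<^sup>2 * a\<^sup>2 + (\<bar>l\<bar> * b) powr (2 / s)))" for l
  have fm: "f \<in> borel_measurable ?P"
    using continuous_on_Rn_measurable[OF smooth_continuous[OF f]] measurable_cong_sets[OF sets_power refl] by blast
  have tm: "tanh \<in> borel_measurable (borel :: real measure)"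
    by (intro borel_measurable_continuous_onI) (meson DERIV_tanh_real DERIV_isCont continuous_at_imp_continuous_on)
  have bX: "bounded_measurable ?P (X k)" for k
  proof (rule bounded_measurableI[where B="real (Suc k)"])
    show "X k \<in> borel_measurable ?P"
      unfolding X_def by (intro borel_measurable_times borel_measurable_const measurable_compose[OF _ tm] borel_measurable_divide fm)
    show "\<bar>X k x\<bar> \<le> real (Suc k)" for x
      unfolding X_def abs_mult using tanh_real_bounds[of "f x / real (Suc k)"]
      by (simp add: abs_le_iff mult_le_cancel_left1)
  qed
  have XL: "(\<integral>x. exp (l * X k x) \<partial>?P) \<le> exp (l * (\<integral>x. X k x \<partial>?P) + \<Phi> l)" for k l
    unfolding X_def \<Phi>_def by (rule Laplace_truncated[OF f a b]) auto
  have Xle: "\<bar>X k x\<bar> \<le> \<bar>f x\<bar>" for k x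
  proof -
    have "real (Suc k) * \<bar>tanh (f x / real (Suc k))\<bar> \<le> real (Suc k) * \<bar>f x / real (Suc k)\<bar>"
      by (rule mult_left_mono[OF abs_tanh_le]) simp
    then have "\<bar>X k x\<bar> \<le> real (Suc k) * \<bar>f x / real (Suc k)\<bar>"
      unfolding X_def abs_mult by simp
    then show ?thesis by simp
  qed
  have Xlim: "(\<lambda>k. X k x) \<longlonglongrightarrow> f x" for x unfolding X_def by (rule scaled_tanh_limit)
  have nn: "(\<integral>\<^sup>+x. ennreal (exp (l * (f x - (\<integral>y. f y \<partial>?P)))) \<partial>?P) \<le> ennreal (exp (\<Phi> l))" for l
    by (rule P.Laplace_limit(2)[OF fm bX Xle Xlim XL])
  have ev: "\<Phi> (- l) = \<Phi> l" by (simp add: \<Phi>_def)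
  have "measure ?P {x \<in> space ?P. t \<le> \<bar>f x - (\<integral>y. f y \<partial>?P)\<bar>} \<le> 2 * (exp (- (l * t)) * exp (\<Phi> l))"
    using nn[of l] nn[of "- l"] l by (intro P.Chernoff_two_sided fm) (simp_all add: ev)
  then show ?thesis using l by (simp add: space_power \<Phi>_def flip: exp_add)
qed

end

section \<open>The two-level concentration inequality\<close>

text \<open>
  A positive lower bound on the fraction excludes an infinite supremum, for which the fraction
  is \<open>0\<close>, and clears the denominator.
\<close>

lemma ennreal_le_divideD:
  assumes "ennreal w \<le> ennreal u / (ennreal C * S)" "0 < w" "0 < C" "0 \<le> u"
  shows "S < \<infinity>" "w * (C * enn2real S) \<le> u"
proof -
  show S: "S < \<infinity>"
  proof (rule ccontr)
    assume "\<not> S < \<infinity>"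
    then have "ennreal C * S = \<infinity>" using assms(3) by (simp add: ennreal_mult_top less_top[symmetric])
    then show False using assms(1,2) by simp
  qed
  define z where "z = enn2real S"
  have z: "z \<ge> 0" "S = ennreal z" using S by (simp_all add: z_def)
  show "w * (C * enn2real S) \<le> u"
  proof (cases "z = 0")
    case True
    then show ?thesis using assms by (simp add: z_def)
  next
    case False
    then have Cz: "C * z > 0" using z assms by simp
    have "ennreal w \<le> ennreal u / ennreal (C * z)" using assms z by (simp add: ennreal_mult)
    also have "\<dots> = ennreal (u / (C * z))" using assms(4) Cz by (rule divide_ennreal)
    finally have "w \<le> u / (C * z)" using assms Cz by (simp add: ennreal_le_iff)
    then show ?thesis using Cz by (simp add: z_def field_simps)
  qed
qed

text \<open>
  Choosing \<open>l = w/t\<close> makes the linear gain \<open>l t\<close> equal to \<open>w\<close>, while each of the two hypotheses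
  on \<open>w\<close> says that the corresponding error term is at most \<open>w/C\<close>; with \<open>C \<ge> 8K\<close> at least half of the
  gain remains.
\<close>

lemma exponent_optimisation:
  fixes t w K C a b r p :: real
  assumes "0 < t" "0 < w" "0 \<le> K" "8 * K \<le> C" "0 < C" "0 \<le> a" "0 \<le> b" and r: "1 < r" and p: "1 / r + 1 / p = 1"
    and a: "w * (C * a\<^sup>2) \<le> t\<^sup>2" and b: "w * (C powr (r - 1) * b powr r) \<le> t powr r"
  shows "- (w / t * t) + 2 * (K * ((w / t)\<^sup>2 * a\<^sup>2 + (w / t * b) powr p)) \<le> - (w / 2)"
proof -
  have "(w / t)\<^sup>2 * a\<^sup>2 = w / C * (w * (C * a\<^sup>2)) / t\<^sup>2"
    using assms(1,2,5) by (simp add: power2_eq_square field_simps)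
  also have "\<dots> \<le> w / C * t\<^sup>2 / t\<^sup>2"
    using assms(1,2,5) a by (intro divide_right_mono mult_left_mono) auto
  also have "\<dots> = w / C" using assms(1) by simp
  finally have 1: "(w / t)\<^sup>2 * a\<^sup>2 \<le> w / C" .
  have "1 / p = (r - 1) / r" using p r by (simp add: field_simps)
  have "p = 1 / (1 / p)" by simp
  also have "\<dots> = r / (r - 1)" unfolding \<open>1 / p = (r - 1) / r\<close> by simp
  finally have p_eq: "p = r / (r - 1)" .
  have "(w / t * b) powr r = w powr r * b powr r / t powr r"
    using assms(1,2,7) by (simp add: powr_mult powr_divide)
  also have "\<dots> = (w / C) powr (r - 1) * (w * (C powr (r - 1) * b powr r)) / t powr r"
  proof -
    have "w powr r = w powr (r - 1) * w" using assms(2) by (simp add: powr_diff)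
    then show ?thesis using assms(2,5) by (simp add: powr_divide)
  qed
  also have "\<dots> \<le> (w / C) powr (r - 1) * t powr r / t powr r"
    using b by (intro divide_right_mono mult_left_mono) auto
  also have "\<dots> = (w / C) powr (r - 1)" using assms(1) by simp
  finally have "((w / t * b) powr r) powr (1 / (r - 1)) \<le> ((w / C) powr (r - 1)) powr (1 / (r - 1))"
    using r by (intro powr_mono2) auto
  then have 2: "(w / t * b) powr p \<le> w / C"
    using r assms(2,5) by (simp add: powr_powr p_eq)
  have "2 * (K * ((w / t)\<^sup>2 * a\<^sup>2 + (w / t * b) powr p)) \<le> 2 * (K * (w / C + w / C))"
    using 1 2 assms(3) by (intro mult_left_mono add_mono) auto
  also have "\<dots> = (4 * K / C) * w" by simp
  also have "\<dots> \<le> (1 / 2) * w" using assms(2,4,5) by (intro mult_right_mono) (auto simp: field_simps)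
  finally show ?thesis using assms(1) by simp
qed

text \<open>
  Testing against all real \<open>w\<close> below \<open>W\<close> treats finite and infinite \<open>W\<close> alike: if \<open>W = \<infinity>\<close>
  (a vanishing gradient) the bound tends to \<open>0\<close>.
\<close>

lemma le_exp_minus_half:
  assumes "\<And>w. 0 \<le> w \<Longrightarrow> ennreal w \<le> W \<Longrightarrow> q \<le> 2 * exp (- (w / 2))"
  shows "q \<le> 2 * exp_minus ((1 / 2) * W)"
proof (cases "W = \<infinity>")
  case True
  have "((\<lambda>w. 2 * exp (- (w / 2))) \<longlongrightarrow> 2 * (0::real)) at_top"
    by (intro tendsto_intros filterlim_compose[OF exp_at_bot] filterlim_compose[OF filterlim_uminus_at_bot_at_top])
       (rule filterlim_at_top_mult_tendsto_pos[of "\<lambda>_. 1/2" "1/2", simplified], auto intro: filterlim_ident)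
  moreover have "\<forall>\<^sub>F w in at_top. q \<le> 2 * exp (- (w / 2))"
    using eventually_ge_at_top[of 0] by eventually_elim (use assms True in auto)
  ultimately have "q \<le> 2 * 0" by (rule tendsto_lowerbound) simp
  moreover have "(1 / 2) * W = \<infinity>" using True by (simp add: ennreal_mult_top divide_eq_0_iff)
  ultimately show ?thesis by (simp add: exp_minus_def)
next
  case False
  define w where "w = enn2real W"
  have w: "w \<ge> 0" "W = ennreal w" using False by (simp_all add: w_def less_top)
  have "(1 / 2) * W = W / 2" by (simp add: divide_ennreal_def mult.commute)
  also have "\<dots> = ennreal (w / 2)" using divide_ennreal[of w 2] w by simp
  finally have "(1 / 2) * W = ennreal (w / 2)" .
  then have "exp_minus ((1 / 2) * W) = exp (- (w / 2))" using w by (simp add: exp_minus_def)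
  then show ?thesis using assms[of w] w by simp
qed

theorem corollary2p2:
  fixes r r' :: real and C_LO :: ennreal
  assumes "1 < r" and "r < 2" and "1 / r + 1 / r' = 1" and "C_LO < \<infinity>"
  shows "\<exists>C::real. C > 0 \<and>
    (\<forall>(d::nat) (\<mu> :: (nat \<Rightarrow> real) measure).
       0 < d \<and> prob_measure_on_Rn d \<mu> \<and> LO_inequality d r C_LO \<mu> \<longrightarrow>
       (\<forall>(n::nat) (f :: (nat \<Rightarrow> real) \<Rightarrow> real) (t::real).
          0 < n \<and> smooth (d * n) f \<and> 0 < t \<longrightarrow>
          measure (power_measure d n \<mu>)
            {x \<in> Rn (d * n). \<bar>f x - (\<integral>y. f y \<partial>power_measure d n \<mu>)\<bar> \<ge> t}
          \<le> 2 * exp_minus ((1 / 2) *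
              min (ennreal (t\<^sup>2) /
                     (ennreal C *
                      (SUP x\<in>Rn (d * n). ennreal ((euclid_norm (d * n) (grad (d * n) f x))\<^sup>2))))
                  (ennreal (t powr r) /
                     (ennreal (C powr (r - 1)) *
                      (SUP x\<in>Rn (d * n). ennreal (norm_p2 d n r' (grad (d * n) f x) powr r)))))))"
proof -
  define K where "K = LO_space.mls_const r C_LO"
  \<comment> \<open>The truncation at \<open>0\<close> makes \<open>C\<close> positive before any measure is given; the constant is nonnegative
    once one satisfies the hypothesis.\<close>
  define C where "C = 8 * max 0 K + 1"
  show ?thesis
  proof (intro exI[of _ C] conjI allI impI)
    show C0: "C > 0" unfolding C_def by simp
    fix d n :: nat and \<mu> :: "(nat \<Rightarrow> real) measure" and f :: "(nat \<Rightarrow> real) \<Rightarrow> real" and t :: real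
    assume \<mu>: "0 < d \<and> prob_measure_on_Rn d \<mu> \<and> LO_inequality d r C_LO \<mu>"
      and f: "0 < n \<and> smooth (d * n) f \<and> 0 < t"
    interpret prob_space \<mu> using \<mu> by (simp add: prob_measure_on_Rn_def)
    interpret LO_space \<mu> d r C_LO
      using \<mu> assms by unfold_locales (auto simp: prob_measure_on_Rn_def)
    interpret P: prob_space "power_measure d n \<mu>" by (rule prob_space_power)
    have r': "2 / s = r'"
    proof -
      have "s = 2 * (1 / r')" using assms(3) unfolding s_def by simp
      then show ?thesis by simp
    qed
    have KC: "0 \<le> K" "8 * K \<le> C" using mls_const_nonneg unfolding K_def C_def by auto
    define q where "q = measure (power_measure d n \<mu>)
            {x \<in> Rn (d * n). \<bar>f x - (\<integral>y. f y \<partial>power_measure d n \<mu>)\<bar> \<ge> t}"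
    define S1 where "S1 = (SUP x\<in>Rn (d * n). ennreal ((grad_norm (d * n) f x)\<^sup>2))"
    define S2 where "S2 = (SUP x\<in>Rn (d * n). ennreal (norm_p2 d n r' (grad (d * n) f x) powr r))"
    have main: "q \<le> 2 * exp (- (w / 2))"
      if w0: "0 \<le> w" and w: "ennreal w \<le> min (ennreal (t\<^sup>2) / (ennreal C * S1)) (ennreal (t powr r) / (ennreal (C powr (r - 1)) * S2))" for w
    proof (cases "w = 0")
      case True
      have "q \<le> 1" unfolding q_def by (rule P.prob_le_1)
      then show ?thesis using True by simp
    next
      case False
      then have w0: "w > 0" using w0 by simp
      have w1: "S1 < \<infinity>" "w * (C * enn2real S1) \<le> t\<^sup>2"
        using w w0 C0 ennreal_le_divideD[of w "t\<^sup>2" C S1] by auto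
      have w2: "S2 < \<infinity>" "w * (C powr (r - 1) * enn2real S2) \<le> t powr r"
        using w w0 C0 ennreal_le_divideD[of w "t powr r" "C powr (r - 1)" S2] by auto
      define a where "a = sqrt (enn2real S1)"
      define b where "b = enn2real S2 powr (1 / r)"
      have ab: "a \<ge> 0" "b \<ge> 0" "a\<^sup>2 = enn2real S1" "b powr r = enn2real S2"
        using assms(1) by (auto simp: a_def b_def powr_powr)
      have a: "grad_norm (d * n) f x \<le> a" if "x \<in> Rn (d * n)" for x
      proof -
        have "ennreal ((grad_norm (d * n) f x)\<^sup>2) \<le> S1" unfolding S1_def using that by (intro SUP_upper)
        also have "S1 = ennreal (enn2real S1)" using w1 by simp
        finally have "(grad_norm (d * n) f x)\<^sup>2 \<le> enn2real S1" by (simp add: ennreal_le_iff)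
        then show ?thesis unfolding a_def by (rule real_le_rsqrt)
      qed
      have b: "norm_p2 d n (2 / s) (grad (d * n) f x) \<le> b" if "x \<in> Rn (d * n)" for x
      proof -
        have "ennreal (norm_p2 d n r' (grad (d * n) f x) powr r) \<le> S2" unfolding S2_def using that by (intro SUP_upper)
        also have "S2 = ennreal (enn2real S2)" using w2 by simp
        finally have "norm_p2 d n r' (grad (d * n) f x) powr r \<le> enn2real S2" by (simp add: ennreal_le_iff)
        then have "(norm_p2 d n r' (grad (d * n) f x) powr r) powr (1 / r) \<le> b"
          unfolding b_def using assms(1) by (intro powr_mono2) auto
        then show ?thesis using assms(1) norm_p2_nonneg by (simp add: powr_powr r')
      qed
      have "q \<le> 2 * exp (- (w / t * t) + 2 * (K * ((w / t)\<^sup>2 * a\<^sup>2 + (w / t * b) powr r')))"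
        using concentration[of n f a b "w / t" t, OF _ a b] f w0 unfolding q_def K_def r' by simp
      also have "\<dots> \<le> 2 * exp (- (w / 2))"
        using f w0 KC C0 ab assms(1,3) w1 w2
        by (intro mult_left_mono exp_le_cancel_iff[THEN iffD2] exponent_optimisation[where C=C and r=r]) auto
      finally show ?thesis .
    qed
    from le_exp_minus_half[OF this]
    show "measure (power_measure d n \<mu>)
            {x \<in> Rn (d * n). \<bar>f x - (\<integral>y. f y \<partial>power_measure d n \<mu>)\<bar> \<ge> t}
          \<le> 2 * exp_minus ((1 / 2) *
              min (ennreal (t\<^sup>2) /
                     (ennreal C *
                      (SUP x\<in>Rn (d * n). ennreal ((euclid_norm (d * n) (grad (d * n) f x))\<^sup>2))))
                  (ennreal (t powr r) /
                     (ennreal (C powr (r - 1)) *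
                      (SUP x\<in>Rn (d * n). ennreal (norm_p2 d n r' (grad (d * n) f x) powr r)))))"
      unfolding q_def S1_def S2_def .
  qed
qed

end
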